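(* An element $h=\sum_{\mu\in\mathbf Y,\,w\in W}h_{w,\mu}\cdot\mathsf D^\mu[w]\in\ddot{\mathsf H}$ belongs to the spherical subalgebra $\mathbf e\ddot{\mathsf H}\mathbf e$ if and only if, for any $i=1,\dots,l$ (and all $w\in W$, $\mu\in\mathbf Y$), we have: (i) $h_{s_iw,\,s_i\mu}=s_i(h_{w,\mu})$; (ii) $h_{ws_i,\mu}=h_{w,\mu}\cdot\mathsf D^\mu w\!\left(\dfrac{\mathbf t^2e^{\alpha_i}-1}{e^{\alpha_i}-\mathbf t^2}\right)$.
   Context: Let $\Delta$ be a finite reduced irreducible root system with Weyl group $W$, simple roots $\alpha_1,\dots,\alpha_l$, simple reflections $s_1,\dots,s_l$ and length function $l(w)$. Let $\mathbf X$ be the root lattice, $\mathbf Y$ the coweight lattice, $\langle\,,\rangle:\mathbf X\times\mathbf Y\to\mathbb Z$ the natural pairing, $T=\mathbb C^*\otimes_{\mathbb Z}\mathbf Y$; $e^\lambda$ is the function on $T$ given by $\lambda\in\mathbf X$. Let $\dot T=T\times\mathbb C^*$, and $\mathbf q$ the function on $\dot T$ given by the second projection; $\mathbf t$ is a further independent parameter. For an affine root $\beta+k\delta$ put $e^{\beta+k\delta}=\mathbf q^{2k}e^\beta$; let $\alpha_0=\delta-\theta$ with $\theta$ the highest root. For $\mu\in\mathbf Y$ the $\mathbf q$-shift operator $\mathsf D^\mu$ acts on functions by $(\mathsf D^\mu f)(\tau)=f(\mathbf q^{2\mu}\cdot\tau)$, $\tau\in T$, fixing $\mathbf q,\mathbf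 t$. $W$ acts by $[w]:e^\lambda\mapsto e^{w(\lambda)}$, fixing $\mathbf q,\mathbf t$. The operators $\mathsf D^\mu[w]$ realize the (extended) affine Weyl group $\dot W=W\ltimes\mathbf Y$, which acts on affine roots compatibly with $\beta+k\delta\mapsto e^{\beta+k\delta}$. Let $s_0\in\dot W$ be the reflection in $\alpha_0$, and $\Omega\subset\dot W$ the subgroup of elements permuting $\{\alpha_0,\dots,\alpha_l\}$. The double-affine Hecke (Cherednik) algebra $\ddot{\mathsf H}$ is the subalgebra of the $\mathbb C[\mathbf t^{\pm1}]$-linear endomorphisms of $\mathbb C(\dot T)[\mathbf t^{\pm1}]$ generated by multiplications by elements of $\mathbb C[\dot T]$ and $\mathbb C[\mathbf t^{\pm1}]$, by the operators $$\hat{\mathsf T}_i=\mathbf t\,s_i+\frac{\mathbf t-\mathbf t^{-1}}{e^{\alpha_i}-1}(s_i-1),\qquad i=0,1,\dots,l,$$ and by the elements of $\Omega$. Every element of $\ddot{\mathsf H}$ is written uniquely as a finite sum $h=\sum h_{w,\mu}\mathsf D^\mu[w]$ with $h_{w,\mu}\in\mathbb C(\dot T)[\mathbf t^{\pm1}]$. The finite Hecke algebra $\mathsf H\subset\ddot{\mathsf H}$ is generated over $\mathbb C[\mathbf t^{\pm1}]$ by $\mathsf T_i=\hat{\mathsf T}_i$, $i=1,\dots,l$, which satisfy the braid relations and $(\mathsf T_i-\mathbf t)(\mathsf T_i+\mathbf t^{-1})=0$; $\mathsf T_w=\mathsf T_{i_1}\cdots\mathsf T_{i_r}$ for a reduced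 decomposition $w=s_{i_1}\cdots s_{i_r}$. Put $W(\mathbf t)=\sum_{w\in W}\mathbf t^{2l(w)}$ and $\mathbf e=\frac1{W(\mathbf t)}\sum_{w\in W}\mathbf t^{l(w)}\mathsf T_w$, an idempotent (where $W(\mathbf t)$ is understood to be inverted). The spherical subalgebra is $\mathbf e\ddot{\mathsf H}\mathbf e=\mathbf e\cdot\ddot{\mathsf H}\cdot\mathbf e$. *)

theory Defs
  imports
    "HOL-Analysis.Analysis"
    "HOL-Library.Poly_Mapping"
    "HOL-Library.Option_ord"
    "HOL-Library.FuncSet"
    "HOL-Computational_Algebra.Fraction_Field"
begin

section \<open>Root systems\<close>

text \<open>
  Root systems live in a Euclidean space, which is identified with its dual through the inner
  product; coroots and coweights are therefore vectors of the same space and the pairing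
  between the root lattice and the coweight lattice is the inner product.
\<close>

definition coroot :: "'v::euclidean_space \<Rightarrow> 'v" where
  "coroot \<beta> = (2 / (\<beta> \<bullet> \<beta>)) *\<^sub>R \<beta>"

definition reflect :: "'v::euclidean_space \<Rightarrow> 'v \<Rightarrow> 'v" where
  "reflect \<beta> v = v - (v \<bullet> coroot \<beta>) *\<^sub>R \<beta>"

definition reduced_root_system :: "'v::euclidean_space set \<Rightarrow> bool" where
  "reduced_root_system \<Delta> \<longleftrightarrow>
     finite \<Delta> \<and> 0 \<notin> \<Delta> \<and> span \<Delta> = UNIV \<and>
     (\<forall>\<beta>\<in>\<Delta>. reflect \<beta> ` \<Delta> = \<Delta>) \<and>
     (\<forall>\<beta>\<in>\<Delta>. \<forall>\<gamma>\<in>\<Delta>. \<gamma> \<bullet> coroot \<beta> \<in> \<int>) \<and>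
     (\<forall>\<beta>\<in>\<Delta>. \<forall>r. r *\<^sub>R \<beta> \<in> \<Delta> \<longrightarrow> r = 1 \<or> r = -1)"

definition irreducible_root_system :: "'v::euclidean_space set \<Rightarrow> bool" where
  "irreducible_root_system \<Delta> \<longleftrightarrow>
     reduced_root_system \<Delta> \<and> \<Delta> \<noteq> {} \<and>
     (\<forall>\<Delta>1 \<Delta>2. \<Delta> = \<Delta>1 \<union> \<Delta>2 \<and> (\<forall>\<beta>\<in>\<Delta>1. \<forall>\<gamma>\<in>\<Delta>2. \<beta> \<bullet> \<gamma> = 0) \<longrightarrow> \<Delta>1 = {} \<or> \<Delta>2 = {})"

text \<open>
  The simple roots are enumerated by a finite type \<open>'n\<close>, the rank being \<open>CARD('n)\<close>. Its linear
  order (the numbering of the simple roots) serves only to make the group algebra below an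
  integral domain by the library's type class instances.
\<close>

definition simple_system :: "'v::euclidean_space set \<Rightarrow> ('n::finite \<Rightarrow> 'v) \<Rightarrow> bool" where
  "simple_system \<Delta> \<alpha> \<longleftrightarrow>
     inj \<alpha> \<and> range \<alpha> \<subseteq> \<Delta> \<and> independent (range \<alpha>) \<and>
     (\<forall>\<beta>\<in>\<Delta>. \<exists>m :: 'n \<Rightarrow> nat. \<beta> = (\<Sum>i\<in>UNIV. real (m i) *\<^sub>R \<alpha> i) \<or>
                             \<beta> = - (\<Sum>i\<in>UNIV. real (m i) *\<^sub>R \<alpha> i))"

inductive_set weyl :: "'v::euclidean_space set \<Rightarrow> ('v \<Rightarrow> 'v) set" for \<Delta> where
  weyl_id: "id \<in> weyl \<Delta>"
| weyl_reflect: "\<beta> \<in> \<Delta> \<Longrightarrow> w \<in> weyl \<Delta> \<Longrightarrow> reflect \<beta> \<circ> w \<in> weyl \<Delta>"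

definition coweight_lattice :: "'v::euclidean_space set \<Rightarrow> 'v set" where
  "coweight_lattice \<Delta> = {\<mu>. \<forall>\<beta>\<in>\<Delta>. \<beta> \<bullet> \<mu> \<in> \<int>}"

definition highest_root :: "'v::euclidean_space set \<Rightarrow> ('n::finite \<Rightarrow> 'v) \<Rightarrow> 'v" where
  "highest_root \<Delta> \<alpha> =
     (THE \<theta>. \<theta> \<in> \<Delta> \<and> (\<forall>\<beta>\<in>\<Delta>. \<exists>m :: 'n \<Rightarrow> nat. \<theta> - \<beta> = (\<Sum>i\<in>UNIV. real (m i) *\<^sub>R \<alpha> i)))"

definition word_prod :: "('n \<Rightarrow> 'v::euclidean_space) \<Rightarrow> 'n list \<Rightarrow> 'v \<Rightarrow> 'v" where
  "word_prod \<alpha> is = foldr (\<lambda>i w. reflect (\<alpha> i) \<circ> w) is id"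

definition weyl_length :: "('n \<Rightarrow> 'v::euclidean_space) \<Rightarrow> ('v \<Rightarrow> 'v) \<Rightarrow> nat" where
  "weyl_length \<alpha> w = (LEAST r. \<exists>is. length is = r \<and> word_prod \<alpha> is = w)"

text \<open>An affine root \<open>\<beta> + k\<delta>\<close> is the pair \<open>(\<beta>, k)\<close>.\<close>

definition simple_affine_roots ::
  "'v::euclidean_space set \<Rightarrow> ('n::finite \<Rightarrow> 'v) \<Rightarrow> ('v \<times> int) set" where
  "simple_affine_roots \<Delta> \<alpha> = insert (- highest_root \<Delta> \<alpha>, 1) (range (\<lambda>i. (\<alpha> i, 0)))"

text \<open>
  The action on affine roots of the element of the extended affine Weyl group realized by
  \<open>D\<^sup>\<mu>[w]\<close>: since \<open>D\<^sup>\<mu>[w] e\<^sup>\<beta> = q\<^bsup>2\<langle>w\<beta>,\<mu>\<rangle>\<^esup> e\<^bsup>w\<beta>\<^esup>\<close>, it sends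
  \<open>\<beta> + k\<delta>\<close> to \<open>w\<beta> + (k + \<langle>w\<beta>,\<mu>\<rangle>)\<delta>\<close>.
\<close>

definition affine_act :: "('v::euclidean_space \<Rightarrow> 'v) \<Rightarrow> 'v \<Rightarrow> 'v \<times> int \<Rightarrow> 'v \<times> int" where
  "affine_act w \<mu> = (\<lambda>(\<beta>, k). (w \<beta>, k + \<lfloor>w \<beta> \<bullet> \<mu>\<rfloor>))"

definition Omega ::
  "'v::euclidean_space set \<Rightarrow> ('n::finite \<Rightarrow> 'v) \<Rightarrow> (('v \<Rightarrow> 'v) \<times> 'v) set" where
  "Omega \<Delta> \<alpha> = {(w, \<mu>) \<in> weyl \<Delta> \<times> coweight_lattice \<Delta>.
     affine_act w \<mu> ` simple_affine_roots \<Delta> \<alpha> = simple_affine_roots \<Delta> \<alpha>}"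


section \<open>Rational functions\<close>

text \<open>
  The root lattice is free on the simple roots, so the coordinate ring of \<open>T \<times> \<complex>\<^sup>* \<times> \<complex>\<^sup>*\<close> (with \<open>q\<close>
  and \<open>t\<close> the last two coordinates) is the group algebra of the free abelian group with basis
  \<open>'n option option\<close>: \<open>None\<close> is the exponent of \<open>t\<close>, \<open>Some None\<close> that of \<open>q\<close>, and
  \<open>Some (Some i)\<close> the coefficient of the simple root \<open>\<alpha> i\<close>. Its field of fractions \<open>\<complex>(T \<times> \<complex>\<^sup>*)(t)\<close>
  contains all the functions used here.
\<close>

type_synonym 'n expo = "'n option option \<Rightarrow>\<^sub>0 int"
type_synonym 'n laurent = "'n expo \<Rightarrow>\<^sub>0 complex"
type_synonym 'n ratfun = "'n laurent fract"

definition of_laurent :: "'n::{finite,linorder} laurent \<Rightarrow> 'n ratfun" where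
  "of_laurent p = Fraction_Field.Fract p 1"

definition const_fun :: "complex \<Rightarrow> 'n::{finite,linorder} ratfun" where
  "const_fun a = of_laurent (Poly_Mapping.single 0 a)"

definition tvar :: "'n::{finite,linorder} ratfun" where
  "tvar = of_laurent (Poly_Mapping.single (Poly_Mapping.single None 1) 1)"

definition qvar :: "'n::{finite,linorder} ratfun" where
  "qvar = of_laurent (Poly_Mapping.single (Poly_Mapping.single (Some None) 1) 1)"

definition expo_of :: "('n::{finite,linorder} \<Rightarrow> 'v::euclidean_space) \<Rightarrow> 'v \<Rightarrow> 'n expo" where
  "expo_of \<alpha> v =
     (\<Sum>i\<in>UNIV. Poly_Mapping.single (Some (Some i)) \<lfloor>representation (range \<alpha>) v (\<alpha> i)\<rfloor>)"

definition expo_vec :: "('n::{finite,linorder} \<Rightarrow> 'v::euclidean_space) \<Rightarrow> 'n expo \<Rightarrow> 'v" where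
  "expo_vec \<alpha> x = (\<Sum>i\<in>UNIV. of_int (Poly_Mapping.lookup x (Some (Some i))) *\<^sub>R \<alpha> i)"

definition efun :: "('n::{finite,linorder} \<Rightarrow> 'v::euclidean_space) \<Rightarrow> 'v \<Rightarrow> 'n ratfun" where
  "efun \<alpha> v = of_laurent (Poly_Mapping.single (expo_of \<alpha> v) 1)"

definition efun_affine ::
  "('n::{finite,linorder} \<Rightarrow> 'v::euclidean_space) \<Rightarrow> 'v \<times> int \<Rightarrow> 'n ratfun" where
  "efun_affine \<alpha> = (\<lambda>(\<beta>, k). qvar powi (2 * k) * efun \<alpha> \<beta>)"

text \<open>
  Both the Weyl group and the \<open>q\<close>-shifts act by automorphisms that permute the monomials.
  \<open>monomial_subst g\<close> is the extension to fractions of the linear map sending the monomial with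
  exponent \<open>x\<close> to the one with exponent \<open>g x\<close>; it is well defined when \<open>g\<close> is an automorphism
  of the exponent group.
\<close>

definition push_expo ::
  "('n::{finite,linorder} expo \<Rightarrow> 'n expo) \<Rightarrow> 'n laurent \<Rightarrow> 'n laurent" where
  "push_expo g p = (\<Sum>x\<in>Poly_Mapping.keys p. Poly_Mapping.single (g x) (Poly_Mapping.lookup p x))"

definition monomial_subst ::
  "('n::{finite,linorder} expo \<Rightarrow> 'n expo) \<Rightarrow> 'n ratfun \<Rightarrow> 'n ratfun" where
  "monomial_subst g f =
     (THE f'. \<exists>a b. b \<noteq> 0 \<and> f = Fraction_Field.Fract a b \<and>
                    f' = Fraction_Field.Fract (push_expo g a) (push_expo g b))"

definition weyl_op ::
  "('n::{finite,linorder} \<Rightarrow> 'v::euclidean_space) \<Rightarrow> ('v \<Rightarrow> 'v) \<Rightarrow> 'n ratfun \<Rightarrow> 'n ratfun" where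
  "weyl_op \<alpha> w = monomial_subst (\<lambda>x.
     expo_of \<alpha> (w (expo_vec \<alpha> x))
     + Poly_Mapping.single (Some None) (Poly_Mapping.lookup x (Some None))
     + Poly_Mapping.single None (Poly_Mapping.lookup x None))"

text \<open>
  From \<open>(D\<^sup>\<mu> f)(\<tau>) = f(q\<^bsup>2\<mu>\<^esup>\<tau>)\<close> one gets \<open>D\<^sup>\<mu> e\<^sup>\<lambda> = q\<^bsup>2\<langle>\<lambda>,\<mu>\<rangle>\<^esup> e\<^sup>\<lambda>\<close>; the floor is taken of
  an integer when \<open>\<mu>\<close> is a coweight.
\<close>

definition shift_op ::
  "('n::{finite,linorder} \<Rightarrow> 'v::euclidean_space) \<Rightarrow> 'v \<Rightarrow> 'n ratfun \<Rightarrow> 'n ratfun" where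
  "shift_op \<alpha> \<mu> = monomial_subst (\<lambda>x.
     x + Poly_Mapping.single (Some None) (2 * \<lfloor>expo_vec \<alpha> x \<bullet> \<mu>\<rfloor>))"

text \<open>The coordinate ring \<open>\<complex>[T \<times> \<complex>\<^sup>*]\<close> and its field of fractions: no \<open>t\<close> occurs.\<close>

definition torus_ring :: "'n::{finite,linorder} ratfun set" where
  "torus_ring = of_laurent ` {p. \<forall>x\<in>Poly_Mapping.keys p. Poly_Mapping.lookup x None = 0}"

definition torus_field :: "'n::{finite,linorder} ratfun set" where
  "torus_field = {a / b | a b. a \<in> torus_ring \<and> b \<in> torus_ring \<and> b \<noteq> 0}"

definition laurent_in_t :: "'n::{finite,linorder} ratfun set \<Rightarrow> 'n ratfun set" where
  "laurent_in_t F = {\<Sum>k\<in>S. f k * tvar powi k | S f. finite S \<and> (\<forall>k\<in>S. f k \<in> F)}"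

definition scalar_ring :: "'n::{finite,linorder} ratfun set" where
  "scalar_ring = laurent_in_t (range const_fun)"

definition weyl_poly ::
  "'v::euclidean_space set \<Rightarrow> ('n::{finite,linorder} \<Rightarrow> 'v) \<Rightarrow> 'n ratfun" where
  "weyl_poly \<Delta> \<alpha> = (\<Sum>w\<in>weyl \<Delta>. tvar ^ (2 * weyl_length \<alpha> w))"

definition invert_weyl_poly ::
  "'v::euclidean_space set \<Rightarrow> ('n::{finite,linorder} \<Rightarrow> 'v) \<Rightarrow> 'n ratfun set \<Rightarrow> 'n ratfun set" where
  "invert_weyl_poly \<Delta> \<alpha> B = {b / weyl_poly \<Delta> \<alpha> ^ n | b n. b \<in> B}"

text \<open>
  The module \<open>\<complex>(T \<times> \<complex>\<^sup>*)[t\<^sup>\<plusminus>\<^sup>1]\<close> on which all operators act, with \<open>W(t)\<close> inverted because the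
  idempotent \<open>e\<close> involves \<open>1 / W(t)\<close>.
\<close>

definition fun_module ::
  "'v::euclidean_space set \<Rightarrow> ('n::{finite,linorder} \<Rightarrow> 'v) \<Rightarrow> 'n ratfun set" where
  "fun_module \<Delta> \<alpha> = invert_weyl_poly \<Delta> \<alpha> (laurent_in_t torus_field)"


section \<open>The double affine Hecke algebra\<close>

text \<open>
  Endomorphisms of \<open>fun_module\<close> are represented by extensional functions, and their product
  is \<^const>\<open>compose\<close>.
\<close>

definition mult_op ::
  "'v::euclidean_space set \<Rightarrow> ('n::{finite,linorder} \<Rightarrow> 'v) \<Rightarrow> 'n ratfun \<Rightarrow> 'n ratfun \<Rightarrow> 'n ratfun"
  where
  "mult_op \<Delta> \<alpha> a = (\<lambda>f\<in>fun_module \<Delta> \<alpha>. a * f)"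

text \<open>
  The reflection in the affine root \<open>\<beta> + k\<delta>\<close> sends \<open>\<lambda> + m\<delta>\<close> to
  \<open>\<lambda> + m\<delta> - \<langle>\<lambda>,\<beta>\<^sup>\<or>\<rangle>(\<beta> + k\<delta>) = s\<^sub>\<beta>\<lambda> + (m + \<langle>s\<^sub>\<beta>\<lambda>, k\<beta>\<^sup>\<or>\<rangle>)\<delta>\<close>,
  so it is realized by \<open>D\<^sup>\<mu>[s\<^sub>\<beta>]\<close> with \<open>\<mu> = k\<beta>\<^sup>\<or>\<close>.
\<close>

definition affine_reflect_op ::
  "('n::{finite,linorder} \<Rightarrow> 'v::euclidean_space) \<Rightarrow> 'v \<times> int \<Rightarrow> 'n ratfun \<Rightarrow> 'n ratfun" where
  "affine_reflect_op \<alpha> = (\<lambda>(\<beta>, k). shift_op \<alpha> (of_int k *\<^sub>R coroot \<beta>) \<circ> weyl_op \<alpha> (reflect \<beta>))"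

definition T_op ::
  "'v::euclidean_space set \<Rightarrow> ('n::{finite,linorder} \<Rightarrow> 'v) \<Rightarrow> 'v \<times> int \<Rightarrow> 'n ratfun \<Rightarrow> 'n ratfun"
  where
  "T_op \<Delta> \<alpha> a = (\<lambda>f\<in>fun_module \<Delta> \<alpha>.
     tvar * affine_reflect_op \<alpha> a f
     + (tvar - inverse tvar) / (efun_affine \<alpha> a - 1) * (affine_reflect_op \<alpha> a f - f))"

text \<open>
  The algebra generated over the ring of scalars \<open>A\<close>. For \<open>A = scalar_ring = \<complex>[t\<^sup>\<plusminus>\<^sup>1]\<close> this is the
  double affine Hecke algebra itself, for \<open>A = invert_weyl_poly \<Delta> \<alpha> scalar_ring\<close> the algebra
  obtained from it by inverting \<open>W(t)\<close>.
\<close>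

inductive_set daha ::
  "'v::euclidean_space set \<Rightarrow> ('n::{finite,linorder} \<Rightarrow> 'v) \<Rightarrow> 'n ratfun set
     \<Rightarrow> ('n ratfun \<Rightarrow> 'n ratfun) set"
  for \<Delta> \<alpha> A where
  daha_torus: "p \<in> torus_ring \<Longrightarrow> mult_op \<Delta> \<alpha> p \<in> daha \<Delta> \<alpha> A"
| daha_scalar: "a \<in> A \<Longrightarrow> mult_op \<Delta> \<alpha> a \<in> daha \<Delta> \<alpha> A"
| daha_T: "a \<in> simple_affine_roots \<Delta> \<alpha> \<Longrightarrow> T_op \<Delta> \<alpha> a \<in> daha \<Delta> \<alpha> A"
| daha_Omega: "(w, \<mu>) \<in> Omega \<Delta> \<alpha> \<Longrightarrow>
    (\<lambda>f\<in>fun_module \<Delta> \<alpha>. shift_op \<alpha> \<mu> (weyl_op \<alpha> w f)) \<in> daha \<Delta> \<alpha> A"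
| daha_add: "g \<in> daha \<Delta> \<alpha> A \<Longrightarrow> h \<in> daha \<Delta> \<alpha> A \<Longrightarrow>
    (\<lambda>f\<in>fun_module \<Delta> \<alpha>. g f + h f) \<in> daha \<Delta> \<alpha> A"
| daha_mult: "g \<in> daha \<Delta> \<alpha> A \<Longrightarrow> h \<in> daha \<Delta> \<alpha> A \<Longrightarrow>
    compose (fun_module \<Delta> \<alpha>) g h \<in> daha \<Delta> \<alpha> A"

definition T_word ::
  "'v::euclidean_space set \<Rightarrow> ('n::{finite,linorder} \<Rightarrow> 'v) \<Rightarrow> 'n list \<Rightarrow> 'n ratfun \<Rightarrow> 'n ratfun"
  where
  "T_word \<Delta> \<alpha> is =
     foldr (\<lambda>i X. compose (fun_module \<Delta> \<alpha>) (T_op \<Delta> \<alpha> (\<alpha> i, 0)) X) is (mult_op \<Delta> \<alpha> 1)"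

text \<open>By the braid relations \<open>T_weyl\<close> does not depend on the chosen reduced decomposition.\<close>

definition T_weyl ::
  "'v::euclidean_space set \<Rightarrow> ('n::{finite,linorder} \<Rightarrow> 'v) \<Rightarrow> ('v \<Rightarrow> 'v) \<Rightarrow> 'n ratfun \<Rightarrow> 'n ratfun"
  where
  "T_weyl \<Delta> \<alpha> w =
     T_word \<Delta> \<alpha> (SOME is. word_prod \<alpha> is = w \<and> length is = weyl_length \<alpha> w)"

definition sph_idem ::
  "'v::euclidean_space set \<Rightarrow> ('n::{finite,linorder} \<Rightarrow> 'v) \<Rightarrow> 'n ratfun \<Rightarrow> 'n ratfun" where
  "sph_idem \<Delta> \<alpha> = (\<lambda>f\<in>fun_module \<Delta> \<alpha>.
     1 / weyl_poly \<Delta> \<alpha> * (\<Sum>w\<in>weyl \<Delta>. tvar ^ weyl_length \<alpha> w * T_weyl \<Delta> \<alpha> w f))"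

definition spherical ::
  "'v::euclidean_space set \<Rightarrow> ('n::{finite,linorder} \<Rightarrow> 'v) \<Rightarrow> 'n ratfun set
     \<Rightarrow> ('n ratfun \<Rightarrow> 'n ratfun) set" where
  "spherical \<Delta> \<alpha> A =
     {compose (fun_module \<Delta> \<alpha>) (sph_idem \<Delta> \<alpha>) (compose (fun_module \<Delta> \<alpha>) g (sph_idem \<Delta> \<alpha>))
       | g. g \<in> daha \<Delta> \<alpha> A}"

definition coeff_support ::
  "'v::euclidean_space set \<Rightarrow> (('v \<Rightarrow> 'v) \<Rightarrow> 'v \<Rightarrow> 'n::{finite,linorder} ratfun)
     \<Rightarrow> (('v \<Rightarrow> 'v) \<times> 'v) set" where
  "coeff_support \<Delta> c = {(w, \<mu>) \<in> weyl \<Delta> \<times> coweight_lattice \<Delta>. c w \<mu> \<noteq> 0}"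

end

theory Submission
  imports Defs
begin

text \<open>
  Everything rests on the identity \<open>T\<^sub>i - t = u\<^sub>i (s\<^sub>i - 1)\<close> with
  \<open>u\<^sub>i = (t e\<^bsup>\<alpha>\<^sub>i\<^esup> - t\<^sup>-\<^sup>1) / (e\<^bsup>\<alpha>\<^sub>i\<^esup> - 1)\<close>. It turns \<open>T\<^sub>i h = t h\<close> into \<open>s\<^sub>i h = h\<close>, and
  \<open>h T\<^sub>i = t h\<close> into the statement that \<open>h\<close> kills all functions \<open>u\<^sub>i (s\<^sub>i f - f)\<close>. Write \<open>h\<close> as a
  combination of the operators \<open>D\<^sup>\<mu>[w]\<close>. These are distinct ring automorphisms that permute the
  monomials, so they are linearly independent by Artin's theorem on characters, and comparing
  coefficients turns \<open>s\<^sub>i h = h\<close> into (i) and the second statement into (ii): the fraction in (ii)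
  is \<open>u\<^sub>i / s\<^sub>i(u\<^sub>i)\<close> (lemmas \<open>invariant_iff\<close>, \<open>annihilates_iff\<close>, \<open>hecke_factor_ratio\<close>).

  It remains to see that the elements of the spherical subalgebra are those with
  \<open>T\<^sub>i h = t h = h T\<^sub>i\<close> for all \<open>i\<close> (lemma \<open>spherical_iff_invariant\<close>). If these equations hold, then
  \<open>T\<^sub>w h = t\<^bsup>l(w)\<^esup> h = h T\<^sub>w\<close> for all \<open>w\<close>, so \<open>e h e = h\<close>. Conversely, \<open>h = e g e\<close> inherits them from
  \<open>T\<^sub>i e = t e = e T\<^sub>i\<close>, which follows by pairing \<open>w\<close> with \<open>s\<^sub>i w\<close> or \<open>w s\<^sub>i\<close> in the sum that defines
  \<open>e\<close> (lemmas \<open>T_Sym\<close>, \<open>Sym_T\<close>). This needs \<open>T\<^sub>i T\<^sub>w = T\<^bsub>s\<^sub>i w\<^esub>\<close> whenever the length increases, that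
  is, it needs that \<open>T\<^sub>w\<close> is independent of the reduced word from which it is built. That is
  Matsumoto's theorem, proved here from the exchange property, combined with the braid relations
  of the \<open>T\<^sub>i\<close>.

  The braid relations are checked in the four systems of rank 2. Put \<open>E\<^sub>i = T\<^sub>i + t\<^sup>-\<^sup>1\<close>. For a dihedral
  group of order \<open>2m\<close> the difference of the two alternating products of \<open>m\<close> operators \<open>T\<close> is
  \<open>Q\<^sub>i\<^sub>j - Q\<^sub>j\<^sub>i\<close>, where \<open>Q\<^sub>i\<^sub>j\<close> is an explicit polynomial in \<open>E\<^sub>i\<close> and \<open>E\<^sub>j\<close>. Both polynomials turn out to be
  the symmetrizer \<open>f \<mapsto> \<Sum>\<^sub>w w(\<Prod>\<^sub>\<beta> m\<^sub>\<beta> \<cdot> f)\<close>, the product being over the positive roots, with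
  \<open>m\<^sub>\<beta> = (t\<^sup>-\<^sup>1 e\<^sup>\<beta> - t) / (e\<^sup>\<beta> - 1)\<close>. This works because \<open>m\<^sub>\<beta>\<close> is an affine function of a
  hyperbolic cotangent, which is odd and satisfies an addition theorem.

  One more piece of root combinatorics is needed: the highest root exists. Without it the
  operators attached to \<open>\<alpha>\<^sub>0\<close> would not be known to preserve the module of functions, and products
  of such operators could not be evaluated.
\<close>

section \<open>Braid relations of Demazure--Lusztig operators in rank 2\<close>

text \<open>
  Two reflections \<open>s\<close>, \<open>r\<close> act by field automorphisms; \<open>h\<close> stands for \<open>t + t\<^sup>-\<^sup>1\<close>, and \<open>i\<close>, \<open>j\<close> for the
  functions \<open>m\<^sub>\<beta> = (t\<^sup>-\<^sup>1 e\<^sup>\<beta> - t) / (e\<^sup>\<beta> - 1)\<close> of the two simple roots, for which \<open>m\<^bsub>-\<beta>\<^esub> = h - m\<^sub>\<beta>\<close>. In the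
  lemmas below \<open>a\<close>, \<open>b\<close>, \<open>c\<close>, \<open>d\<close> are the same functions for the other positive roots of the rank 2
  system.
\<close>
locale hecke_pair =
  fixes s r :: "'a::field \<Rightarrow> 'a" and h i j :: 'a
  assumes s_add: "s (f + g) = s f + s g" and s_mult: "s (f * g) = s f * s g" and s_invol: "s (s f) = f"
    and r_add: "r (f + g) = r f + r g" and r_mult: "r (f * g) = r f * r g" and r_invol: "r (r f) = f"
    and s_h: "s h = h" and r_h: "r h = h" and s_i: "s i = h - i" and r_j: "r j = h - j"
begin

lemma s_diff: "s (f - g) = s f - s g"
  using s_add[of "f - g" g] by simp
lemma r_diff: "r (f - g) = r f - r g"
  using r_add[of "f - g" g] by simp
lemma s_1: "s 1 = 1"
  by (metis mult_1 mult_cancel_right2 s_invol s_mult mult.right_neutral)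
lemma r_1: "r 1 = 1"
  by (metis mult_1 mult_cancel_right2 r_invol r_mult mult.right_neutral)
lemma s_numeral: "s (numeral n) = numeral n"
  by (induction n) (simp_all only: numeral.simps s_add s_1)
lemma r_numeral: "r (numeral n) = numeral n"
  by (induction n) (simp_all only: numeral.simps r_add r_1)

lemmas hom = s_add s_mult s_diff s_h s_i s_invol s_1 s_numeral r_add r_mult r_diff r_h r_j r_invol r_1 r_numeral

text \<open>
  The operators \<open>T + t\<^sup>-\<^sup>1\<close> for the two Demazure--Lusztig operators \<open>T\<close>. Up to the factor \<open>h\<close> they
  are idempotent, and their values are invariant under \<open>s\<close> and \<open>r\<close>, respectively.
\<close>
definition "E f = i * f + (h - i) * s f"
definition "D f = j * f + (h - j) * r f"

lemma swap: "hecke_pair r s h j i"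
  by unfold_locales (fact hom)+

lemma E_linear: "E (f + g) = E f + E g" "E (f - g) = E f - E g" "s a = a \<Longrightarrow> E (a * f) = a * E f"
  by (simp_all add: E_def hom algebra_simps)
lemma D_linear: "D (f + g) = D f + D g" "D (f - g) = D f - D g" "r a = a \<Longrightarrow> D (a * f) = a * D f"
  by (simp_all add: D_def hom algebra_simps)
lemma E_E: "E (E f) = h * E f" and D_D: "D (D f) = h * D f"
  by (simp_all add: E_def D_def hom algebra_simps)
lemma r_D: "r (D f) = D f"
  by (simp add: D_def hom algebra_simps)

text \<open>
  For each dihedral group one polynomial in \<open>E\<close> and \<open>D\<close> is computed explicitly. The result, a sum over
  all group elements \<open>w\<close> of \<open>w\<close> applied to the product of all \<open>m\<^sub>\<beta>\<close> with \<open>\<beta>\<close> positive times the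
  argument, does not distinguish between \<open>s\<close> and \<open>r\<close>.
\<close>
lemma symmetrizer_commute2:
  assumes "s j = j" "r i = i" "s (r f) = r (s f)"
  shows "E (D f) = D (E f)"
  unfolding E_def D_def by (simp add: hom assms algebra_simps)

lemma symmetrizer3:
  assumes perm: "s j = a" "s a = j" "r i = a" "r a = i"
    and id: "i*j + (h-j)*a - 1 = a*i"
  shows "D (E (D g)) - D g = i*j*a*g + (h-i)*a*j* s g + i*a*(h-j) * r g
     + (h-i)*j*(h-a) * s (r g) + (h-a)*i*(h-j) * r (s g) + (h-i)*(h-j)*(h-a) * r (s (r g))"
proof -
  define f where "f = D g"
  have rf: "r f = f" by (simp add: f_def r_D)
  have "D (E f) - f = (i*j + (h-j)*a - 1)*f + j*(h-i)* s f + (h-j)*(h-a)* r (s f)"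
    unfolding E_def D_def by (simp add: hom perm rf algebra_simps)
  then show ?thesis unfolding id
    unfolding f_def D_def[of g] by (simp add: hom perm algebra_simps)
qed

text \<open>
  All the polynomials end in \<open>D\<close>, so that it is enough to apply the rest to an \<open>r\<close>-invariant \<open>f\<close>, whose
  orbit has only half as many members as the group. Since the image is \<open>s\<close>-invariant, the coefficients
  come in pairs exchanged by \<open>s\<close>.
\<close>
lemma invariant_orbit4:
  assumes perm: "s j = b" "s b = j" "s a = a" "r i = a" "r a = i" "r b = b"
    and f: "r f = f" "s f = f1" "r f1 = f2" "s f2 = f3" "r f3 = f3"
    and id: "j*i + (h-j)*a + (h-i)*b - 2 = a*b"
  shows "E (D (E f)) - 2 * E f = i*a*b*f + (h-i)*a*j*f1 + (h-a)*i*(h-j)*f2 + (h-a)*(h-i)*(h-b)*f3"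
proof -
  have f': "s f1 = f" "r f2 = f1" "s f3 = f2"
    using f by (metis s_invol r_invol)+
  define x0 where "x0 = i*(j*i + (h-j)*a + (h-i)*b)"
  have e1: "E f = i * f + (h-i) * f1" by (simp add: E_def f)
  have e2: "D (E f) = (j*i + (h-j)*a) * f + j*(h-i) * f1 + (h-j)*(h-a)*f2"
    unfolding e1 by (simp add: D_def hom perm f f' algebra_simps)
  have e3: "E (D (E f)) = x0 * f + s x0 * f1 + i*(h-j)*(h-a) * f2 + (h-i)*(h-b)*(h-a) * f3"
    unfolding e2 by (simp add: E_def x0_def hom perm f f' algebra_simps)
  have x0: "x0 = i*a*b + 2 * i" using id by (simp add: x0_def algebra_simps)
  show ?thesis unfolding e3 unfolding x0 e1 by (simp add: hom perm algebra_simps)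
qed

lemma symmetrizer4:
  assumes perm: "s j = b" "s b = j" "s a = a" "r i = a" "r a = i" "r b = b"
    and word: "\<And>f. s (r (s (r f))) = r (s (r (s f)))"
    and id: "j*i + (h-j)*a + (h-i)*b - 2 = a*b"
  shows "E (D (E (D g))) - 2 * E (D g) = i*j*a*b*g + (h-i)*a*j*b* s g + i*a*b*(h-j)* r g + (h-a)*i*(h-j)*b* r (s g)
    + (h-i)*a*j*(h-b)* s (r g) + (h-a)*(h-i)*(h-b)*j* s (r (s g)) + (h-a)*(h-j)*(h-b)*i* r (s (r g))
    + (h-a)*(h-i)*(h-b)*(h-j) * s (r (s (r g)))"
proof -
  define f where "f = D g"
  have rf: "r f = f" by (simp add: f_def r_D)
  have l: "r (s (r (s f))) = s (r (s f))" using word[of f] rf by metis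
  have f0: "f = j * g + (h - j) * r g" by (simp add: f_def D_def)
  have "E (D (E f)) - 2 * E f = i*a*b*f + (h-i)*a*j* s f + (h-a)*i*(h-j)* r (s f) + (h-a)*(h-i)*(h-b)* s (r (s f))"
    by (rule invariant_orbit4) (use perm rf l id in \<open>simp_all\<close>)
  then show ?thesis
    unfolding f_def D_def[of g] by (simp add: hom perm algebra_simps)
qed

lemma invariant_orbit6:
  assumes perm: "s j = b" "s b = j" "s a = c" "s c = a" "s d = d" "r i = a" "r a = i" "r b = d" "r d = b" "r c = c"
    and f: "r f = f" "s f = f1" "r f1 = f2" "s f2 = f3" "r f3 = f4" "s f4 = f5" "r f5 = f5"
    and id1: "(j*i + (h-j)*a + (h-i)*b - 1) * (j*i + (h-j)*a + (h-i)*b - 3) + (h-j)*a*((h-a)*d - (h-i)*b)+(h-i)*(h-b)*b*c = a*b*c*d"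
    and id2: "(h-a)*d + (h-d)*c + a*(h-j) + j*i + (h-i)*b - 4 = b * c"
  shows "E (D (E (D (E f)))) - 4 * E (D (E f)) + 3 * E f =
     i*a*b*c*d*f + (h-i)*c*j*a*d*f1 + (h-a)*c*(h-j)*i*b*f2 + (h-c)*a*(h-b)*(h-i)*j*f3
     + (h-c)*i*(h-d)*(h-a)*(h-j)*f4 + (h-a)*(h-i)*(h-d)*(h-c)*(h-b)*f5"
proof -
  have f': "s f1 = f" "r f2 = f1" "s f3 = f2" "r f4 = f3" "s f5 = f4"
    using f by (metis s_invol r_invol)+
  define x0 where "x0 = i*(j*i + (h-j)*a + (h-i)*b)"
  define x1 where "x1 = s x0"
  define x2 where "x2 = i*(h-j)*(h-a)"
  define x3 where "x3 = (h-i)*(h-b)*(h-c)"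
  have e1: "E f = i * f + (h-i) * f1" by (simp add: E_def f)
  have e2: "D (E f) = (j*i + (h-j)*a) * f + j*(h-i) * f1 + (h-j)*(h-a)*f2"
    unfolding e1 by (simp add: D_def hom perm f f' algebra_simps)
  have e3: "E (D (E f)) = x0 * f + x1 * f1 + x2 * f2 + x3 * f3"
    unfolding e2 by (simp add: E_def x0_def x1_def x2_def x3_def hom perm f f' algebra_simps)
  have s3: "s x1 = x0" "s x2 = x3" "s x3 = x2" by (simp_all add: x0_def x1_def x2_def x3_def hom perm algebra_simps)
  define y0 where "y0 = j * x0 + (h-j) * r x0"
  define y1 where "y1 = j * x1 + (h-j) * r x2"
  define y2 where "y2 = j * x2 + (h-j) * r x1"
  define y3 where "y3 = j * x3"
  define y4 where "y4 = (h-j) * r x3"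
  have e4: "D (E (D (E f))) = y0 * f + y1 * f1 + y2 * f2 + y3 * f3 + y4 * f4"
    unfolding e3 by (simp add: D_def y0_def y1_def y2_def y3_def y4_def hom f f' algebra_simps)
  define z0 where "z0 = i * y0 + (h-i) * s y1"
  define z2 where "z2 = i * y2 + (h-i) * s y3"
  define z4 where "z4 = i * y4"
  have e5: "E (D (E (D (E f)))) = z0 * f + s z0 * f1 + z2 * f2 + s z2 * f3 + z4 * f4 + s z4 * f5"
    unfolding e4 by (simp add: E_def z0_def z2_def z4_def hom f f' algebra_simps)
  \<comment> \<open>The coefficients of \<open>f\<close>, \<open>f2\<close> and \<open>f4\<close> are computed through \<open>w\<close> and its images, those of \<open>f1\<close>,
    \<open>f3\<close> and \<open>f5\<close> by applying \<open>s\<close> to them.\<close>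
  define w where "w = j*i + (h-j)*a + (h-i)*b - 1"
  have w: "j*i + (h-j)*a + (h-i)*b = w + 1" unfolding w_def by simp
  have x0: "x0 = i * (w + 1)" by (simp add: x0_def w)
  have "r (j*i + (h-j)*a + (h-i)*b) = r (w + 1)" by (simp only: w)
  then have "(h-j)*a + j*i + (h-a)*d = r w + 1" by (simp add: hom perm)
  with w have rw: "r w = w + (h-a)*d - (h-i)*b" by algebra
  have y0': "y0 = j*i*(w+1) + (h-j)*a*(r w + 1)" unfolding y0_def x0 by (simp add: hom perm algebra_simps)
  have y1': "s y1 = b*i*(w+1) + (h-b)*c*b*i"
    unfolding y1_def x2_def by (simp add: hom perm s3 x0)
  have "z0 - 4 * x0 + 3 * i = i * (w*(w-2) + (h-j)*a*((h-a)*d - (h-i)*b)+(h-i)*(h-b)*b*c)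
     + i * (j*i + (h-j)*a + (h-i)*b - (w + 1)) * (w+1)"
    unfolding z0_def y0' y1' x0 rw by (simp add: algebra_simps)
  also have "\<dots> = i*(a*b*c*d)"
    using id1 unfolding w by simp
  finally have 0: "z0 - 4 * x0 + 3 * i = i*a*b*c*d" by (simp add: mult.assoc)
  have 2: "z2 - 4 * x2 = (h-a)*c*(h-j)*i*b"
  proof -
    have "s w + 1 = b*(h-i) + (h-b)*c + i*j"
      using arg_cong[OF w, of s] by (simp add: hom perm algebra_simps)
    from arg_cong[OF this, of r] have rsw: "r (s w) + 1 = d*(h-a) + (h-d)*c + a*(h-j)" by (simp add: hom perm)
    have y2: "y2 = j * x2 + (h-j) * (h-a) * (r (s w) + 1)"
      unfolding y2_def x1_def x0 by (simp add: hom perm algebra_simps)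
    have y3: "s y3 = b * x2" by (simp add: y3_def hom perm s3)
    have "z2 - 4 * x2 = x2 * ((h-a)*d + (h-d)*c + a*(h-j) + j*i + (h-i)*b - 4)"
      unfolding z2_def y2 y3 rsw by (simp add: x2_def algebra_simps)
    then show ?thesis unfolding id2 x2_def by (simp add: algebra_simps)
  qed
  have 4: "z4 = (h-c)*i*(h-d)*(h-a)*(h-j)"
    unfolding z4_def y4_def x3_def by (simp add: hom perm)
  have 1: "s z0 - 4 * x1 + 3 * (h-i) = (h-i)*c*j*a*d"
    using arg_cong[OF 0, of s] by (simp add: hom perm x1_def)
  have 3: "s z2 - 4 * x3 = (h-c)*a*(h-b)*(h-i)*j"
    using arg_cong[OF 2, of s] by (simp add: hom perm s3)
  have 5: "s z4 = (h-a)*(h-i)*(h-d)*(h-c)*(h-b)" unfolding 4 by (simp add: hom perm)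
  have "E (D (E (D (E f)))) - 4 * E (D (E f)) + 3 * E f = (z0 - 4 * x0 + 3 * i) * f
      + (s z0 - 4 * x1 + 3 * (h-i)) * f1 + (z2 - 4 * x2) * f2 + (s z2 - 4 * x3) * f3 + z4 * f4 + s z4 * f5"
    unfolding e5 unfolding e3 unfolding e1 by (simp add: algebra_simps)
  then show ?thesis unfolding 0 1 2 3 5 unfolding 4 .
qed

lemma symmetrizer6:
  assumes perm: "s j = b" "s b = j" "s a = c" "s c = a" "s d = d" "r i = a" "r a = i" "r b = d" "r d = b" "r c = c"
    and word: "\<And>f. s (r (s (r (s (r f))))) = r (s (r (s (r (s f)))))"
    and id1: "(j*i + (h-j)*a + (h-i)*b - 1) * (j*i + (h-j)*a + (h-i)*b - 3) + (h-j)*a*((h-a)*d - (h-i)*b)+(h-i)*(h-b)*b*c = a*b*c*d"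
    and id2: "(h-a)*d + (h-d)*c + a*(h-j) + j*i + (h-i)*b - 4 = b * c"
  shows "E (D (E (D (E (D g))))) - 4 * E (D (E (D g))) + 3 * E (D g) =
     i*a*b*c*d*(j * g + (h-j) * r g) + (h-i)*c*j*a*d*(b * s g + (h-b)* s (r g))
     + (h-a)*c*(h-j)*i*b*(d* r (s g) + (h-d) * r (s (r g)))
     + (h-c)*a*(h-b)*(h-i)*j*(d * s (r (s g)) + (h-d) * s (r (s (r g))))
     + (h-c)*i*(h-d)*(h-a)*(h-j)*(b * r (s (r (s g))) + (h-b) * r (s (r (s (r g)))))
     + (h-a)*(h-i)*(h-d)*(h-c)*(h-b)*(j * s (r (s (r (s g)))) + (h-j) * s (r (s (r (s (r g))))))"
proof -
  define f where "f = D g"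
  have rf: "r f = f" by (simp add: f_def r_D)
  have l: "r (s (r (s (r (s f))))) = s (r (s (r (s f))))" using word[of f] rf by metis
  have f0: "f = j * g + (h - j) * r g" by (simp add: f_def D_def)
  have f1: "s f = b * s g + (h-b)* s (r g)" by (simp add: f0 hom perm)
  have f2: "r (s f) = d* r (s g) + (h-d) * r (s (r g))" by (simp add: f1 hom perm)
  have f3: "s (r (s f)) = d * s (r (s g)) + (h-d) * s (r (s (r g)))" by (simp add: f2 hom perm)
  have f4: "r (s (r (s f))) = b * r (s (r (s g))) + (h-b) * r (s (r (s (r g))))" by (simp add: f3 hom perm)
  have f5: "s (r (s (r (s f)))) = j * s (r (s (r (s g)))) + (h-j) * s (r (s (r (s (r g)))))" by (simp add: f4 hom perm)
  have "E (D (E (D (E f)))) - 4 * E (D (E f)) + 3 * E f =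
     i*a*b*c*d*f + (h-i)*c*j*a*d* s f + (h-a)*c*(h-j)*i*b* r (s f) + (h-c)*a*(h-b)*(h-i)*j* s (r (s f))
     + (h-c)*i*(h-d)*(h-a)*(h-j)* r (s (r (s f))) + (h-a)*(h-i)*(h-d)*(h-c)*(h-b)* s (r (s (r (s f))))"
    by (rule invariant_orbit6) (use perm rf l id1 id2 in \<open>simp_all\<close>)
  then show ?thesis unfolding f0 [symmetric] f1[symmetric] f2[symmetric] f3[symmetric] f4[symmetric] f5[symmetric]
    by (simp add: f_def)
qed

definition "T k f = E f - k * f"
definition "S k f = D f - k * f"

context
  fixes k assumes k: "s k = k" "r k = k" "h * k = k * k + 1"
begin

lemma linear_scalars: "E (k * f) = k * E f" "D (k * f) = k * D f" "E (h * f) = h * E f" "D (h * f) = h * D f"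
  using k by (simp_all add: E_linear D_linear hom)

text \<open>
  Substituting \<open>T = E - k\<close>, \<open>S = D - k\<close> and using \<open>E\<^sup>2 = hE\<close>, \<open>D\<^sup>2 = hD\<close>, \<open>h = k + k\<^sup>-\<^sup>1\<close>, all monomials of the
  two braid words cancel except for those of the two symmetrizer polynomials.
\<close>
lemma braid_if_symmetrizers3:
  assumes "E (D (E f)) - E f = D (E (D f)) - D f"
  shows "T k (S k (T k f)) = S k (T k (S k f))"
  unfolding T_def S_def
  using assms k(3) by (simp add: E_linear D_linear linear_scalars E_E D_D, algebra)
lemma braid_if_symmetrizers4:
  assumes "E (D (E (D f))) - 2 * E (D f) = D (E (D (E f))) - 2 * D (E f)"
  shows "T k (S k (T k (S k f))) = S k (T k (S k (T k f)))"
  unfolding T_def S_def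
  using assms k(3) by (simp add: E_linear D_linear linear_scalars E_E D_D, algebra)
lemma braid_if_symmetrizers6:
  assumes "E (D (E (D (E (D f))))) - 4 * E (D (E (D f))) + 3 * E (D f)
    = D (E (D (E (D (E f))))) - 4 * D (E (D (E f))) + 3 * D (E f)"
  shows "T k (S k (T k (S k (T k (S k f))))) = S k (T k (S k (T k (S k (T k f)))))"
  unfolding T_def S_def
  using assms k(3) by (simp add: E_linear D_linear linear_scalars E_E D_D, algebra)
end

lemma braid2:
  assumes "s k = k" "r k = k" "s j = j" "r i = i" "\<And>f. s (r f) = r (s f)"
  shows "T k (S k f) = S k (T k f)"
  using symmetrizer_commute2[OF assms(3,4), of f] assms by (simp add: T_def S_def E_linear D_linear right_diff_distrib)

text \<open>
  The relations \<open>a (h - i - j) = 1 - i j\<close> below say that the root of \<open>a\<close> is the sum of those of \<open>i\<close>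
  and \<open>j\<close>. They generate the identities needed for the symmetrizer and for its mirror image under
  exchange of the two simple roots.
\<close>
lemma braid3:
  assumes k: "s k = k" "r k = k" "h * k = k * k + 1"
    and perm: "s j = a" "s a = j" "r i = a" "r a = i"
    and word: "\<And>f. s (r (s f)) = r (s (r f))"
    and id: "a * (h - i - j) = 1 - i * j"
  shows "T k (S k (T k f)) = S k (T k (S k f))"
proof (rule braid_if_symmetrizers3[OF k])
  interpret sw: hecke_pair r s h j i by (rule swap)
  have "sw.D (sw.E (sw.D f)) - sw.D f = D (E (D f)) - D f"
    by (subst sw.symmetrizer3[of a], (simp_all only: perm)[4], use id in \<open>algebra\<close>,
        subst symmetrizer3[of a], (simp_all only: perm)[4], use id in \<open>algebra\<close>, simp add: word algebra_simps)
  then show "E (D (E f)) - E f = D (E (D f)) - D f" by (simp add: sw.E_def sw.D_def E_def D_def)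
qed

lemma braid4:
  assumes k: "s k = k" "r k = k" "h * k = k * k + 1"
    and perm: "s j = b" "s b = j" "s a = a" "r i = a" "r a = i" "r b = b"
    and word: "\<And>f. s (r (s (r f))) = r (s (r (s f)))"
    and id: "b * (h - i - j) = 1 - i * j" "a * (h - b - j) = 1 - b * j"
  shows "T k (S k (T k (S k f))) = S k (T k (S k (T k f)))"
proof (rule braid_if_symmetrizers4[OF k])
  interpret sw: hecke_pair r s h j i by (rule swap)
  have 1: "j*i + (h-j)*a + (h-i)*b - 2 = a*b" using id by algebra
  have 2: "i*j + (h-i)*b + (h-j)*a - 2 = b*a" using id by algebra
  have "sw.E (sw.D (sw.E (sw.D f))) - 2 * sw.E (sw.D f) = E (D (E (D f))) - 2 * E (D f)"
    unfolding sw.symmetrizer4[OF perm(4,5,6,1,2,3) word[symmetric] 2] symmetrizer4[OF perm word 1] word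
    by (simp add: algebra_simps)
  then show "E (D (E (D f))) - 2 * E (D f) = D (E (D (E f))) - 2 * D (E f)" by (simp add: sw.E_def sw.D_def E_def D_def)
qed

lemma braid6:
  assumes k: "s k = k" "r k = k" "h * k = k * k + 1"
    and perm: "s j = b" "s b = j" "s a = c" "s c = a" "s d = d" "r i = a" "r a = i" "r b = d" "r d = b" "r c = c"
    and word: "\<And>f. s (r (s (r (s (r f))))) = r (s (r (s (r (s f)))))"
    and id: "b * (h - i - j) = 1 - i * j" "d * (h - b - j) = 1 - b * j" "a * (h - d - j) = 1 - d * j"
       "c * (h - i - a) = 1 - i * a" "c * (h - b - d) = 1 - b * d"
  shows "T k (S k (T k (S k (T k (S k f))))) = S k (T k (S k (T k (S k (T k f)))))"
proof (rule braid_if_symmetrizers6[OF k])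
  interpret sw: hecke_pair r s h j i by (rule swap)
  have 1: "(j*i + (h-j)*a + (h-i)*b - 1) * (j*i + (h-j)*a + (h-i)*b - 3) + (h-j)*a*((h-a)*d - (h-i)*b)+(h-i)*(h-b)*b*c = a*b*c*d"
    using id by algebra
  have 2: "(h-a)*d + (h-d)*c + a*(h-j) + j*i + (h-i)*b - 4 = b * c" using id by algebra
  have 3: "(i*j + (h-i)*b + (h-j)*a - 1) * (i*j + (h-i)*b + (h-j)*a - 3) + (h-i)*b*((h-b)*c - (h-j)*a)+(h-j)*(h-a)*a*d = b*a*d*c"
    using id by algebra
  have 4: "(h-b)*c + (h-c)*d + b*(h-i) + i*j + (h-j)*a - 4 = a * d" using id by algebra
  have "sw.E (sw.D (sw.E (sw.D (sw.E (sw.D f))))) - 4 * sw.E (sw.D (sw.E (sw.D f))) + 3 * sw.E (sw.D f)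
     = E (D (E (D (E (D f))))) - 4 * E (D (E (D f))) + 3 * E (D f)"
    unfolding sw.symmetrizer6[OF perm(6,7,8,9,10,1,2,3,4,5) word[symmetric] 3 4] symmetrizer6[OF perm word 1 2] word
    by (simp add: algebra_simps)
  then show "E (D (E (D (E (D f))))) - 4 * E (D (E (D f))) + 3 * E (D f)
    = D (E (D (E (D (E f))))) - 4 * D (E (D (E f))) + 3 * D (E f)" by (simp add: sw.E_def sw.D_def E_def D_def)
qed
end

section \<open>Simple reflections, lengths and the exchange property\<close>

lemma reflect_linear: "linear (reflect \<beta>)"
  by (rule linearI) (simp_all add: reflect_def inner_add_left scaleR_left_distrib algebra_simps)

lemma coroot_inner: "v \<bullet> coroot \<beta> = 2 * (v \<bullet> \<beta>) / (\<beta> \<bullet> \<beta>)"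
  by (simp add: coroot_def)

lemma coroot_self: "\<beta> \<noteq> 0 \<Longrightarrow> \<beta> \<bullet> coroot \<beta> = 2"
  by (simp add: coroot_inner)

lemma reflect_self: "\<beta> \<noteq> 0 \<Longrightarrow> reflect \<beta> \<beta> = - \<beta>"
  by (simp add: reflect_def coroot_self algebra_simps scaleR_2)

lemma reflect_reflect: "reflect \<beta> (reflect \<beta> v) = v"
proof (cases "\<beta> = 0")
  case False
  then show ?thesis by (simp add: reflect_def inner_diff_left coroot_self algebra_simps)
qed (simp add: reflect_def)

lemma reflect_comp_reflect: "reflect \<beta> \<circ> reflect \<beta> = id"
  by (simp add: fun_eq_iff reflect_reflect)

lemma reflect_adjoint: "reflect \<beta> v \<bullet> u = v \<bullet> reflect \<beta> u"
  by (simp add: reflect_def inner_diff_left inner_diff_right coroot_inner inner_commute)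

lemma reflect_isometry: "reflect \<beta> v \<bullet> reflect \<beta> u = v \<bullet> u"
  by (simp add: reflect_adjoint reflect_reflect)

lemma reflect_uminus: "reflect (- \<beta>) = reflect \<beta>"
  by (simp add: fun_eq_iff reflect_def coroot_def)

lemma reflect_conj:
  assumes "\<And>u v. g u \<bullet> g v = u \<bullet> v" "linear g"
  shows "reflect (g \<beta>) (g v) = g (reflect \<beta> v)"
  using assms by (simp add: reflect_def coroot_inner linear_diff linear_scale)

lemma word_prod_Nil [simp]: "word_prod \<alpha> [] = id"
  and word_prod_Cons [simp]: "word_prod \<alpha> (i # is) = reflect (\<alpha> i) \<circ> word_prod \<alpha> is"
  by (simp_all add: word_prod_def)

lemma word_prod_append: "word_prod \<alpha> (is @ js) = word_prod \<alpha> is \<circ> word_prod \<alpha> js"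
  by (induction "is") (simp_all add: fun_eq_iff)

lemma word_prod_rev: "word_prod \<alpha> (rev is) \<circ> word_prod \<alpha> is = id"
  by (induction "is") (simp_all add: word_prod_append fun_eq_iff reflect_reflect)

fun alt_word :: "'n \<Rightarrow> 'n \<Rightarrow> nat \<Rightarrow> 'n list" where
  "alt_word i j 0 = []"
| "alt_word i j (Suc k) = i # alt_word j i k"

lemma alt_word_snoc: "alt_word i j (Suc k) = alt_word i j k @ [if even k then i else j]"
  by (induction k arbitrary: i j) auto

locale root_datum =
  fixes \<Delta> :: "'v::euclidean_space set" and \<alpha> :: "'n::finite \<Rightarrow> 'v"
  assumes irreducible: "irreducible_root_system \<Delta>"
    and simple: "simple_system \<Delta> \<alpha>"
begin

lemma reduced: "reduced_root_system \<Delta>"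
  using irreducible by (simp add: irreducible_root_system_def)

lemma finite_roots: "finite \<Delta>" and zero_not_root: "0 \<notin> \<Delta>" and span_roots: "span \<Delta> = UNIV"
  and reflect_roots: "\<beta> \<in> \<Delta> \<Longrightarrow> reflect \<beta> ` \<Delta> = \<Delta>"
  and root_pairing: "\<beta> \<in> \<Delta> \<Longrightarrow> \<gamma> \<in> \<Delta> \<Longrightarrow> \<gamma> \<bullet> coroot \<beta> \<in> \<int>"
  and root_multiple: "\<beta> \<in> \<Delta> \<Longrightarrow> r *\<^sub>R \<beta> \<in> \<Delta> \<Longrightarrow> r = 1 \<or> r = -1"
  using reduced by (auto simp: reduced_root_system_def)

lemma reflect_root: "\<beta> \<in> \<Delta> \<Longrightarrow> \<gamma> \<in> \<Delta> \<Longrightarrow> reflect \<beta> \<gamma> \<in> \<Delta>"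
  using reflect_roots by blast

lemma uminus_root: "\<beta> \<in> \<Delta> \<Longrightarrow> - \<beta> \<in> \<Delta>"
  using reflect_root[of \<beta> \<beta>] reflect_self[of \<beta>] zero_not_root by metis

lemma inj_simple: "inj \<alpha>" and simple_root: "\<alpha> i \<in> \<Delta>" and indep: "independent (range \<alpha>)"
  using simple by (auto simp: simple_system_def)

lemma simple_nz: "\<alpha> i \<noteq> 0"
  using simple_root zero_not_root by metis

lemma root_nat_comb:
  assumes "\<beta> \<in> \<Delta>"
  obtains m :: "'n \<Rightarrow> nat" where "\<beta> = (\<Sum>i\<in>UNIV. real (m i) *\<^sub>R \<alpha> i)"
  | m :: "'n \<Rightarrow> nat" where "\<beta> = - (\<Sum>i\<in>UNIV. real (m i) *\<^sub>R \<alpha> i)"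
  using assms simple unfolding simple_system_def by blast

lemma sum_in_span: "(\<Sum>i\<in>UNIV. c i *\<^sub>R \<alpha> i) \<in> span (range \<alpha>)"
  by (intro span_sum span_scale span_base) auto

lemma span_simple: "span (range \<alpha>) = UNIV"
proof -
  have "\<Delta> \<subseteq> span (range \<alpha>)"
  proof
    fix \<beta> assume "\<beta> \<in> \<Delta>" then show "\<beta> \<in> span (range \<alpha>)"
      by (cases rule: root_nat_comb) (auto intro: sum_in_span span_neg)
  qed
  then show ?thesis using span_roots span_mono span_span by (metis top.extremum_uniqueI)
qed

definition cf :: "'n \<Rightarrow> 'v \<Rightarrow> real" where
  "cf i v = representation (range \<alpha>) v (\<alpha> i)"

lemma linear_cf: "linear (cf i)"
  unfolding cf_def by (rule linearI) (simp_all add: representation_add representation_scale indep span_simple)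

lemma cf_add: "cf i (u + v) = cf i u + cf i v" and cf_diff: "cf i (u - v) = cf i u - cf i v"
  and cf_scale: "cf i (c *\<^sub>R v) = c * cf i v" and cf_uminus: "cf i (- v) = - cf i v" and cf_0: "cf i 0 = 0"
  using linear_cf[of i] by (simp_all add: linear_add linear_diff linear_scale linear_neg linear_0)

lemma cf_simple: "cf i (\<alpha> j) = (if i = j then 1 else 0)"
  unfolding cf_def using inj_simple by (simp add: representation_basis indep inj_eq eq_commute)

lemma cf_sum: "cf i (\<Sum>j\<in>UNIV. c j *\<^sub>R \<alpha> j) = c i"
  by (simp add: linear_sum[OF linear_cf] cf_scale cf_simple if_distrib cong: if_cong)

lemma cf_expand: "(\<Sum>i\<in>UNIV. cf i v *\<^sub>R \<alpha> i) = v"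
proof -
  have "(\<Sum>b\<in>range \<alpha>. representation (range \<alpha>) v b *\<^sub>R b) = v"
    using sum_representation_eq[OF indep, of v "range \<alpha>"] by (simp add: span_simple)
  then show ?thesis using inj_simple by (simp add: sum.reindex cf_def)
qed

lemma cf_eqI:
  assumes "\<And>i. cf i u = cf i v" shows "u = v"
proof -
  have "(\<Sum>i\<in>UNIV. cf i u *\<^sub>R \<alpha> i) = (\<Sum>i\<in>UNIV. cf i v *\<^sub>R \<alpha> i)" by (simp only: assms)
  then show ?thesis by (simp only: cf_expand)
qed

definition pos :: "'v set" where "pos = {\<beta>\<in>\<Delta>. \<forall>i. 0 \<le> cf i \<beta>}"

lemma root_cf_Ints: "\<beta> \<in> \<Delta> \<Longrightarrow> cf i \<beta> \<in> \<int>"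
  by (erule root_nat_comb) (simp_all add: cf_sum cf_uminus)

lemma pos_or_neg: "\<beta> \<in> \<Delta> \<Longrightarrow> \<beta> \<in> pos \<or> - \<beta> \<in> pos"
proof -
  assume b: "\<beta> \<in> \<Delta>"
  then show ?thesis
    by (cases rule: root_nat_comb) (use b uminus_root[OF b] in \<open>simp_all add: pos_def cf_sum cf_uminus\<close>)
qed

lemma pos_root: "\<beta> \<in> pos \<Longrightarrow> \<beta> \<in> \<Delta>" and pos_cf: "\<beta> \<in> pos \<Longrightarrow> 0 \<le> cf i \<beta>"
  by (auto simp: pos_def)

lemma not_pos_neg: "\<beta> \<in> pos \<Longrightarrow> - \<beta> \<notin> pos"
proof
  assume "\<beta> \<in> pos" "- \<beta> \<in> pos"
  then have "cf i \<beta> = cf i 0" for i using pos_cf[of \<beta> i] pos_cf[of "- \<beta>" i] by (simp add: cf_uminus cf_0)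
  then have "\<beta> = 0" by (rule cf_eqI)
  then show False using \<open>\<beta> \<in> pos\<close> pos_root zero_not_root by blast
qed

lemma pos_cfI: "\<beta> \<in> \<Delta> \<Longrightarrow> cf i \<beta> > 0 \<Longrightarrow> \<beta> \<in> pos"
  using pos_or_neg[of \<beta>] pos_cf[of "- \<beta>" i] by (auto simp: cf_uminus)

lemma simple_pos: "\<alpha> i \<in> pos"
  by (simp add: pos_def simple_root cf_simple)

text \<open>
  A positive root other than \<open>\<alpha>\<^sub>i\<close> involves a second simple root, since the system is reduced, and
  \<open>s\<^sub>i\<close> leaves the coefficient of that simple root unchanged.
\<close>
lemma reflect_simple_pos:
  assumes "\<beta> \<in> pos" "\<beta> \<noteq> \<alpha> i"
  shows "reflect (\<alpha> i) \<beta> \<in> pos"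
proof -
  have "\<exists>k. k \<noteq> i \<and> cf k \<beta> \<noteq> 0"
  proof (rule ccontr)
    assume "\<not> ?thesis"
    then have "\<beta> = cf i \<beta> *\<^sub>R \<alpha> i" by (intro cf_eqI) (auto simp: cf_scale cf_simple)
    moreover from this have "cf i \<beta> = 1 \<or> cf i \<beta> = -1" using root_multiple simple_root pos_root assms(1) by metis
    ultimately show False using assms pos_cf[of \<beta> i] by auto
  qed
  then obtain k where k: "k \<noteq> i" "cf k \<beta> \<noteq> 0" by blast
  have "cf k (reflect (\<alpha> i) \<beta>) = cf k \<beta>" using k by (simp add: reflect_def cf_diff cf_scale cf_simple)
  then have "cf k (reflect (\<alpha> i) \<beta>) > 0" using k pos_cf[OF assms(1), of k] by simp
  then show ?thesis by (rule pos_cfI[OF reflect_root[OF simple_root pos_root[OF assms(1)]]])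
qed

text \<open>
  Because \<open>\<beta> \<bullet> \<beta> > 0\<close>, some simple root has positive inner product with \<open>\<beta>\<close>; reflecting in it lowers
  the height, and the root stays positive until it is simple.
\<close>
lemma root_conj_simple:
  assumes "\<beta> \<in> pos" shows "\<exists>is k. \<beta> = word_prod \<alpha> is (\<alpha> k)"
  using assms
proof (induction "nat \<lfloor>\<Sum>i\<in>UNIV. cf i \<beta>\<rfloor>" arbitrary: \<beta> rule: less_induct)
  case less
  have nz: "\<beta> \<noteq> 0" using less.prems pos_root zero_not_root by blast
  have "\<beta> \<bullet> \<beta> = (\<Sum>i\<in>UNIV. cf i \<beta> * (\<beta> \<bullet> \<alpha> i))"
    by (subst (2) cf_expand[symmetric]) (simp add: inner_sum_right)
  moreover have "\<beta> \<bullet> \<beta> > 0" using nz by simp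
  ultimately obtain i where "cf i \<beta> * (\<beta> \<bullet> \<alpha> i) > 0"
    by (metis (no_types, lifting) sum_nonpos not_le)
  then have i: "\<beta> \<bullet> \<alpha> i > 0" using pos_cf[OF less.prems, of i] by (simp add: zero_less_mult_iff)
  show ?case
  proof (cases "\<beta> = \<alpha> i")
    case True then show ?thesis by (intro exI[of _ "[]"] exI[of _ i]) simp
  next
    case False
    let ?\<gamma> = "reflect (\<alpha> i) \<beta>"
    have \<gamma>: "?\<gamma> \<in> pos" using reflect_simple_pos less.prems False by blast
    have c: "\<beta> \<bullet> coroot (\<alpha> i) > 0" using i simple_nz by (simp add: coroot_inner)
    have s: "(\<Sum>k\<in>UNIV. cf k ?\<gamma>) = (\<Sum>k\<in>UNIV. cf k \<beta>) - \<beta> \<bullet> coroot (\<alpha> i)"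
    proof -
      have "cf k ?\<gamma> = cf k \<beta> - (if k = i then \<beta> \<bullet> coroot (\<alpha> i) else 0)" for k
        by (simp add: reflect_def cf_diff cf_scale cf_simple)
      then show ?thesis by (simp add: sum_subtractf)
    qed
    have int: "(\<Sum>k\<in>UNIV. cf k \<delta>) \<in> \<int>" if "\<delta> \<in> pos" for \<delta>
      using that by (intro Ints_sum root_cf_Ints pos_root)
    have "0 \<le> (\<Sum>k\<in>UNIV. cf k ?\<gamma>)" using \<gamma> by (intro sum_nonneg pos_cf)
    then have "nat \<lfloor>\<Sum>k\<in>UNIV. cf k ?\<gamma>\<rfloor> < nat \<lfloor>\<Sum>k\<in>UNIV. cf k \<beta>\<rfloor>"
      using s c int[OF \<gamma>] int[OF less.prems]
      by (auto elim!: Ints_cases)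
    from less.hyps[OF this \<gamma>] obtain "is" k where "?\<gamma> = word_prod \<alpha> is (\<alpha> k)" by blast
    then have "\<beta> = word_prod \<alpha> (i # is) (\<alpha> k)" by (metis comp_apply reflect_reflect word_prod_Cons)
    then show ?thesis by blast
  qed
qed

lemma word_linear: "linear (word_prod \<alpha> is)"
proof (induction "is")
  case Nil show ?case by (simp only: word_prod_Nil linear_id)
next
  case (Cons i "is") then show ?case using linear_compose[OF _ reflect_linear] by (simp only: word_prod_Cons)
qed

lemma word_isometry: "word_prod \<alpha> is u \<bullet> word_prod \<alpha> is v = u \<bullet> v"
  by (induction "is") (simp_all add: reflect_isometry)

lemma word_root: "\<beta> \<in> \<Delta> \<Longrightarrow> word_prod \<alpha> is \<beta> \<in> \<Delta>"
  by (induction "is") (simp_all add: reflect_root simple_root)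

lemma word_weyl: "word_prod \<alpha> is \<in> weyl \<Delta>"
  by (induction "is") (simp_all only: word_prod_Nil word_prod_Cons weyl.weyl_id weyl.weyl_reflect simple_root)

lemma reflect_word:
  assumes "\<beta> \<in> \<Delta>" shows "\<exists>is. reflect \<beta> = word_prod \<alpha> is"
proof -
  have *: "\<exists>is. reflect \<beta> = word_prod \<alpha> is" if "\<beta> \<in> pos" for \<beta>
  proof -
    obtain "is" k where \<beta>: "\<beta> = word_prod \<alpha> is (\<alpha> k)" using root_conj_simple \<open>\<beta> \<in> pos\<close> by blast
    have "reflect \<beta> v = word_prod \<alpha> (is @ [k] @ rev is) v" for v
    proof -
      obtain u where v: "v = word_prod \<alpha> is u"
        using word_prod_rev[of \<alpha> "rev is"] by (metis comp_apply id_apply rev_rev_ident)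
      show ?thesis unfolding \<beta> v
        by (subst reflect_conj) (simp_all add: word_isometry word_linear word_prod_append
              word_prod_rev[unfolded fun_eq_iff comp_apply id_apply])
    qed
    then show ?thesis by blast
  qed
  show ?thesis using pos_or_neg[OF assms] * reflect_uminus by metis
qed

lemma weyl_word: "w \<in> weyl \<Delta> \<Longrightarrow> \<exists>is. w = word_prod \<alpha> is"
proof (induction rule: weyl.induct)
  case weyl_id then show ?case by (metis word_prod_Nil)
next
  case (weyl_reflect \<beta> w) then show ?case by (metis reflect_word word_prod_append)
qed

lemma weyl_linear: "w \<in> weyl \<Delta> \<Longrightarrow> linear w"
  using weyl_word word_linear by metis
lemma weyl_isometry: "w \<in> weyl \<Delta> \<Longrightarrow> w u \<bullet> w v = u \<bullet> v"
  using weyl_word word_isometry by metis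
lemma weyl_root: "w \<in> weyl \<Delta> \<Longrightarrow> \<beta> \<in> \<Delta> \<Longrightarrow> w \<beta> \<in> \<Delta>"
  using weyl_word word_root by metis
lemma weyl_comp: "w \<in> weyl \<Delta> \<Longrightarrow> x \<in> weyl \<Delta> \<Longrightarrow> w \<circ> x \<in> weyl \<Delta>"
  using weyl_word word_weyl word_prod_append by metis
lemma reflect_weyl: "\<beta> \<in> \<Delta> \<Longrightarrow> reflect \<beta> \<in> weyl \<Delta>"
  using weyl_reflect[OF _ weyl_id] by simp

lemma inv_word: "inv (word_prod \<alpha> is) = word_prod \<alpha> (rev is)"
  using word_prod_rev[of \<alpha> "is"] word_prod_rev[of \<alpha> "rev is"] by (metis inv_unique_comp rev_rev_ident)

lemma weyl_bij: "w \<in> weyl \<Delta> \<Longrightarrow> bij w"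
  using weyl_word word_prod_rev[of \<alpha>] by (metis o_bij rev_rev_ident)
lemma weyl_inv: "w \<in> weyl \<Delta> \<Longrightarrow> inv w \<in> weyl \<Delta>"
  using weyl_word inv_word word_weyl by metis
lemma weyl_inv_apply: "w \<in> weyl \<Delta> \<Longrightarrow> w (inv w v) = v" "w \<in> weyl \<Delta> \<Longrightarrow> inv w (w v) = v"
  using weyl_bij by (simp_all add: bij_is_inj bij_is_surj surj_f_inv_f)

lemma weyl_eqI:
  assumes "w \<in> weyl \<Delta>" "x \<in> weyl \<Delta>" "\<And>i. w (\<alpha> i) = x (\<alpha> i)" shows "w = x"
proof
  fix v
  show "w v = x v"
    by (subst (1 2) cf_expand[symmetric], simp add: linear_sum[OF weyl_linear[OF assms(1)]]
       linear_sum[OF weyl_linear[OF assms(2)]] linear_scale weyl_linear assms)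
qed

lemma finite_weyl: "finite (weyl \<Delta>)"
proof (rule inj_on_finite[where f = "\<lambda>w. restrict w (range \<alpha>)" and B = "PiE (range \<alpha>) (\<lambda>_. \<Delta>)"])
  show "inj_on (\<lambda>w. restrict w (range \<alpha>)) (weyl \<Delta>)"
    by (auto intro!: inj_onI weyl_eqI) (metis rangeI restrict_apply')
  show "(\<lambda>w. restrict w (range \<alpha>)) ` weyl \<Delta> \<subseteq> PiE (range \<alpha>) (\<lambda>_. \<Delta>)"
    using weyl_root simple_root by auto
  show "finite (PiE (range \<alpha>) (\<lambda>_. \<Delta>))" using finite_roots by (intro finite_PiE) auto
qed

text \<open>
  Send \<open>\<beta>\<close> through the letters of the word. At the letter where the root becomes negative it equals
  the simple root of that letter, and this letter can be deleted.
\<close>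
lemma exchange:
  assumes "\<beta> \<in> pos" "- word_prod \<alpha> (rev is) \<beta> \<in> pos"
  shows "\<exists>js. Suc (length js) = length is \<and> reflect \<beta> \<circ> word_prod \<alpha> is = word_prod \<alpha> js"
  using assms
proof (induction "is" arbitrary: \<beta>)
  case Nil then show ?case using not_pos_neg by simp
next
  case (Cons k "is")
  show ?case
  proof (cases "\<beta> = \<alpha> k")
    case True
    then show ?thesis by (intro exI[of _ "is"]) (simp add: fun_eq_iff reflect_reflect)
  next
    case False
    let ?\<gamma> = "reflect (\<alpha> k) \<beta>"
    have "?\<gamma> \<in> pos" using reflect_simple_pos Cons.prems False by blast
    moreover have "- word_prod \<alpha> (rev is) ?\<gamma> \<in> pos" using Cons.prems by (simp add: word_prod_append)
    ultimately obtain js where js: "Suc (length js) = length is" "reflect ?\<gamma> \<circ> word_prod \<alpha> is = word_prod \<alpha> js"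
      using Cons.IH by blast
    have "reflect \<beta> (reflect (\<alpha> k) v) = reflect (\<alpha> k) (reflect ?\<gamma> v)" for v
      using reflect_conj[of "reflect (\<alpha> k)" ?\<gamma> v] by (simp add: reflect_isometry reflect_linear reflect_reflect)
    then have "reflect \<beta> \<circ> word_prod \<alpha> (k # is) = word_prod \<alpha> (k # js)"
      unfolding word_prod_Cons js(2)[symmetric] by (simp add: fun_eq_iff)
    then show ?thesis using js(1) by (metis length_Cons)
  qed
qed

abbreviation len where "len \<equiv> weyl_length \<alpha>"

lemma len_word: "w \<in> weyl \<Delta> \<Longrightarrow> \<exists>is. word_prod \<alpha> is = w \<and> length is = len w"
  unfolding weyl_length_def using weyl_word by (smt (verit, best) LeastI_ex)

lemma len_le: "len (word_prod \<alpha> is) \<le> length is"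
  unfolding weyl_length_def by (rule Least_le) blast

lemma len_reflect_le: "w \<in> weyl \<Delta> \<Longrightarrow> len (reflect (\<alpha> i) \<circ> w) \<le> Suc (len w)"
  using len_word len_le by (metis length_Cons word_prod_Cons)

lemma reflect_cancel: "reflect \<beta> \<circ> (reflect \<beta> \<circ> w) = w"
  by (simp add: fun_eq_iff reflect_reflect)

lemma reflect_cancel_right: "w \<circ> reflect \<beta> \<circ> reflect \<beta> = w"
  by (simp add: fun_eq_iff reflect_reflect)

lemma len_descent:
  assumes w: "w \<in> weyl \<Delta>" and neg: "- inv w (\<alpha> i) \<in> pos"
  shows "len w = Suc (len (reflect (\<alpha> i) \<circ> w))"
proof -
  obtain "is" where i: "word_prod \<alpha> is = w" "length is = len w" using len_word[OF w] by blast
  obtain js where "Suc (length js) = length is" "reflect (\<alpha> i) \<circ> word_prod \<alpha> is = word_prod \<alpha> js"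
    using exchange[OF simple_pos, of "is" i] neg i inv_word by metis
  then have "len (reflect (\<alpha> i) \<circ> w) < len w" using i len_le by (metis Suc_le_eq not_less_eq_eq)
  moreover have "len w \<le> Suc (len (reflect (\<alpha> i) \<circ> w))"
    using len_reflect_le[of "reflect (\<alpha> i) \<circ> w" i] w by (simp add: reflect_cancel weyl_reflect simple_root)
  ultimately show ?thesis by simp
qed

lemma len_ascent:
  assumes w: "w \<in> weyl \<Delta>" and p: "inv w (\<alpha> i) \<in> pos"
  shows "len (reflect (\<alpha> i) \<circ> w) = Suc (len w)"
proof -
  have s: "reflect (\<alpha> i) \<in> weyl \<Delta>" by (simp add: reflect_weyl simple_root)
  have "inv (reflect (\<alpha> i) \<circ> w) = inv w \<circ> inv (reflect (\<alpha> i))"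
    using o_inv_distrib weyl_bij[OF w] weyl_bij[OF s] by blast
  also have "inv (reflect (\<alpha> i)) = reflect (\<alpha> i)"
    by (meson inv_unique_comp reflect_comp_reflect)
  finally have e: "inv (reflect (\<alpha> i) \<circ> w) = inv w \<circ> reflect (\<alpha> i)" .
  have "- inv (reflect (\<alpha> i) \<circ> w) (\<alpha> i) \<in> pos"
    unfolding e using p by (simp add: reflect_self simple_nz linear_neg weyl_linear weyl_inv w)
  from len_descent[OF _ this] show ?thesis using weyl_comp[OF s w] by (simp add: reflect_cancel)
qed

lemma descent_cases:
  assumes w: "w \<in> weyl \<Delta>"
  shows "inv w (\<alpha> i) \<in> pos \<and> len (reflect (\<alpha> i) \<circ> w) = Suc (len w)
    \<or> - inv w (\<alpha> i) \<in> pos \<and> len w = Suc (len (reflect (\<alpha> i) \<circ> w))"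
  using len_descent[OF w] len_ascent[OF w] pos_or_neg[of "inv w (\<alpha> i)"] weyl_root weyl_inv[OF w] simple_root by blast

lemma len_inv: "w \<in> weyl \<Delta> \<Longrightarrow> len (inv w) = len w"
proof -
  have *: "len (inv w) \<le> len w" if "w \<in> weyl \<Delta>" for w
    using len_word[OF that] len_le inv_word by (metis length_rev)
  assume w: "w \<in> weyl \<Delta>"
  show ?thesis using *[OF w] *[OF weyl_inv[OF w]] weyl_bij[OF w] by (simp add: inv_inv_eq)
qed

lemma len_right_cases:
  assumes w: "w \<in> weyl \<Delta>"
  shows "len (w \<circ> reflect (\<alpha> i)) = Suc (len w) \<or> len w = Suc (len (w \<circ> reflect (\<alpha> i)))"
proof -
  have s: "reflect (\<alpha> i) \<in> weyl \<Delta>" by (simp add: reflect_weyl simple_root)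
  have "inv (w \<circ> reflect (\<alpha> i)) = inv (reflect (\<alpha> i)) \<circ> inv w"
    using o_inv_distrib weyl_bij[OF w] weyl_bij[OF s] by blast
  also have "inv (reflect (\<alpha> i)) = reflect (\<alpha> i)"
    by (meson inv_unique_comp reflect_comp_reflect)
  finally have "len (w \<circ> reflect (\<alpha> i)) = len (reflect (\<alpha> i) \<circ> inv w)"
    using len_inv[OF weyl_comp[OF w s]] by metis
  then show ?thesis using descent_cases[OF weyl_inv[OF w], of i] len_inv[OF w] by auto
qed

end

section \<open>Rank 2 subsystems and the theorem of Matsumoto\<close>

text \<open>
  The order of \<open>s\<^sub>i s\<^sub>j\<close> in terms of the product of the two Cartan integers, which is
  \<open>4 cos\<^sup>2 (\<pi> / m)\<close>.
\<close>
definition dihedral_order :: "nat \<Rightarrow> nat" where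
  "dihedral_order k = (if k = 0 then 2 else if k = 1 then 3 else if k = 2 then 4 else 6)"

context root_datum
begin

definition cartan :: "'n \<Rightarrow> 'n \<Rightarrow> nat" where
  "cartan i j = nat \<lfloor>- (\<alpha> j \<bullet> coroot (\<alpha> i))\<rfloor>"

lemma cartan_pairing:
  assumes "i \<noteq> j" shows "\<alpha> j \<bullet> coroot (\<alpha> i) = - real (cartan i j)"
proof -
  have r: "reflect (\<alpha> i) (\<alpha> j) \<in> pos" using reflect_simple_pos[OF simple_pos] assms inj_simple by (metis injD)
  have "cf i (reflect (\<alpha> i) (\<alpha> j)) = - (\<alpha> j \<bullet> coroot (\<alpha> i))"
    using assms by (simp add: reflect_def cf_diff cf_scale cf_simple)
  then have "- (\<alpha> j \<bullet> coroot (\<alpha> i)) \<ge> 0" using pos_cf[OF r] by metis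
  moreover have "\<alpha> j \<bullet> coroot (\<alpha> i) \<in> \<int>" using root_pairing simple_root by blast
  ultimately show ?thesis unfolding cartan_def by (auto elim!: Ints_cases)
qed

lemma reflect_simple:
  "i \<noteq> j \<Longrightarrow> reflect (\<alpha> i) (\<alpha> j) = \<alpha> j + real (cartan i j) *\<^sub>R \<alpha> i"
  by (simp add: reflect_def cartan_pairing)

lemma cartan_cases:
  assumes "i \<noteq> j"
  shows "(cartan i j, cartan j i) \<in> {(0,0), (1,1), (1,2), (2,1), (1,3), (3,1)}"
proof -
  let ?a = "\<alpha> i" and ?b = "\<alpha> j"
  have nz: "?a \<bullet> ?a > 0" "?b \<bullet> ?b > 0" using simple_nz by auto
  have ab: "2 * (?b \<bullet> ?a) = - real (cartan i j) * (?a \<bullet> ?a)" "2 * (?b \<bullet> ?a) = - real (cartan j i) * (?b \<bullet> ?b)"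
    using cartan_pairing[OF assms] cartan_pairing[OF assms[symmetric]] nz
    by (simp_all add: coroot_inner field_simps inner_commute)
  have "(?b \<bullet> ?a)\<^sup>2 < (?b \<bullet> ?b) * (?a \<bullet> ?a)"
  proof -
    \<comment> \<open>Strict Cauchy--Schwarz: \<open>?u\<close> is a multiple of the component of \<open>\<alpha>\<^sub>j\<close> orthogonal to \<open>\<alpha>\<^sub>i\<close>.\<close>
    let ?u = "(?a \<bullet> ?a) *\<^sub>R ?b - (?b \<bullet> ?a) *\<^sub>R ?a"
    have "cf j ?u = ?a \<bullet> ?a" using assms by (simp add: cf_diff cf_scale cf_simple)
    then have "?u \<noteq> 0" using nz cf_0[of j] by auto
    then have "0 < ?u \<bullet> ?u" by simp
    also have "?u \<bullet> ?u = (?a \<bullet> ?a) * ((?b \<bullet> ?b) * (?a \<bullet> ?a) - (?b \<bullet> ?a)\<^sup>2)"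
      by (simp add: inner_diff_left inner_diff_right inner_commute power2_eq_square algebra_simps)
    finally show ?thesis using nz by (simp add: zero_less_mult_iff)
  qed
  then have "(2 * (?b \<bullet> ?a)) * (2 * (?b \<bullet> ?a)) < 4 * ((?b \<bullet> ?b) * (?a \<bullet> ?a))" by (simp add: power2_eq_square)
  then have "real (cartan i j * cartan j i) * ((?b \<bullet> ?b) * (?a \<bullet> ?a)) < 4 * ((?b \<bullet> ?b) * (?a \<bullet> ?a))"
    by (subst (asm) (1) ab(1), subst (asm) ab(2)) (simp add: algebra_simps)
  then have "real (cartan i j * cartan j i) < 4" using nz by simp
  then have l: "cartan i j * cartan j i < 4" by linarith
  have z: "cartan i j = 0 \<longleftrightarrow> cartan j i = 0" using ab nz by auto
  show ?thesis
  proof (cases "cartan i j = 0")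
    case True then show ?thesis using z by simp
  next
    case False
    then have ne: "cartan i j \<ge> 1" "cartan j i \<ge> 1" using z by auto
    have "cartan i j < 4" "cartan j i < 4"
      using l ne by (metis mult.right_neutral mult_le_mono2 le_less_trans) (metis l ne(1) mult_1 mult_le_mono1 le_less_trans)
    then have "cartan i j \<in> {1,2,3}" "cartan j i \<in> {1,2,3}" using ne by auto
    then show ?thesis using l by auto
  qed
qed

definition coxeter :: "'n \<Rightarrow> 'n \<Rightarrow> nat" where
  "coxeter i j = dihedral_order (cartan i j * cartan j i)"

lemma coxeter_commute: "coxeter i j = coxeter j i"
  by (simp add: coxeter_def mult.commute)

lemma coxeter_pos: "0 < coxeter i j"
  by (simp add: coxeter_def dihedral_order_def)

lemma reflect_plane:
  assumes "i \<noteq> j"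
  shows "reflect (\<alpha> i) (v - a *\<^sub>R \<alpha> i - b *\<^sub>R \<alpha> j) = v - (v \<bullet> coroot (\<alpha> i) - a + real (cartan i j) * b) *\<^sub>R \<alpha> i - b *\<^sub>R \<alpha> j"
    and "reflect (\<alpha> j) (v - a *\<^sub>R \<alpha> i - b *\<^sub>R \<alpha> j) = v - a *\<^sub>R \<alpha> i - (v \<bullet> coroot (\<alpha> j) - b + real (cartan j i) * a) *\<^sub>R \<alpha> j"
  using coroot_self[OF simple_nz] cartan_pairing[OF assms] cartan_pairing[OF assms[symmetric]]
  by (simp_all add: reflect_def inner_diff_left algebra_simps) (simp_all add: scaleR_add_left[symmetric])

lemma braid_weyl:
  assumes ij: "i \<noteq> j"
  shows "word_prod \<alpha> (alt_word i j (coxeter i j)) = word_prod \<alpha> (alt_word j i (coxeter i j))"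
proof
  fix v
  have v: "v = v - 0 *\<^sub>R \<alpha> i - 0 *\<^sub>R \<alpha> j" by simp
  show "word_prod \<alpha> (alt_word i j (coxeter i j)) v = word_prod \<alpha> (alt_word j i (coxeter i j)) v"
    by (subst (1 2) v)
       (use cartan_cases[OF ij] in \<open>auto simp: coxeter_def dihedral_order_def numeral_eq_Suc reflect_plane[OF ij] simp del: diff_zero scaleR_zero_left,
          simp_all add: algebra_simps\<close>)
qed

text \<open>
  Fewer than \<open>m\<close> alternating letters do not yet form the longest element of the dihedral group, so
  the alternating word can be prolonged.
\<close>
lemma alt_word_positive:
  assumes ij: "i \<noteq> j" and k: "k < coxeter i j"
  shows "\<exists>a b. 0 \<le> a \<and> 0 \<le> b \<and>
    word_prod \<alpha> (alt_word i j k) (\<alpha> (if even k then i else j)) = a *\<^sub>R \<alpha> i + b *\<^sub>R \<alpha> j"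
proof -
  have ri: "reflect (\<alpha> i) (a *\<^sub>R \<alpha> i + b *\<^sub>R \<alpha> j) = (real (cartan i j) * b - a) *\<^sub>R \<alpha> i + b *\<^sub>R \<alpha> j" for a b
    using reflect_plane(1)[OF ij, of 0 "-a" "-b"] by (simp add: algebra_simps)
  have rj: "reflect (\<alpha> j) (a *\<^sub>R \<alpha> i + b *\<^sub>R \<alpha> j) = a *\<^sub>R \<alpha> i + (real (cartan j i) * a - b) *\<^sub>R \<alpha> j" for a b
    using reflect_plane(2)[OF ij, of 0 "-a" "-b"] by (simp add: algebra_simps)
  let ?n = "real (cartan i j)" and ?m = "real (cartan j i)"
  have ai: "\<alpha> i = 1 *\<^sub>R \<alpha> i + 0 *\<^sub>R \<alpha> j" and aj: "\<alpha> j = 0 *\<^sub>R \<alpha> i + 1 *\<^sub>R \<alpha> j" by simp_all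
  have 1: "reflect (\<alpha> i) (\<alpha> j) = ?n *\<^sub>R \<alpha> i + 1 *\<^sub>R \<alpha> j"
    by (subst aj, subst ri) simp
  have 2: "reflect (\<alpha> i) (reflect (\<alpha> j) (\<alpha> i)) = (?n * ?m - 1) *\<^sub>R \<alpha> i + ?m *\<^sub>R \<alpha> j"
    using rj[of 1 0] ri[of 1 ?m] by simp
  have 3: "reflect (\<alpha> i) (reflect (\<alpha> j) (reflect (\<alpha> i) (\<alpha> j))) = (?n * (?n * ?m - 2)) *\<^sub>R \<alpha> i + (?n * ?m - 1) *\<^sub>R \<alpha> j"
    unfolding 1 rj ri by (simp add: algebra_simps)
  have 4: "reflect (\<alpha> i) (reflect (\<alpha> j) (reflect (\<alpha> i) (reflect (\<alpha> j) (\<alpha> i))))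
      = ((?n * ?m) * (?n * ?m) - 3 * (?n * ?m) + 1) *\<^sub>R \<alpha> i + (?m * (?n * ?m - 2)) *\<^sub>R \<alpha> j"
    unfolding 2 rj ri by (simp add: algebra_simps)
  have 5: "reflect (\<alpha> i) (reflect (\<alpha> j) (reflect (\<alpha> i) (reflect (\<alpha> j) (reflect (\<alpha> i) (\<alpha> j)))))
      = (?n * ((?n * ?m) * (?n * ?m) - 4 * (?n * ?m) + 3)) *\<^sub>R \<alpha> i + ((?n * ?m) * (?n * ?m) - 3 * (?n * ?m) + 1) *\<^sub>R \<alpha> j"
    unfolding 3 rj ri by (simp add: algebra_simps)
  have aw: "alt_word i j 2 = [i,j]" "alt_word i j 3 = [i,j,i]" "alt_word i j 4 = [i,j,i,j]" "alt_word i j 5 = [i,j,i,j,i]"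
    by (simp_all add: numeral_eq_Suc)
  have ex: "\<exists>a b. 0 \<le> a \<and> 0 \<le> b \<and> x = a *\<^sub>R \<alpha> i + b *\<^sub>R \<alpha> j" if "x = A *\<^sub>R \<alpha> i + B *\<^sub>R \<alpha> j" "0 \<le> A \<and> 0 \<le> B" for A B x
    using that by blast
  have "k \<in> {0,1,2,3,4,5}" using k by (auto simp: coxeter_def dihedral_order_def split: if_splits)
  then consider "k = 0" | "k = 1" | "k = 2" | "k = 3" | "k = 4" | "k = 5" by blast
  then show ?thesis
  proof cases
    case 1 then show ?thesis using ai by (intro ex[of _ 1 0]) auto
  next
    case k1: 2 then show ?thesis using 1 by (intro ex[of _ ?n 1]) auto
  next
    case k2: 3
    show ?thesis by (rule ex[of _ "?n * ?m - 1" ?m])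
      (use k k2 2 cartan_cases[OF ij] in \<open>auto simp: aw coxeter_def dihedral_order_def split: if_splits\<close>)
  next
    case k3: 4
    show ?thesis by (rule ex[of _ "?n * (?n * ?m - 2)" "?n * ?m - 1"])
      (use k k3 3 cartan_cases[OF ij] in \<open>auto simp: aw coxeter_def dihedral_order_def split: if_splits\<close>)
  next
    case k4: 5
    show ?thesis by (rule ex[of _ "(?n * ?m) * (?n * ?m) - 3 * (?n * ?m) + 1" "?m * (?n * ?m - 2)"])
      (use k k4 4 cartan_cases[OF ij] in \<open>auto simp: aw coxeter_def dihedral_order_def split: if_splits\<close>)
  next
    case k5: 6
    show ?thesis by (rule ex[of _ "?n * ((?n * ?m) * (?n * ?m) - 4 * (?n * ?m) + 3)" "(?n * ?m) * (?n * ?m) - 3 * (?n * ?m) + 1"])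
      (use k k5 5 cartan_cases[OF ij] in \<open>auto simp: aw coxeter_def dihedral_order_def split: if_splits\<close>)
  qed
qed

text \<open>
  Since \<open>w\<^sup>-\<^sup>1\<close> is negative on \<open>\<alpha>\<^sub>i\<close> and \<open>\<alpha>\<^sub>j\<close>, it is negative on all their nonnegative combinations.
  So after each step the next letter is again a descent of what remains of \<open>w\<close>.
\<close>
lemma strip_alternating:
  assumes w: "w \<in> weyl \<Delta>" and ij: "i \<noteq> j" and d: "- inv w (\<alpha> i) \<in> pos" "- inv w (\<alpha> j) \<in> pos"
    and k: "k \<le> coxeter i j"
  shows "\<exists>x\<in>weyl \<Delta>. w = word_prod \<alpha> (alt_word i j k) \<circ> x \<and> len w = k + len x"
  using k
proof (induction k)
  case 0 show ?case using w by (intro bexI[of _ w]) auto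
next
  case (Suc k)
  have "k \<le> coxeter i j" using Suc.prems by simp
  from Suc.IH[OF this] obtain x
    where x: "x \<in> weyl \<Delta>" "w = word_prod \<alpha> (alt_word i j k) \<circ> x" "len w = k + len x" by blast
  let ?u = "word_prod \<alpha> (alt_word i j k)" and ?l = "if even k then i else j"
  obtain a b where ab: "0 \<le> a" "0 \<le> b" "?u (\<alpha> ?l) = a *\<^sub>R \<alpha> i + b *\<^sub>R \<alpha> j"
    using alt_word_positive[OF ij, of k] Suc.prems by auto
  have u: "inv w (?u v) = inv x v" for v
  proof -
    have "w (inv x v) = ?u v" unfolding x(2) using weyl_inv_apply(1)[OF x(1)] by simp
    then show ?thesis using weyl_inv_apply(2)[OF w] by metis
  qed
  have lin: "linear (inv w)" by (rule weyl_linear[OF weyl_inv[OF w]])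
  have "inv x (\<alpha> ?l) = a *\<^sub>R inv w (\<alpha> i) + b *\<^sub>R inv w (\<alpha> j)"
    unfolding u[symmetric] ab(3) linear_add[OF lin] linear_scale[OF lin] ..
  then have "cf l (inv x (\<alpha> ?l)) \<le> 0" for l
    using ab pos_cf[OF d(1), of l] pos_cf[OF d(2), of l]
    by (simp add: cf_add cf_scale cf_uminus mult_nonneg_nonpos add_nonpos_nonpos)
  moreover have "- inv x (\<alpha> ?l) \<in> \<Delta>" using weyl_inv[OF x(1)] weyl_root simple_root uminus_root by blast
  ultimately have "- inv x (\<alpha> ?l) \<in> pos" by (simp add: pos_def cf_uminus)
  then have "len x = Suc (len (reflect (\<alpha> ?l) \<circ> x))" by (rule len_descent[OF x(1)])
  then have "len w = Suc k + len (reflect (\<alpha> ?l) \<circ> x)" using x(3) by simp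
  moreover have "w = word_prod \<alpha> (alt_word i j (Suc k)) \<circ> (reflect (\<alpha> ?l) \<circ> x)"
    unfolding alt_word_snoc word_prod_append by (subst x(2)) (simp add: fun_eq_iff reflect_reflect)
  ultimately show ?case using weyl_reflect[OF simple_root x(1)] by blast
qed

lemma reduced_tail:
  assumes "length (i # is) = len (word_prod \<alpha> (i # is))"
  shows "length is = len (word_prod \<alpha> is)"
  using len_le[of "is"] len_reflect_le[OF word_weyl, of i "is"] assms by simp

lemma reduced_descent:
  assumes "length (i # is) = len (word_prod \<alpha> (i # is))"
  shows "- inv (word_prod \<alpha> (i # is)) (\<alpha> i) \<in> pos"
  using descent_cases[OF word_weyl, of "i # is" i] reduced_tail[OF assms] assms
  by (auto simp: reflect_cancel)

text \<open>
  By induction on the length. Words with the same first letter reduce to shorter ones. If the first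
  letters \<open>i\<close> and \<open>j\<close> differ, then both are descents of the product, which therefore also has reduced
  words that start with the two sides of the braid relation and continue in the same way; each
  given word shares its first letter with one of them.
\<close>
theorem matsumoto:
  fixes X :: "'n \<Rightarrow> 'f \<Rightarrow> 'f"
  assumes braid: "\<And>i j f. i \<noteq> j \<Longrightarrow> foldr X (alt_word i j (coxeter i j)) f = foldr X (alt_word j i (coxeter i j)) f"
    and "length is = len (word_prod \<alpha> is)" "length js = len (word_prod \<alpha> js)"
    and "word_prod \<alpha> is = word_prod \<alpha> js"
  shows "foldr X is f = foldr X js f"
  using assms(2-)
proof (induction "length is" arbitrary: "is" js f)
  case 0 then show ?case by simp
next
  case (Suc n)
  obtain i is' where i: "is = i # is'" using Suc.hyps by (cases "is") auto
  obtain j js' where j: "js = j # js'" using Suc.hyps Suc.prems by (cases js) auto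
  have same_head: "foldr X ls f = foldr X (l # ks) f"
    if "length (l # ls') = len (word_prod \<alpha> (l # ls'))" "length (l # ks) = len (word_prod \<alpha> (l # ks))"
      "word_prod \<alpha> (l # ls') = word_prod \<alpha> (l # ks)" "ls = l # ls'" "length ls = Suc n" for l ls ls' ks f
  proof -
    have "word_prod \<alpha> ls' = word_prod \<alpha> ks"
      using arg_cong[OF that(3), of "\<lambda>w. reflect (\<alpha> l) \<circ> w"] by (simp only: word_prod_Cons reflect_cancel)
    moreover have "n = length ls'" using that(4,5) by simp
    ultimately have "foldr X ls' f = foldr X ks f"
      by (intro Suc.hyps(1) reduced_tail[OF that(1)] reduced_tail[OF that(2)])
    then show ?thesis by (simp add: that(4))
  qed
  show ?case
  proof (cases "i = j")
    case True then show ?thesis using same_head[of i is' js' "is"] Suc.prems Suc.hyps i j by simp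
  next
    case False
    define w m where "w = word_prod \<alpha> is" and "m = coxeter i j"
    have w: "w \<in> weyl \<Delta>" by (simp add: w_def word_weyl)
    have "- inv w (\<alpha> i) \<in> pos" "- inv w (\<alpha> j) \<in> pos"
      using reduced_descent[of i is'] reduced_descent[of j js'] Suc.prems by (simp_all add: w_def i j)
    from strip_alternating[OF w False this order_refl] obtain x where
      x: "x \<in> weyl \<Delta>" "w = word_prod \<alpha> (alt_word i j m) \<circ> x" "len w = m + len x" unfolding m_def by blast
    obtain K where K: "word_prod \<alpha> K = x" "length K = len x" using len_word[OF x(1)] by blast
    obtain m' where m': "m = Suc m'" using coxeter_pos[of i j] unfolding m_def by (cases "coxeter i j") auto
    have wi: "word_prod \<alpha> (alt_word i j m @ K) = w" and wj: "word_prod \<alpha> (alt_word j i m @ K) = w"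
      using x(2) K(1) braid_weyl[OF False] by (simp_all add: word_prod_append m_def)
    have wi': "word_prod \<alpha> (i # alt_word j i m' @ K) = w" and wj': "word_prod \<alpha> (j # alt_word i j m' @ K) = w"
      using wi wj unfolding m' by (simp_all del: word_prod_Cons)
    have n: "len w = Suc n" using Suc by (simp add: w_def)
    have "length (alt_word p q k) = k" for p q :: 'n and k by (induction k arbitrary: p q) auto
    then have l: "Suc (length (alt_word j i m' @ K)) = Suc n" "Suc (length (alt_word i j m' @ K)) = Suc n"
      using x(3) K(2) m' n by simp_all
    have "foldr X is f = foldr X (i # alt_word j i m' @ K) f"
      by (rule same_head[OF _ _ _ i]) (use wi' n l Suc i w_def in \<open>simp_all del: word_prod_Cons\<close>)
    also have "\<dots> = foldr X (alt_word i j m @ K) f" by (simp add: m')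
    also have "\<dots> = foldr X (alt_word j i m @ K) f" using braid[OF False] by (simp add: m_def)
    also have "\<dots> = foldr X (j # alt_word i j m' @ K) f" by (simp add: m')
    also have "\<dots> = foldr X js f"
      by (rule same_head[symmetric, OF _ _ _ j]) (use wj' n l Suc j w_def in \<open>simp_all del: word_prod_Cons\<close>)
    finally show ?thesis .
  qed
qed

end

section \<open>Existence of the highest root\<close>

context root_datum
begin

definition dom_le :: "'v \<Rightarrow> 'v \<Rightarrow> bool" where
  "dom_le u v \<longleftrightarrow> (\<forall>i. cf i u \<le> cf i v)"

definition maximal_root :: "'v \<Rightarrow> bool" where
  "maximal_root \<gamma> \<longleftrightarrow> \<gamma> \<in> \<Delta> \<and> (\<forall>\<delta>\<in>\<Delta>. dom_le \<gamma> \<delta> \<longrightarrow> \<delta> = \<gamma>)"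

lemma root_diff:
  assumes "\<beta> \<in> \<Delta>" "\<gamma> \<in> \<Delta>" "\<beta> \<bullet> \<gamma> > 0" "\<beta> \<noteq> \<gamma>"
  shows "\<beta> - \<gamma> \<in> \<Delta>"
proof -
  have nz: "\<beta> \<bullet> \<beta> > 0" "\<gamma> \<bullet> \<gamma> > 0" using assms zero_not_root by auto
  have p: "\<beta> \<bullet> coroot \<gamma> > 0" "\<gamma> \<bullet> coroot \<beta> > 0"
    using nz assms by (simp_all add: coroot_inner inner_commute)
  have one_or_two: "x = 1 \<or> x \<ge> 2" if "x \<in> \<int>" "x > 0" for x :: real
    using that by (auto elim!: Ints_cases)
  consider "\<beta> \<bullet> coroot \<gamma> = 1" | "\<gamma> \<bullet> coroot \<beta> = 1" | "\<beta> \<bullet> coroot \<gamma> \<ge> 2" "\<gamma> \<bullet> coroot \<beta> \<ge> 2"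
    using one_or_two root_pairing assms(1,2) p by metis
  then show ?thesis
  proof cases
    case 1 then show ?thesis using reflect_root[OF assms(2,1)] by (simp add: reflect_def)
  next
    case 2 then show ?thesis using uminus_root[OF reflect_root[OF assms(1,2)]] by (simp add: reflect_def)
  next
    case 3
    then have "\<beta> \<bullet> \<gamma> \<ge> \<gamma> \<bullet> \<gamma>" "\<beta> \<bullet> \<gamma> \<ge> \<beta> \<bullet> \<beta>"
      using nz by (simp_all add: coroot_inner field_simps inner_commute)
    then have "(\<beta> - \<gamma>) \<bullet> (\<beta> - \<gamma>) \<le> 0" by (simp add: inner_diff_left inner_diff_right inner_commute)
    then show ?thesis using assms(4) by (metis inner_ge_zero inner_eq_zero_iff order_antisym right_minus_eq)
  qed
qed

lemma maximal_root_above: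
  assumes "\<beta> \<in> \<Delta>" shows "\<exists>\<gamma>. maximal_root \<gamma> \<and> dom_le \<beta> \<gamma>"
proof -
  let ?S = "{\<delta>\<in>\<Delta>. dom_le \<beta> \<delta>}"
  have S: "finite ?S" "?S \<noteq> {}" using finite_roots assms by (auto simp: dom_le_def)
  let ?f = "\<lambda>\<delta>. \<Sum>i\<in>UNIV. cf i \<delta>"
  have "Max (?f ` ?S) \<in> ?f ` ?S" using S by (intro Max_in) auto
  then obtain \<gamma> where \<gamma>1: "\<gamma> \<in> ?S" "Max (?f ` ?S) = ?f \<gamma>" by blast
  have \<gamma>: "\<gamma> \<in> ?S" "\<And>\<delta>. \<delta> \<in> ?S \<Longrightarrow> ?f \<delta> \<le> ?f \<gamma>"
  proof -
    show "\<gamma> \<in> ?S" by (rule \<gamma>1)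
    show "?f \<delta> \<le> ?f \<gamma>" if "\<delta> \<in> ?S" for \<delta>
      unfolding \<gamma>1(2)[symmetric] by (rule Max_ge[OF finite_imageI[OF S(1)] imageI[OF that]])
  qed
  have "\<delta> = \<gamma>" if "\<delta> \<in> \<Delta>" "dom_le \<gamma> \<delta>" for \<delta>
  proof (rule cf_eqI)
    fix i
    have "\<delta> \<in> ?S" using that \<gamma>(1) by (auto simp: dom_le_def intro: order_trans)
    from \<gamma>(2)[OF this] have "(\<Sum>i\<in>UNIV. cf i \<delta> - cf i \<gamma>) \<le> 0" by (simp add: sum_subtractf)
    moreover have nn: "cf i \<delta> - cf i \<gamma> \<ge> 0" for i using that(2) by (simp add: dom_le_def)
    ultimately have "(\<Sum>i\<in>UNIV. cf i \<delta> - cf i \<gamma>) = 0" by (intro antisym sum_nonneg) auto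
    then have "\<forall>i\<in>UNIV. cf i \<delta> - cf i \<gamma> = 0" using nn by (subst (asm) sum_nonneg_eq_0_iff) auto
    then show "cf i \<delta> = cf i \<gamma>" by simp
  qed
  then show ?thesis using \<gamma>(1) unfolding maximal_root_def by blast
qed

lemma root_neq_uminus: "\<beta> \<in> \<Delta> \<Longrightarrow> \<beta> \<noteq> - \<beta>"
  using zero_not_root by (metis eq_neg_iff_add_eq_0 scaleR_2 scaleR_eq_0_iff zero_neq_numeral)

text \<open>
  If \<open>\<gamma> \<bullet> \<alpha>\<^sub>i < 0\<close>, then \<open>\<gamma> + \<alpha>\<^sub>i\<close> is a larger root.
\<close>
lemma maximal_root_dominant:
  assumes "maximal_root \<gamma>" shows "0 \<le> \<gamma> \<bullet> \<alpha> i"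
proof (rule ccontr)
  assume "\<not> ?thesis"
  then have n: "\<gamma> \<bullet> - \<alpha> i > 0" by simp
  have g: "\<gamma> \<in> \<Delta>" and m: "\<And>\<delta>. \<delta> \<in> \<Delta> \<Longrightarrow> dom_le \<gamma> \<delta> \<Longrightarrow> \<delta> = \<gamma>"
    using assms by (auto simp: maximal_root_def)
  have "\<gamma> \<noteq> - \<alpha> i"
  proof
    assume e: "\<gamma> = - \<alpha> i"
    then have "dom_le \<gamma> (\<alpha> i)" by (simp add: dom_le_def cf_uminus cf_simple)
    from m[OF simple_root this] show False using e root_neq_uminus[OF simple_root] by metis
  qed
  then have "\<gamma> + \<alpha> i \<in> \<Delta>" using root_diff[OF g uminus_root[OF simple_root] n] by simp
  moreover have "dom_le \<gamma> (\<gamma> + \<alpha> i)" by (simp add: dom_le_def cf_add cf_simple)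
  ultimately have "\<gamma> + \<alpha> i = \<gamma>" by (rule m)
  then show False using simple_nz by simp
qed

lemma maximal_root_pos:
  assumes "maximal_root \<gamma>" shows "\<gamma> \<in> pos"
proof (rule ccontr)
  assume "\<gamma> \<notin> pos"
  moreover have g: "\<gamma> \<in> \<Delta>" using assms by (simp add: maximal_root_def)
  ultimately have p: "- \<gamma> \<in> pos" using pos_or_neg by blast
  have "0 \<le> - cf i \<gamma>" for i using pos_cf[OF p, of i] by (simp add: cf_uminus)
  then have "dom_le \<gamma> (- \<gamma>)" unfolding dom_le_def cf_uminus
    by (metis neg_0_le_iff_le order_trans)
  then have "- \<gamma> = \<gamma>" using assms pos_root[OF p] by (auto simp: maximal_root_def)
  then show False using root_neq_uminus[OF g] by simp
qed

text \<open>
  Here irreducibility enters. Dominance forces the simple roots outside the support of \<open>\<gamma>\<close> to be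
  orthogonal to those in the support. The spans of both sets are then stable under all simple
  reflections, and since every root is conjugate to a simple one, this splits the root system.
\<close>
lemma maximal_root_support:
  assumes "maximal_root \<gamma>" shows "0 < cf i \<gamma>"
proof -
  define I where "I = {i. cf i \<gamma> > 0}"
  have p: "\<gamma> \<in> pos" by (rule maximal_root_pos[OF assms])
  have off: "cf k \<gamma> = 0" if "k \<notin> I" for k using pos_cf[OF p, of k] that by (auto simp: I_def)
  have orth: "\<alpha> i \<bullet> \<alpha> k = 0" if "i \<in> I" "k \<notin> I" for i k
  proof -
    have np: "\<alpha> j \<bullet> \<alpha> k \<le> 0" if "j \<noteq> k" for j
    proof -
      have r: "reflect (\<alpha> k) (\<alpha> j) \<in> pos" using reflect_simple_pos[OF simple_pos] that inj_simple by (metis injD)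
      have "cf k (reflect (\<alpha> k) (\<alpha> j)) = - (\<alpha> j \<bullet> coroot (\<alpha> k))"
        using that by (simp add: reflect_def cf_diff cf_scale cf_simple)
      then have "\<alpha> j \<bullet> coroot (\<alpha> k) \<le> 0" using pos_cf[OF r, of k] by simp
      then have "(\<alpha> j \<bullet> coroot (\<alpha> k)) * (\<alpha> k \<bullet> \<alpha> k) \<le> 0" by (simp add: mult_nonpos_nonneg)
      then show ?thesis using simple_nz[of k] by (simp add: coroot_inner)
    qed
    have "\<gamma> \<bullet> \<alpha> k = (\<Sum>j\<in>UNIV. cf j \<gamma> * (\<alpha> j \<bullet> \<alpha> k))"
      by (subst cf_expand[of \<gamma>, symmetric]) (simp add: inner_sum_left)
    then have s: "0 \<le> (\<Sum>j\<in>UNIV. cf j \<gamma> * (\<alpha> j \<bullet> \<alpha> k))" using maximal_root_dominant[OF assms, of k] by simp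
    have t: "cf j \<gamma> * (\<alpha> j \<bullet> \<alpha> k) \<le> 0" for j
      using pos_cf[OF p, of j] np[of j] off[OF that(2)] by (cases "j = k") (auto intro: mult_nonneg_nonpos)
    have "(\<Sum>j\<in>UNIV. - (cf j \<gamma> * (\<alpha> j \<bullet> \<alpha> k))) = 0"
      using s t by (intro antisym sum_nonneg) (auto simp: sum_negf)
    then have "- (cf i \<gamma> * (\<alpha> i \<bullet> \<alpha> k)) = 0" using t by (subst (asm) sum_nonneg_eq_0_iff) auto
    then show ?thesis using that(1) by (simp add: I_def)
  qed
  define V1 where "V1 = {v. \<forall>k. k \<notin> I \<longrightarrow> cf k v = 0}"
  define V2 where "V2 = {v. \<forall>k. k \<in> I \<longrightarrow> cf k v = 0}"
  have V: "u \<bullet> v = 0" if "u \<in> V1" "v \<in> V2" for u v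
  proof -
    have "(\<Sum>i\<in>UNIV. cf i u *\<^sub>R \<alpha> i) \<bullet> (\<Sum>j\<in>UNIV. cf j v *\<^sub>R \<alpha> j) = (\<Sum>j\<in>UNIV. \<Sum>i\<in>UNIV. cf i u * cf j v * (\<alpha> i \<bullet> \<alpha> j))"
      by (simp add: inner_sum_left inner_sum_right sum_distrib_left ac_simps)
    also have "\<dots> = 0"
      using that orth by (intro sum.neutral ballI) (auto simp: V1_def V2_def)
    finally show ?thesis by (simp only: cf_expand)
  qed
  have a: "\<alpha> i \<in> V1 \<union> V2" for i by (auto simp: V1_def V2_def cf_simple)
  have V0: "u \<bullet> v = 0" if "u \<in> V2" "v \<in> V1" for u v using V[OF that(2,1)] by (simp add: inner_commute)
  have r: "reflect (\<alpha> i) v \<in> V1" if "v \<in> V1" for i v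
  proof (cases "i \<in> I")
    case True then show ?thesis using that by (auto simp: V1_def reflect_def cf_diff cf_scale cf_simple)
  next
    case False
    then have "\<alpha> i \<in> V2" by (auto simp: V2_def cf_simple)
    then show ?thesis using V[OF that] that by (simp add: reflect_def coroot_inner)
  qed
  have r': "reflect (\<alpha> i) v \<in> V2" if "v \<in> V2" for i v
  proof (cases "i \<in> I")
    case False then show ?thesis using that by (auto simp: V2_def reflect_def cf_diff cf_scale cf_simple)
  next
    case True
    then have "\<alpha> i \<in> V1" by (auto simp: V1_def cf_simple)
    then show ?thesis using V0[OF that] that by (simp add: reflect_def coroot_inner)
  qed
  have w: "word_prod \<alpha> is v \<in> V1" if "v \<in> V1" for "is" v using that by (induction "is") (auto intro: r)
  have w': "word_prod \<alpha> is v \<in> V2" if "v \<in> V2" for "is" v using that by (induction "is") (auto intro: r')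
  have pV: "\<beta> \<in> V1 \<union> V2" if "\<beta> \<in> pos" for \<beta>
    using root_conj_simple[OF that] a w w' by blast
  have "\<beta> \<in> V1 \<union> V2" if b: "\<beta> \<in> \<Delta>" for \<beta>
    using pos_or_neg[OF b] pV[of \<beta>] pV[of "- \<beta>"] by (auto simp: V1_def V2_def cf_uminus)
  then have "\<Delta> = (\<Delta> \<inter> V1) \<union> (\<Delta> \<inter> V2) \<and> (\<forall>\<beta>\<in>\<Delta> \<inter> V1. \<forall>\<gamma>\<in>\<Delta> \<inter> V2. \<beta> \<bullet> \<gamma> = 0)" using V by blast
  then have "\<Delta> \<inter> V1 = {} \<or> \<Delta> \<inter> V2 = {}"
    using irreducible unfolding irreducible_root_system_def by meson
  moreover have "\<gamma> \<in> \<Delta> \<inter> V1" using p pos_root off by (auto simp: V1_def)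
  ultimately have "\<alpha> i \<notin> V2" using simple_root by blast
  then show ?thesis by (auto simp: V2_def cf_simple I_def split: if_splits)
qed

text \<open>
  Two maximal roots have positive inner product, by dominance of one and full support of the other.
  Then their difference is zero or a root, and in the latter case they are comparable.
\<close>
lemma maximal_root_unique:
  assumes "maximal_root \<gamma>" "maximal_root \<delta>" shows "\<gamma> = \<delta>"
proof (rule ccontr)
  assume ne: "\<gamma> \<noteq> \<delta>"
  have g: "\<gamma> \<in> \<Delta>" and d: "\<delta> \<in> \<Delta>" using assms by (auto simp: maximal_root_def)
  have exp: "\<gamma> \<bullet> \<eta> = (\<Sum>j\<in>UNIV. cf j \<eta> * (\<gamma> \<bullet> \<alpha> j))" for \<eta>
    by (subst cf_expand[of \<eta>, symmetric]) (simp add: inner_sum_right)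
  have "\<exists>i. \<gamma> \<bullet> \<alpha> i \<noteq> 0"
  proof (rule ccontr)
    assume "\<not> ?thesis" then have "\<gamma> \<bullet> \<gamma> = 0" using exp[of \<gamma>] by simp
    then show False using g zero_not_root by auto
  qed
  then obtain i where "\<gamma> \<bullet> \<alpha> i \<noteq> 0" ..
  then have i: "\<gamma> \<bullet> \<alpha> i > 0" using maximal_root_dominant[OF assms(1), of i] by simp
  have "0 < (\<Sum>j\<in>UNIV. cf j \<delta> * (\<gamma> \<bullet> \<alpha> j))"
    by (rule sum_pos2[of _ i]) (use i maximal_root_support[OF assms(2)] maximal_root_dominant[OF assms(1)] in \<open>auto intro: mult_pos_pos mult_nonneg_nonneg less_imp_le\<close>)
  then have "\<gamma> \<bullet> \<delta> > 0" unfolding exp[of \<delta>] .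
  then have r: "\<gamma> - \<delta> \<in> \<Delta>" using root_diff g d ne by blast
  then have "dom_le \<delta> \<gamma> \<or> dom_le \<gamma> \<delta>"
    using pos_or_neg[OF r] pos_cf[of "\<gamma> - \<delta>"] pos_cf[of "- (\<gamma> - \<delta>)"] unfolding dom_le_def cf_uminus cf_diff by force
  then show False using assms g d ne by (auto simp: maximal_root_def)
qed

lemma dom_le_nat_comb:
  assumes "\<beta> \<in> \<Delta>" "\<theta> \<in> \<Delta>"
  shows "dom_le \<beta> \<theta> \<longleftrightarrow> (\<exists>m :: 'n \<Rightarrow> nat. \<theta> - \<beta> = (\<Sum>i\<in>UNIV. real (m i) *\<^sub>R \<alpha> i))"
proof
  assume l: "dom_le \<beta> \<theta>"
  have c: "real (nat \<lfloor>cf i (\<theta> - \<beta>)\<rfloor>) = cf i (\<theta> - \<beta>)" for i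
  proof -
    have "cf i (\<theta> - \<beta>) \<in> \<int>" unfolding cf_diff using root_cf_Ints assms by (intro Ints_diff)
    then obtain z where z: "cf i (\<theta> - \<beta>) = of_int z" by (rule Ints_cases)
    have "0 \<le> cf i (\<theta> - \<beta>)" using l by (simp add: dom_le_def cf_diff)
    then show ?thesis by (simp add: z)
  qed
  have "\<theta> - \<beta> = (\<Sum>i\<in>UNIV. real (nat \<lfloor>cf i (\<theta> - \<beta>)\<rfloor>) *\<^sub>R \<alpha> i)"
    by (simp only: c cf_expand)
  then show "\<exists>m :: 'n \<Rightarrow> nat. \<theta> - \<beta> = (\<Sum>i\<in>UNIV. real (m i) *\<^sub>R \<alpha> i)"
    by (rule exI[of _ "\<lambda>i. nat \<lfloor>cf i (\<theta> - \<beta>)\<rfloor>"])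
next
  assume "\<exists>m :: 'n \<Rightarrow> nat. \<theta> - \<beta> = (\<Sum>i\<in>UNIV. real (m i) *\<^sub>R \<alpha> i)"
  then obtain m :: "'n \<Rightarrow> nat" where "\<theta> - \<beta> = (\<Sum>i\<in>UNIV. real (m i) *\<^sub>R \<alpha> i)" ..
  then have "cf i (\<theta> - \<beta>) = real (m i)" for i by (simp add: cf_sum)
  then have "0 \<le> cf i (\<theta> - \<beta>)" for i by simp
  then show "dom_le \<beta> \<theta>" by (simp add: dom_le_def cf_diff)
qed

lemma highest_root_in: "highest_root \<Delta> \<alpha> \<in> \<Delta>"
proof -
  obtain \<theta> where \<theta>: "maximal_root \<theta>" using maximal_root_above simple_root by blast
  then have t: "\<theta> \<in> \<Delta>" by (simp add: maximal_root_def)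
  have top: "dom_le \<beta> \<theta>" if "\<beta> \<in> \<Delta>" for \<beta>
    using maximal_root_above[OF that] maximal_root_unique \<theta> by metis
  have "highest_root \<Delta> \<alpha> = \<theta>"
    unfolding highest_root_def
  proof (rule the_equality)
    show "\<theta> \<in> \<Delta> \<and> (\<forall>\<beta>\<in>\<Delta>. \<exists>m :: 'n \<Rightarrow> nat. \<theta> - \<beta> = (\<Sum>i\<in>UNIV. real (m i) *\<^sub>R \<alpha> i))"
      using t top dom_le_nat_comb by blast
  next
    fix \<eta> assume e: "\<eta> \<in> \<Delta> \<and> (\<forall>\<beta>\<in>\<Delta>. \<exists>m :: 'n \<Rightarrow> nat. \<eta> - \<beta> = (\<Sum>i\<in>UNIV. real (m i) *\<^sub>R \<alpha> i))"
    then have "dom_le \<theta> \<eta>" using dom_le_nat_comb t by blast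
    then show "\<eta> = \<theta>" using e \<theta> by (auto simp: maximal_root_def)
  qed
  then show ?thesis using t by simp
qed

end

section \<open>Automorphisms of the field of rational functions that permute monomials\<close>

definition expo_embedding :: "('n::{finite,linorder} expo \<Rightarrow> 'n expo) \<Rightarrow> bool" where
  "expo_embedding g \<longleftrightarrow> (\<forall>x y. g (x + y) = g x + g y) \<and> inj g"

lemma expo_embedding_comp: "expo_embedding g \<Longrightarrow> expo_embedding g' \<Longrightarrow> expo_embedding (g \<circ> g')"
  by (simp add: expo_embedding_def inj_compose)

lemma push_expo_superset:
  assumes "finite S" "Poly_Mapping.keys p \<subseteq> S"
  shows "push_expo g p = (\<Sum>x\<in>S. Poly_Mapping.single (g x) (Poly_Mapping.lookup p x))"
  unfolding push_expo_def using assms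
  by (intro sum.mono_neutral_left) (auto simp: in_keys_iff)

lemma push_expo_add: "push_expo g (p + q) = push_expo g p + push_expo g q"
proof -
  let ?S = "Poly_Mapping.keys p \<union> Poly_Mapping.keys q"
  have "Poly_Mapping.keys (p + q) \<subseteq> ?S" by (rule keys_add)
  then show ?thesis
    by (simp add: push_expo_superset[of ?S] lookup_add single_add sum.distrib)
qed

lemma push_expo_0: "push_expo g 0 = 0"
  by (simp add: push_expo_def)

lemma push_expo_sum: "push_expo g (\<Sum>x\<in>S. f x) = (\<Sum>x\<in>S. push_expo g (f x))"
  by (induction S rule: infinite_finite_induct) (simp_all add: push_expo_0 push_expo_add)

lemma push_expo_single: "push_expo g (Poly_Mapping.single x c) = Poly_Mapping.single (g x) c"
  by (subst push_expo_superset[of "{x}"]) auto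

lemma laurent_expand: "(\<Sum>x\<in>Poly_Mapping.keys p. Poly_Mapping.single x (Poly_Mapping.lookup p x)) = p"
  by (rule poly_mapping_eqI) (simp add: lookup_sum lookup_single when_def not_in_keys_iff_lookup_eq_zero)

lemma push_expo_comp: "push_expo g (push_expo g' p) = push_expo (g \<circ> g') p"
  unfolding push_expo_def[of g'] push_expo_sum push_expo_single by (simp add: push_expo_def)

lemma push_expo_mult:
  assumes "expo_embedding g" shows "push_expo g (p * q) = push_expo g p * push_expo g q"
proof -
  have "push_expo g (p * q) = push_expo g ((\<Sum>x\<in>Poly_Mapping.keys p. Poly_Mapping.single x (Poly_Mapping.lookup p x)) *
      (\<Sum>y\<in>Poly_Mapping.keys q. Poly_Mapping.single y (Poly_Mapping.lookup q y)))"
    by (simp only: laurent_expand)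
  also have "\<dots> = push_expo g p * push_expo g q"
    using assms unfolding push_expo_def[of g p] push_expo_def[of g q]
    by (simp add: sum_product push_expo_sum mult_single push_expo_single expo_embedding_def)
  finally show ?thesis .
qed

lemma lookup_push_expo:
  assumes "expo_embedding g" shows "Poly_Mapping.lookup (push_expo g p) (g x) = Poly_Mapping.lookup p x"
proof -
  have "inj g" using assms by (simp add: expo_embedding_def)
  then show ?thesis
    by (simp add: push_expo_def lookup_sum lookup_single when_def inj_eq not_in_keys_iff_lookup_eq_zero)
qed

lemma push_expo_eq_0_iff: "expo_embedding g \<Longrightarrow> push_expo g p = 0 \<longleftrightarrow> p = 0"
  by (metis lookup_push_expo lookup_zero poly_mapping_eqI push_expo_0)

text \<open>
  Injectivity of \<open>g\<close> keeps denominators nonzero, additivity makes the result independent of the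
  representing fraction.
\<close>
lemma monomial_subst_Fract:
  assumes g: "expo_embedding g" and b: "b \<noteq> 0"
  shows "monomial_subst g (Fract a b) = Fract (push_expo g a) (push_expo g b)"
  unfolding monomial_subst_def
proof (rule the_equality)
  show "\<exists>a' b'. b' \<noteq> 0 \<and> Fract a b = Fract a' b' \<and> Fract (push_expo g a) (push_expo g b) = Fract (push_expo g a') (push_expo g b')"
    using b by blast
next
  fix f' assume "\<exists>a' b'. b' \<noteq> 0 \<and> Fract a b = Fract a' b' \<and> f' = Fract (push_expo g a') (push_expo g b')"
  then obtain a' b' where *: "b' \<noteq> 0" "Fract a b = Fract a' b'" "f' = Fract (push_expo g a') (push_expo g b')" by blast
  then have "a * b' = a' * b" using b by (simp add: eq_fract)
  then have "push_expo g a * push_expo g b' = push_expo g a' * push_expo g b" by (metis push_expo_mult[OF g])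
  then show "f' = Fract (push_expo g a) (push_expo g b)"
    using * b by (simp add: eq_fract push_expo_eq_0_iff[OF g])
qed

lemma of_laurent_0: "of_laurent 0 = 0" and of_laurent_1: "of_laurent 1 = 1"
  and of_laurent_add: "of_laurent (p + q) = of_laurent p + of_laurent q"
  and of_laurent_mult: "of_laurent (p * q) = of_laurent p * of_laurent q"
  and of_laurent_uminus: "of_laurent (- p) = - of_laurent p"
  and of_laurent_inj: "of_laurent p = of_laurent q \<longleftrightarrow> p = q"
  by (simp_all add: of_laurent_def Zero_fract_def One_fract_def eq_fract)

lemma of_laurent_sum: "of_laurent (\<Sum>x\<in>S. f x) = (\<Sum>x\<in>S. of_laurent (f x))"
  by (induction S rule: infinite_finite_induct) (simp_all add: of_laurent_0 of_laurent_add)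

context
  fixes g :: "'n::{finite,linorder} expo \<Rightarrow> 'n expo"
  assumes g: "expo_embedding g"
begin

lemma push_expo_1: "push_expo g 1 = 1"
proof -
  have "g (0 + 0) = g 0 + g 0" using g unfolding expo_embedding_def by blast
  then have "g 0 = 0" by simp
  then show ?thesis using push_expo_single[of g 0 1] by simp
qed

lemma subst_of_laurent: "monomial_subst g (of_laurent p) = of_laurent (push_expo g p)"
  by (simp add: of_laurent_def monomial_subst_Fract[OF g] push_expo_1)

lemma subst_add: "monomial_subst g (f + f') = monomial_subst g f + monomial_subst g f'"
proof (cases f rule: Fract_cases)
  case (Fract a b)
  obtain c d where "f' = Fract c d" "d \<noteq> 0" by (cases f' rule: Fract_cases)
  then show ?thesis using Fract
    by (simp add: monomial_subst_Fract[OF g] push_expo_add push_expo_mult[OF g] push_expo_eq_0_iff[OF g])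
qed

lemma subst_mult: "monomial_subst g (f * f') = monomial_subst g f * monomial_subst g f'"
proof (cases f rule: Fract_cases)
  case (Fract a b)
  obtain c d where "f' = Fract c d" "d \<noteq> 0" by (cases f' rule: Fract_cases)
  then show ?thesis using Fract
    by (simp add: monomial_subst_Fract[OF g] push_expo_mult[OF g] push_expo_eq_0_iff[OF g])
qed

lemma subst_1: "monomial_subst g 1 = 1"
  using subst_of_laurent[of 1] by (simp add: of_laurent_1 push_expo_1)

lemma subst_0: "monomial_subst g 0 = 0"
  using subst_of_laurent[of 0] by (simp add: of_laurent_0 push_expo_0)

lemma subst_uminus: "monomial_subst g (- f) = - monomial_subst g f"
  using subst_add[of f "- f"] by (simp add: subst_0 minus_unique)

lemma subst_diff: "monomial_subst g (f - f') = monomial_subst g f - monomial_subst g f'"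
  using subst_add[of f "- f'"] by (simp add: subst_uminus)

lemma subst_eq_0_iff: "monomial_subst g f = 0 \<longleftrightarrow> f = 0"
proof
  assume "monomial_subst g f = 0"
  then have "f \<noteq> 0 \<Longrightarrow> monomial_subst g (f * inverse f) = 0" unfolding subst_mult by simp
  then show "f = 0" by (cases "f = 0") (simp_all add: subst_1)
qed (simp add: subst_0)

lemma subst_inverse: "monomial_subst g (inverse f) = inverse (monomial_subst g f)"
proof (cases "f = 0")
  case False
  then have "monomial_subst g f * monomial_subst g (inverse f) = 1"
    unfolding subst_mult[symmetric] by (simp add: subst_1)
  then show ?thesis by (metis inverse_unique)
qed (simp add: subst_0)

lemma subst_divide: "monomial_subst g (f / f') = monomial_subst g f / monomial_subst g f'"
  by (simp add: divide_inverse subst_mult subst_inverse)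

lemma subst_power: "monomial_subst g (f ^ n) = monomial_subst g f ^ n"
  by (induction n) (simp_all add: subst_1 subst_mult)

lemma subst_powi: "monomial_subst g (f powi k) = monomial_subst g f powi k"
  by (simp add: power_int_def subst_power subst_inverse)

lemma subst_sum: "monomial_subst g (\<Sum>x\<in>S. h x) = (\<Sum>x\<in>S. monomial_subst g (h x))"
  by (induction S rule: infinite_finite_induct) (simp_all add: subst_0 subst_add)

end

lemma subst_comp:
  assumes "expo_embedding g" "expo_embedding g'"
  shows "monomial_subst g (monomial_subst g' f) = monomial_subst (g \<circ> g') f"
proof (cases f rule: Fract_cases)
  case (Fract a b)
  then show ?thesis using assms
    by (simp add: monomial_subst_Fract expo_embedding_comp push_expo_eq_0_iff push_expo_comp)
qed

lemma subst_id: "monomial_subst id f = f"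
proof (cases f rule: Fract_cases)
  case (Fract a b)
  then show ?thesis by (simp add: monomial_subst_Fract expo_embedding_def push_expo_def laurent_expand)
qed

definition monomial_fun :: "'n::{finite,linorder} expo \<Rightarrow> 'n ratfun" where
  "monomial_fun x = of_laurent (Poly_Mapping.single x 1)"

lemma monomial_fun_0: "monomial_fun 0 = 1"
  by (simp add: monomial_fun_def of_laurent_1)
lemma monomial_fun_add: "monomial_fun (x + y) = monomial_fun x * monomial_fun y"
  by (simp add: monomial_fun_def of_laurent_mult[symmetric] mult_single)
lemma monomial_fun_inj: "monomial_fun x = monomial_fun y \<longleftrightarrow> x = y"
proof
  assume "monomial_fun x = monomial_fun y"
  then have "Poly_Mapping.lookup (Poly_Mapping.single x (1::complex)) x = Poly_Mapping.lookup (Poly_Mapping.single y 1) x"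
    by (simp add: monomial_fun_def of_laurent_inj)
  then show "x = y" by (simp add: lookup_single when_def split: if_splits)
qed simp
lemma monomial_fun_uminus: "monomial_fun (- x) = inverse (monomial_fun x)"
  by (rule inverse_unique[symmetric]) (simp add: monomial_fun_add[symmetric] monomial_fun_0)
lemma monomial_fun_nz: "monomial_fun x \<noteq> 0"
proof
  assume "monomial_fun x = 0"
  then have "monomial_fun (x + - x) = 0" by (simp only: monomial_fun_add mult_zero_left)
  then show False by (simp add: monomial_fun_0)
qed
lemma subst_monomial_fun: "expo_embedding g \<Longrightarrow> monomial_subst g (monomial_fun x) = monomial_fun (g x)"
  by (simp add: monomial_fun_def subst_of_laurent push_expo_single)
lemma tvar_monomial_fun: "tvar = monomial_fun (Poly_Mapping.single None 1)"
  and qvar_monomial_fun: "qvar = monomial_fun (Poly_Mapping.single (Some None) 1)"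
  and efun_monomial_fun: "efun \<alpha> v = monomial_fun (expo_of \<alpha> v)"
  by (simp_all add: tvar_def qvar_def efun_def monomial_fun_def)

text \<open>
  Artin's argument: if \<open>\<phi>\<^sub>i(y)\<close> and \<open>\<phi>\<^sub>k(y)\<close> differ, evaluate the relation at \<open>y + x\<close> and subtract \<open>\<phi>\<^sub>k(y)\<close>
  times the relation at \<open>x\<close>. This removes the term of \<open>k\<close> and multiplies the coefficient of \<open>i\<close> by a
  nonzero factor.
\<close>
lemma characters_independent:
  fixes \<phi> :: "'i \<Rightarrow> 'm::comm_monoid_add \<Rightarrow> 'a::field"
  assumes "finite I" "\<And>i x y. i \<in> I \<Longrightarrow> \<phi> i (x + y) = \<phi> i x * \<phi> i y" "\<And>i. i \<in> I \<Longrightarrow> \<phi> i 0 = 1"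
    "\<And>i j. i \<in> I \<Longrightarrow> j \<in> I \<Longrightarrow> (\<And>x. \<phi> i x = \<phi> j x) \<Longrightarrow> i = j"
    "\<And>x. (\<Sum>i\<in>I. a i * \<phi> i x) = 0" "i \<in> I"
  shows "a i = 0"
  using assms
proof (induction I arbitrary: a i rule: finite_induct)
  case empty then show ?case by simp
next
  case (insert k I)
  have eq: "a k * \<phi> k x + (\<Sum>i\<in>I. a i * \<phi> i x) = 0" for x
    using insert.prems(4)[of x] insert.hyps by simp
  have z: "a i = 0" if i: "i \<in> I" for i
  proof -
    have "\<exists>y. \<phi> i y \<noteq> \<phi> k y" using insert.prems(3)[of i k] i insert.hyps by blast
    then obtain y where y: "\<phi> i y \<noteq> \<phi> k y" ..
    have "(\<Sum>i\<in>I. (a i * (\<phi> i y - \<phi> k y)) * \<phi> i x) = 0" for x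
    proof -
      have "a k * \<phi> k (y + x) + (\<Sum>i\<in>I. a i * \<phi> i (y + x)) - \<phi> k y * (a k * \<phi> k x + (\<Sum>i\<in>I. a i * \<phi> i x)) = 0"
        by (simp only: eq) simp
      then have "(\<Sum>i\<in>I. a i * \<phi> i (y + x)) - \<phi> k y * (\<Sum>i\<in>I. a i * \<phi> i x) = 0"
        using insert.prems(1)[of k y x] by (simp add: algebra_simps)
      moreover have "(\<Sum>i\<in>I. a i * \<phi> i (y + x)) = (\<Sum>i\<in>I. a i * (\<phi> i y * \<phi> i x))"
        using insert.prems(1) by (intro sum.cong) simp_all
      ultimately have "(\<Sum>i\<in>I. a i * (\<phi> i y * \<phi> i x)) - \<phi> k y * (\<Sum>i\<in>I. a i * \<phi> i x) = 0" by simp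
      then show ?thesis by (simp add: sum_distrib_left sum_subtractf[symmetric] algebra_simps)
    qed
    then have "a i * (\<phi> i y - \<phi> k y) = 0"
      using insert.IH[of "\<lambda>i. a i * (\<phi> i y - \<phi> k y)" i] insert.prems(1,2,3) i by blast
    then show ?thesis using y by simp
  qed
  have "a k = 0" using eq[of 0] z insert.prems(2)[of k] by simp
  then show ?case using z insert.prems(5) by blast
qed

section \<open>Weyl group elements and shifts as automorphisms\<close>

definition subring :: "'n::{finite,linorder} ratfun set \<Rightarrow> bool" where
  "subring R \<longleftrightarrow> 0 \<in> R \<and> 1 \<in> R \<and> (\<forall>a\<in>R. \<forall>b\<in>R. a + b \<in> R \<and> a * b \<in> R) \<and> (\<forall>a\<in>R. - a \<in> R)"

lemma subringD:
  assumes "subring R"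
  shows "0 \<in> R" "1 \<in> R" "a \<in> R \<Longrightarrow> b \<in> R \<Longrightarrow> a + b \<in> R" "a \<in> R \<Longrightarrow> b \<in> R \<Longrightarrow> a * b \<in> R"
    "a \<in> R \<Longrightarrow> - a \<in> R" "a \<in> R \<Longrightarrow> b \<in> R \<Longrightarrow> a - b \<in> R"
  using assms by (auto simp: subring_def simp del: add_uminus_conv_diff simp: diff_conv_add_uminus)

lemma subring_sum: "subring R \<Longrightarrow> (\<And>x. x \<in> S \<Longrightarrow> f x \<in> R) \<Longrightarrow> sum f S \<in> R"
  by (induction S rule: infinite_finite_induct) (auto simp: subringD)

lemma subring_power: "subring R \<Longrightarrow> a \<in> R \<Longrightarrow> a ^ n \<in> R"
  by (induction n) (auto simp: subringD)

lemma torus_ring_subring: "subring torus_ring"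
proof -
  let ?P = "{p. \<forall>x\<in>Poly_Mapping.keys p. Poly_Mapping.lookup x None = 0}"
  have "of_laurent p + of_laurent q \<in> torus_ring" "of_laurent p * of_laurent q \<in> torus_ring" "- of_laurent p \<in> torus_ring"
    if "p \<in> ?P" "q \<in> ?P" for p q :: "'a laurent"
  proof -
    have "p + q \<in> ?P" using that keys_add[of p q] by blast
    then show "of_laurent p + of_laurent q \<in> torus_ring" unfolding torus_ring_def of_laurent_add[symmetric] by blast
    have "p * q \<in> ?P" using that keys_mult[of p q] by (fastforce simp: lookup_add)
    then show "of_laurent p * of_laurent q \<in> torus_ring" unfolding torus_ring_def of_laurent_mult[symmetric] by blast
    have "- p \<in> ?P" using that by (auto simp: in_keys_iff)
    then show "- of_laurent p \<in> torus_ring" unfolding torus_ring_def of_laurent_uminus[symmetric] by blast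
  qed
  moreover have "of_laurent 0 \<in> torus_ring" "of_laurent 1 \<in> torus_ring" by (auto simp: torus_ring_def intro!: imageI)
  ultimately show ?thesis unfolding subring_def by (auto simp: of_laurent_0 of_laurent_1 torus_ring_def)
qed

lemma monomial_fun_torus: "Poly_Mapping.lookup x None = 0 \<Longrightarrow> monomial_fun x \<in> torus_ring"
  by (auto simp: torus_ring_def monomial_fun_def intro!: imageI)

lemma torus_ring_field: "a \<in> torus_ring \<Longrightarrow> a \<in> torus_field"
  using subringD(2)[OF torus_ring_subring] unfolding torus_field_def by (intro CollectI exI[of _ a] exI[of _ 1]) auto

lemma torus_field_subring: "subring torus_field"
proof -
  note D = subringD[OF torus_ring_subring]
  have "f + g \<in> torus_field \<and> f * g \<in> torus_field" if fg: "f \<in> torus_field" "g \<in> torus_field" for f g :: "'a ratfun"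
  proof -
    obtain a b where f: "f = a / b" "a \<in> torus_ring" "b \<in> torus_ring" "b \<noteq> 0" using fg(1) unfolding torus_field_def by blast
    obtain c d where g: "g = c / d" "c \<in> torus_ring" "d \<in> torus_ring" "d \<noteq> 0" using fg(2) unfolding torus_field_def by blast
    have "f + g = (a * d + c * b) / (b * d)" "f * g = (a * c) / (b * d)" using f g by (simp_all add: field_simps)
    moreover have "a * d + c * b \<in> torus_ring" "a * c \<in> torus_ring" "b * d \<in> torus_ring" "b * d \<noteq> 0" using f g D by auto
    ultimately show ?thesis unfolding torus_field_def by blast
  qed
  moreover have "- f \<in> torus_field" if ft: "f \<in> torus_field" for f :: "'a ratfun"
  proof -
    obtain a b where f: "f = a / b" "a \<in> torus_ring" "b \<in> torus_ring" "b \<noteq> 0" using ft unfolding torus_field_def by blast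
    have "- f = (- a) / b" "- a \<in> torus_ring" using f D by simp_all
    then show ?thesis using f(3,4) unfolding torus_field_def by blast
  qed
  ultimately show ?thesis using D(1,2) torus_ring_field unfolding subring_def by blast
qed

lemma torus_field_inverse: "a \<in> torus_field \<Longrightarrow> inverse a \<in> torus_field"
proof -
  assume "a \<in> torus_field"
  then obtain b c where a: "a = b / c" "b \<in> torus_ring" "c \<in> torus_ring" "c \<noteq> 0" by (auto simp: torus_field_def)
  show ?thesis
  proof (cases "b = 0")
    case True then show ?thesis using a subringD(1)[OF torus_field_subring] by simp
  next
    case False
    then show ?thesis using a unfolding torus_field_def by (intro CollectI exI[of _ c] exI[of _ b]) auto
  qed
qed

lemma tvar_nz: "tvar \<noteq> 0"
  by (simp add: tvar_monomial_fun monomial_fun_nz)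

lemma laurent_term: "f \<in> F \<Longrightarrow> f * tvar powi k \<in> laurent_in_t F"
  unfolding laurent_in_t_def by (intro CollectI exI[of _ "{k}"] exI[of _ "\<lambda>_. f"]) auto

lemma laurent_in_t_subring:
  assumes "subring F" shows "subring (laurent_in_t F)"
proof -
  note D = subringD[OF assms]
  have add: "a + b \<in> laurent_in_t F" if "a \<in> laurent_in_t F" "b \<in> laurent_in_t F" for a b
  proof -
    obtain S f where a: "a = (\<Sum>k\<in>S. f k * tvar powi k)" "finite S" "\<forall>k\<in>S. f k \<in> F"
      using \<open>a \<in> _\<close> by (auto simp: laurent_in_t_def)
    obtain S' f' where b: "b = (\<Sum>k\<in>S'. f' k * tvar powi k)" "finite S'" "\<forall>k\<in>S'. f' k \<in> F"
      using \<open>b \<in> _\<close> by (auto simp: laurent_in_t_def)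
    let ?f = "\<lambda>k. if k \<in> S then f k else 0" and ?f' = "\<lambda>k. if k \<in> S' then f' k else 0"
    have "a = (\<Sum>k\<in>S \<union> S'. ?f k * tvar powi k)" unfolding a(1)
      by (rule sum.mono_neutral_cong_left) (use a(2) b(2) in auto)
    moreover have "b = (\<Sum>k\<in>S \<union> S'. ?f' k * tvar powi k)" unfolding b(1)
      by (rule sum.mono_neutral_cong_left) (use a(2) b(2) in auto)
    ultimately have "a + b = (\<Sum>k\<in>S \<union> S'. (?f k + ?f' k) * tvar powi k)" by (simp only: sum.distrib distrib_right)
    moreover have "\<forall>k\<in>S \<union> S'. ?f k + ?f' k \<in> F" using a(3) b(3) D by auto
    ultimately show ?thesis unfolding laurent_in_t_def using a(2) b(2)
      by (intro CollectI exI[of _ "S \<union> S'"] exI[of _ "\<lambda>k. ?f k + ?f' k"]) auto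
  qed
  have z: "0 \<in> laurent_in_t F" unfolding laurent_in_t_def by (intro CollectI exI[of _ "{}"]) auto
  have sum: "sum g S \<in> laurent_in_t F" if "\<And>x. x \<in> S \<Longrightarrow> g x \<in> laurent_in_t F" for g and S :: "int set"
    using that by (induction S rule: infinite_finite_induct) (auto simp: z add)
  have mult: "a * b \<in> laurent_in_t F" if "a \<in> laurent_in_t F" "b \<in> laurent_in_t F" for a b
  proof -
    obtain S f where a: "a = (\<Sum>k\<in>S. f k * tvar powi k)" "finite S" "\<forall>k\<in>S. f k \<in> F"
      using \<open>a \<in> _\<close> by (auto simp: laurent_in_t_def)
    obtain S' f' where b: "b = (\<Sum>k\<in>S'. f' k * tvar powi k)" "finite S'" "\<forall>k\<in>S'. f' k \<in> F"
      using \<open>b \<in> _\<close> by (auto simp: laurent_in_t_def)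
    have "(f k * tvar powi k) * (f' l * tvar powi l) = (f k * f' l) * tvar powi (k + l)" for k l
      by (simp add: power_int_add tvar_nz)
    then have "a * b = (\<Sum>k\<in>S. \<Sum>l\<in>S'. (f k * f' l) * tvar powi (k + l))"
      unfolding a(1) b(1) sum_product by (simp only:)
    then show ?thesis using a(3) b(3) D by (auto intro!: sum laurent_term)
  qed
  have um: "- a \<in> laurent_in_t F" if "a \<in> laurent_in_t F" for a
  proof -
    have "-1 \<in> laurent_in_t F" using laurent_term[of "-1" F 0] D by simp
    from mult[OF this that] show ?thesis by simp
  qed
  show ?thesis unfolding subring_def using z add mult um laurent_term[of 1 F 0] D by simp
qed

locale root_functions = root_datum \<Delta> \<alpha> for \<Delta> :: "'v::euclidean_space set" and \<alpha> :: "'n::{finite,linorder} \<Rightarrow> 'v"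
begin

lemma lookup_expo_of: "Poly_Mapping.lookup (expo_of \<alpha> v) (Some (Some i)) = \<lfloor>cf i v\<rfloor>"
  "Poly_Mapping.lookup (expo_of \<alpha> v) None = 0" "Poly_Mapping.lookup (expo_of \<alpha> v) (Some None) = 0"
  by (simp_all add: expo_of_def lookup_sum lookup_single when_def cf_def)

lemma cf_expo_vec: "cf i (expo_vec \<alpha> x) = of_int (Poly_Mapping.lookup x (Some (Some i)))"
  unfolding expo_vec_def by (rule cf_sum)

lemma expo_vec_add: "expo_vec \<alpha> (x + y) = expo_vec \<alpha> x + expo_vec \<alpha> y"
  by (rule cf_eqI) (simp add: cf_expo_vec cf_add lookup_add)

text \<open>
  An exponent is determined by its powers of \<open>t\<close> and \<open>q\<close> and its vector in the root lattice. All
  equations between maps of exponents are verified through these three data.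
\<close>
lemma expo_eqI:
  assumes "Poly_Mapping.lookup x None = Poly_Mapping.lookup y None"
    "Poly_Mapping.lookup x (Some None) = Poly_Mapping.lookup y (Some None)"
    "expo_vec \<alpha> x = expo_vec \<alpha> y"
  shows "x = y"
proof (rule poly_mapping_eqI)
  fix k
  have "Poly_Mapping.lookup x (Some (Some i)) = Poly_Mapping.lookup y (Some (Some i))" for i
    using arg_cong[OF assms(3), of "cf i"] by (simp add: cf_expo_vec)
  then show "Poly_Mapping.lookup x k = Poly_Mapping.lookup y k"
    using assms(1,2) by (cases k rule: option.exhaust; cases "the k") auto
qed

definition lattice :: "'v set" where "lattice = {v. \<forall>i. cf i v \<in> \<int>}"

lemma expo_vec_lattice: "expo_vec \<alpha> x \<in> lattice"
  by (simp add: lattice_def cf_expo_vec)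

lemma expo_vec_expo_of: "v \<in> lattice \<Longrightarrow> expo_vec \<alpha> (expo_of \<alpha> v) = v"
  by (rule cf_eqI) (auto simp: cf_expo_vec lookup_expo_of lattice_def)

lemma root_lattice: "\<beta> \<in> \<Delta> \<Longrightarrow> \<beta> \<in> lattice"
  by (simp add: lattice_def root_cf_Ints)

lemma weyl_lattice:
  assumes "w \<in> weyl \<Delta>" "v \<in> lattice" shows "w v \<in> lattice"
proof -
  have "w v = (\<Sum>i\<in>UNIV. cf i v *\<^sub>R w (\<alpha> i))"
    by (subst cf_expand[of v, symmetric]) (simp add: linear_sum[OF weyl_linear[OF assms(1)]] linear_scale[OF weyl_linear[OF assms(1)]])
  then have "cf k (w v) = (\<Sum>i\<in>UNIV. cf i v * cf k (w (\<alpha> i)))" for k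
    by (simp add: linear_sum[OF linear_cf] cf_scale)
  then show ?thesis using assms(2) root_cf_Ints[OF weyl_root[OF assms(1) simple_root]]
    by (auto simp: lattice_def intro!: Ints_sum Ints_mult)
qed

lemma coweight_pairing:
  assumes "\<mu> \<in> coweight_lattice \<Delta>" "v \<in> lattice" shows "v \<bullet> \<mu> \<in> \<int>"
proof -
  have "v \<bullet> \<mu> = (\<Sum>i\<in>UNIV. cf i v * (\<alpha> i \<bullet> \<mu>))"
    by (subst cf_expand[of v, symmetric]) (simp add: inner_sum_left)
  then show ?thesis using assms simple_root by (auto simp: lattice_def coweight_lattice_def intro!: Ints_sum Ints_mult)
qed

lemma weyl_coweight:
  assumes "w \<in> weyl \<Delta>" "\<mu> \<in> coweight_lattice \<Delta>" shows "w \<mu> \<in> coweight_lattice \<Delta>"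
proof -
  have "\<beta> \<bullet> w \<mu> = inv w \<beta> \<bullet> \<mu>" for \<beta>
    using weyl_isometry[OF assms(1), of "inv w \<beta>" \<mu>] by (simp add: weyl_inv_apply assms(1))
  then show ?thesis using assms weyl_root[OF weyl_inv[OF assms(1)]] by (auto simp: coweight_lattice_def)
qed

lemma coroot_coweight: "\<beta> \<in> \<Delta> \<Longrightarrow> coroot \<beta> \<in> coweight_lattice \<Delta>"
  using root_pairing by (simp add: coweight_lattice_def)

lemma coweight_scale: "\<mu> \<in> coweight_lattice \<Delta> \<Longrightarrow> of_int k *\<^sub>R \<mu> \<in> coweight_lattice \<Delta>"
  by (auto simp: coweight_lattice_def)

lemma zero_coweight: "0 \<in> coweight_lattice \<Delta>"
  by (simp add: coweight_lattice_def)

definition weyl_expo :: "('v \<Rightarrow> 'v) \<Rightarrow> 'n expo \<Rightarrow> 'n expo" where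
  "weyl_expo w x = expo_of \<alpha> (w (expo_vec \<alpha> x))
     + Poly_Mapping.single (Some None) (Poly_Mapping.lookup x (Some None))
     + Poly_Mapping.single None (Poly_Mapping.lookup x None)"

definition shift_expo :: "'v \<Rightarrow> 'n expo \<Rightarrow> 'n expo" where
  "shift_expo \<mu> x = x + Poly_Mapping.single (Some None) (2 * \<lfloor>expo_vec \<alpha> x \<bullet> \<mu>\<rfloor>)"

lemma weyl_op_subst: "weyl_op \<alpha> w = monomial_subst (weyl_expo w)"
  and shift_op_subst: "shift_op \<alpha> \<mu> = monomial_subst (shift_expo \<mu>)"
  by (simp_all add: weyl_op_def shift_op_def weyl_expo_def[abs_def] shift_expo_def[abs_def])

lemma expo_vec_weyl_expo:
  assumes "w \<in> weyl \<Delta>" shows "expo_vec \<alpha> (weyl_expo w x) = w (expo_vec \<alpha> x)"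
proof -
  have "expo_vec \<alpha> (weyl_expo w x) = expo_vec \<alpha> (expo_of \<alpha> (w (expo_vec \<alpha> x)))"
    by (rule cf_eqI) (simp add: cf_expo_vec weyl_expo_def lookup_add lookup_single)
  then show ?thesis by (simp add: expo_vec_expo_of weyl_lattice[OF assms] expo_vec_lattice)
qed

lemma lookup_weyl_expo: "Poly_Mapping.lookup (weyl_expo w x) None = Poly_Mapping.lookup x None"
  "Poly_Mapping.lookup (weyl_expo w x) (Some None) = Poly_Mapping.lookup x (Some None)"
  by (simp_all add: weyl_expo_def lookup_add lookup_single lookup_expo_of)

lemma expo_vec_shift_expo: "expo_vec \<alpha> (shift_expo \<mu> x) = expo_vec \<alpha> x"
  by (rule cf_eqI) (simp add: cf_expo_vec shift_expo_def lookup_add lookup_single)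

lemma lookup_shift_expo: "Poly_Mapping.lookup (shift_expo \<mu> x) None = Poly_Mapping.lookup x None"
  "Poly_Mapping.lookup (shift_expo \<mu> x) (Some None) = Poly_Mapping.lookup x (Some None) + 2 * \<lfloor>expo_vec \<alpha> x \<bullet> \<mu>\<rfloor>"
  by (simp_all add: shift_expo_def lookup_add lookup_single)

lemma expo_embedding_weyl:
  assumes w: "w \<in> weyl \<Delta>" shows "expo_embedding (weyl_expo w)"
  unfolding expo_embedding_def
proof (intro conjI allI injI)
  fix x y
  show "weyl_expo w (x + y) = weyl_expo w x + weyl_expo w y"
    by (rule expo_eqI) (simp_all add: expo_vec_weyl_expo[OF w] expo_vec_add lookup_weyl_expo lookup_add linear_add[OF weyl_linear[OF w]])
  assume e: "weyl_expo w x = weyl_expo w y"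
  have "w (expo_vec \<alpha> x) = w (expo_vec \<alpha> y)" using e expo_vec_weyl_expo[OF w] by metis
  then have "expo_vec \<alpha> x = expo_vec \<alpha> y" using bij_is_inj[OF weyl_bij[OF w]] by (simp add: inj_eq)
  then show "x = y" using e lookup_weyl_expo by (intro expo_eqI) metis+
qed

lemma floor_pairing_add:
  assumes "\<mu> \<in> coweight_lattice \<Delta>" "u \<in> lattice" "v \<in> lattice"
  shows "\<lfloor>(u + v) \<bullet> \<mu>\<rfloor> = \<lfloor>u \<bullet> \<mu>\<rfloor> + \<lfloor>v \<bullet> \<mu>\<rfloor>"
  using coweight_pairing[OF assms(1,2)] coweight_pairing[OF assms(1,3)]
  by (auto elim!: Ints_cases simp: inner_add_left)

lemma expo_embedding_shift:
  assumes m: "\<mu> \<in> coweight_lattice \<Delta>" shows "expo_embedding (shift_expo \<mu>)"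
  unfolding expo_embedding_def
proof (intro conjI allI injI)
  fix x y
  show "shift_expo \<mu> (x + y) = shift_expo \<mu> x + shift_expo \<mu> y"
    by (rule expo_eqI) (simp_all add: expo_vec_shift_expo expo_vec_add lookup_shift_expo lookup_add
         floor_pairing_add[OF m] expo_vec_lattice)
  assume e: "shift_expo \<mu> x = shift_expo \<mu> y"
  then have v: "expo_vec \<alpha> x = expo_vec \<alpha> y" using expo_vec_shift_expo by metis
  then show "x = y" using arg_cong[OF e, of "\<lambda>x. Poly_Mapping.lookup x None"] arg_cong[OF e, of "\<lambda>x. Poly_Mapping.lookup x (Some None)"]
    by (intro expo_eqI) (simp_all add: lookup_shift_expo)
qed

definition act_expo :: "('v \<Rightarrow> 'v) \<Rightarrow> 'v \<Rightarrow> 'n expo \<Rightarrow> 'n expo" where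
  "act_expo w \<mu> = shift_expo \<mu> \<circ> weyl_expo w"

lemma act_expo:
  assumes "w \<in> weyl \<Delta>"
  shows "expo_vec \<alpha> (act_expo w \<mu> x) = w (expo_vec \<alpha> x)"
    "Poly_Mapping.lookup (act_expo w \<mu> x) None = Poly_Mapping.lookup x None"
    "Poly_Mapping.lookup (act_expo w \<mu> x) (Some None) = Poly_Mapping.lookup x (Some None) + 2 * \<lfloor>w (expo_vec \<alpha> x) \<bullet> \<mu>\<rfloor>"
  by (simp_all add: act_expo_def expo_vec_shift_expo expo_vec_weyl_expo[OF assms] lookup_shift_expo lookup_weyl_expo)

lemma expo_embedding_act: "w \<in> weyl \<Delta> \<Longrightarrow> \<mu> \<in> coweight_lattice \<Delta> \<Longrightarrow> expo_embedding (act_expo w \<mu>)"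
  unfolding act_expo_def by (intro expo_embedding_comp expo_embedding_weyl expo_embedding_shift)

abbreviation act :: "('v \<Rightarrow> 'v) \<Rightarrow> 'v \<Rightarrow> 'n ratfun \<Rightarrow> 'n ratfun" where
  "act w \<mu> f \<equiv> shift_op \<alpha> \<mu> (weyl_op \<alpha> w f)"

lemma act_subst:
  "w \<in> weyl \<Delta> \<Longrightarrow> \<mu> \<in> coweight_lattice \<Delta> \<Longrightarrow> act w \<mu> f = monomial_subst (act_expo w \<mu>) f"
  by (simp add: act_expo_def weyl_op_subst shift_op_subst subst_comp expo_embedding_weyl expo_embedding_shift)

lemma weyl_id_op: "weyl_op \<alpha> id f = f"
proof -
  have "weyl_expo id = id" by (rule ext, rule expo_eqI) (simp_all add: expo_vec_weyl_expo lookup_weyl_expo weyl_id)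
  then show ?thesis by (simp add: weyl_op_subst subst_id)
qed

lemma shift_0: "shift_op \<alpha> 0 f = f"
proof -
  have "shift_expo 0 = id" by (rule ext) (simp add: shift_expo_def)
  then show ?thesis by (simp add: shift_op_subst subst_id)
qed

lemma weyl_op_comp:
  assumes "w \<in> weyl \<Delta>" "x \<in> weyl \<Delta>" shows "weyl_op \<alpha> w (weyl_op \<alpha> x f) = weyl_op \<alpha> (w \<circ> x) f"
proof -
  have "weyl_expo w \<circ> weyl_expo x = weyl_expo (w \<circ> x)"
    by (rule ext, rule expo_eqI) (simp_all add: expo_vec_weyl_expo lookup_weyl_expo assms weyl_comp)
  then show ?thesis by (simp add: weyl_op_subst subst_comp expo_embedding_weyl assms)
qed

lemma weyl_op_act:
  assumes "x \<in> weyl \<Delta>" "w \<in> weyl \<Delta>" "\<mu> \<in> coweight_lattice \<Delta>"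
  shows "weyl_op \<alpha> x (act w \<mu> f) = act (x \<circ> w) (x \<mu>) f"
proof -
  have "weyl_expo x \<circ> act_expo w \<mu> = act_expo (x \<circ> w) (x \<mu>)"
    by (rule ext, rule expo_eqI)
       (simp_all add: act_expo expo_vec_weyl_expo lookup_weyl_expo assms weyl_comp weyl_isometry[OF assms(1)])
  then show ?thesis
    by (simp add: act_subst weyl_op_subst[of x] subst_comp expo_embedding_weyl expo_embedding_act assms weyl_comp weyl_coweight)
qed

lemma act_weyl_op:
  assumes "x \<in> weyl \<Delta>" "w \<in> weyl \<Delta>"
  shows "act w \<mu> (weyl_op \<alpha> x f) = act (w \<circ> x) \<mu> f"
  by (simp add: weyl_op_comp assms)

text \<open>
  The images of the simple roots determine \<open>w\<close>, and the powers of \<open>q\<close> that are acquired determine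
  the pairing of \<open>\<mu>\<close> with every root.
\<close>
lemma act_expo_inj:
  assumes "w \<in> weyl \<Delta>" "\<mu> \<in> coweight_lattice \<Delta>" "w' \<in> weyl \<Delta>" "\<mu>' \<in> coweight_lattice \<Delta>"
    and eq: "\<And>x. act_expo w \<mu> x = act_expo w' \<mu>' x"
  shows "w = w' \<and> \<mu> = \<mu>'"
proof
  have a: "expo_vec \<alpha> (expo_of \<alpha> (\<alpha> i)) = \<alpha> i" for i by (simp add: expo_vec_expo_of root_lattice simple_root)
  show w: "w = w'"
    using arg_cong[OF eq, of "expo_vec \<alpha>"] a by (intro weyl_eqI assms) (metis act_expo(1) assms(1,3))
  have "w v \<bullet> (\<mu> - \<mu>') = 0" if "v \<in> lattice" for v
  proof -
    have "\<lfloor>w v \<bullet> \<mu>\<rfloor> = \<lfloor>w v \<bullet> \<mu>'\<rfloor>"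
      using arg_cong[OF eq[of "expo_of \<alpha> v"], of "\<lambda>x. Poly_Mapping.lookup x (Some None)"] w
      by (simp add: act_expo assms expo_vec_expo_of that)
    then show ?thesis
      using coweight_pairing[OF assms(2) weyl_lattice[OF assms(1) that]] coweight_pairing[OF assms(4) weyl_lattice[OF assms(1) that]]
      by (auto elim!: Ints_cases simp: inner_diff_right)
  qed
  then have "\<alpha> i \<bullet> (\<mu> - \<mu>') = 0" for i
    using weyl_inv_apply(1)[OF assms(1)] weyl_lattice[OF weyl_inv[OF assms(1)] root_lattice[OF simple_root]] by metis
  then have "(\<Sum>i\<in>UNIV. cf i (\<mu> - \<mu>') *\<^sub>R \<alpha> i) \<bullet> (\<mu> - \<mu>') = 0" by (simp add: inner_sum_left)
  then show "\<mu> = \<mu>'" unfolding cf_expand by simp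
qed

lemma operators_independent:
  assumes "I \<subseteq> weyl \<Delta> \<times> coweight_lattice \<Delta>" "finite I"
    and z: "\<And>x. (\<Sum>(w, \<mu>)\<in>I. a w \<mu> * act w \<mu> (monomial_fun x)) = 0" and "(w, \<mu>) \<in> I"
  shows "a w \<mu> = 0"
proof -
  have e: "act w \<mu> (monomial_fun x) = monomial_fun (act_expo w \<mu> x)" if "(w, \<mu>) \<in> I" for w \<mu> x
    using that assms(1) by (auto simp: act_subst subst_monomial_fun expo_embedding_act)
  have m: "expo_embedding (act_expo w \<mu>)" if "(w, \<mu>) \<in> I" for w \<mu>
    using that assms(1) by (auto intro: expo_embedding_act)
  have "(\<lambda>(w, \<mu>). a w \<mu>) (w, \<mu>) = 0"
  proof (rule characters_independent[where \<phi> = "\<lambda>(w, \<mu>) x. monomial_fun (act_expo w \<mu> x)" and I = I])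
    show "(case i of (w, \<mu>) \<Rightarrow> \<lambda>x. monomial_fun (act_expo w \<mu> x)) (x + y) =
       (case i of (w, \<mu>) \<Rightarrow> \<lambda>x. monomial_fun (act_expo w \<mu> x)) x * (case i of (w, \<mu>) \<Rightarrow> \<lambda>x. monomial_fun (act_expo w \<mu> x)) y"
      if "i \<in> I" for i x y
      using m that by (cases i) (auto simp: expo_embedding_def monomial_fun_add[symmetric])
    show "(case i of (w, \<mu>) \<Rightarrow> \<lambda>x. monomial_fun (act_expo w \<mu> x)) 0 = 1" if "i \<in> I" for i
    proof (cases i)
      case (Pair w \<mu>)
      have "act_expo w \<mu> (0 + 0) = act_expo w \<mu> 0 + act_expo w \<mu> 0" using m that Pair unfolding expo_embedding_def by blast
      then show ?thesis by (simp add: Pair monomial_fun_0)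
    qed
    show "i = j" if "i \<in> I" "j \<in> I"
      "\<And>x. (case i of (w, \<mu>) \<Rightarrow> \<lambda>x. monomial_fun (act_expo w \<mu> x)) x = (case j of (w, \<mu>) \<Rightarrow> \<lambda>x. monomial_fun (act_expo w \<mu> x)) x" for i j
    proof (cases i; cases j)
      fix w \<mu> w' \<mu>' assume ij: "i = (w, \<mu>)" "j = (w', \<mu>')"
      have "w \<in> weyl \<Delta>" "\<mu> \<in> coweight_lattice \<Delta>" "w' \<in> weyl \<Delta>" "\<mu>' \<in> coweight_lattice \<Delta>"
        using that(1,2) assms(1) ij by auto
      moreover have "act_expo w \<mu> x = act_expo w' \<mu>' x" for x using that(3)[of x] by (simp add: ij monomial_fun_inj)
      ultimately have "w = w' \<and> \<mu> = \<mu>'" by (rule act_expo_inj)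
      then show "i = j" using ij by simp
    qed
    show "(\<Sum>i\<in>I. (case i of (w, \<mu>) \<Rightarrow> a w \<mu>) * (case i of (w, \<mu>) \<Rightarrow> \<lambda>x. monomial_fun (act_expo w \<mu> x)) x) = 0" for x
      using z[of x] e by (simp add: case_prod_beta cong: sum.cong)
  qed (use assms in auto)
  then show ?thesis by simp
qed

end

section \<open>The module of functions\<close>

context root_functions
begin

abbreviation "M \<equiv> fun_module \<Delta> \<alpha>"
abbreviation "W \<equiv> weyl_poly \<Delta> \<alpha>"

lemma torus_field_scalar: "a \<in> torus_field \<Longrightarrow> a \<in> laurent_in_t torus_field"
  using laurent_term[of a torus_field 0] by simp

lemma tvar_laurent: "tvar \<in> laurent_in_t torus_field" "inverse tvar \<in> laurent_in_t torus_field"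
  using laurent_term[of 1 torus_field 1] laurent_term[of 1 torus_field "-1"] subringD(2)[OF torus_field_subring]
  by (simp_all add: power_int_minus)

lemma len_id: "len id = 0"
  using len_le[of "[]"] by simp

text \<open>
  The constant term of \<open>W(t)\<close> counts the elements of length zero, of which the identity is one.
\<close>
lemma weyl_poly_nz: "W \<noteq> 0"
proof
  assume "W = 0"
  let ?p = "\<Sum>w\<in>weyl \<Delta>. Poly_Mapping.single (Poly_Mapping.single None (int (2 * len w))) (1::complex) :: 'n laurent"
  have t: "tvar ^ n = monomial_fun (Poly_Mapping.single None (int n))" for n
    by (induction n) (simp_all add: monomial_fun_0 tvar_monomial_fun monomial_fun_add[symmetric] single_add[symmetric])
  have sz: "Poly_Mapping.single None k = 0 \<longleftrightarrow> k = 0" for k :: int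
    by (metis lookup_single_eq lookup_zero single_zero)
  have "W = of_laurent ?p" unfolding weyl_poly_def t of_laurent_sum monomial_fun_def by simp
  then have "?p = 0" using \<open>W = 0\<close> of_laurent_inj[of ?p 0] by (simp add: of_laurent_0)
  then have "Poly_Mapping.lookup ?p 0 = 0" by simp
  moreover have "Poly_Mapping.lookup ?p 0 = of_nat (card {w\<in>weyl \<Delta>. len w = 0})"
  proof -
    have "Poly_Mapping.lookup ?p 0 = (\<Sum>w\<in>weyl \<Delta>. if len w = 0 then 1 else 0)"
      unfolding lookup_sum by (rule sum.cong) (auto simp: lookup_single when_def sz)
    then show ?thesis by (simp add: sum.If_cases[OF finite_weyl] Int_def)
  qed
  moreover have "{w\<in>weyl \<Delta>. len w = 0} \<noteq> {}" using len_id weyl_id by blast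
  ultimately show False using finite_weyl by simp
qed

lemma laurent_torus_subring: "subring (laurent_in_t torus_field)"
  by (rule laurent_in_t_subring[OF torus_field_subring])

lemma weyl_poly_laurent: "W \<in> laurent_in_t torus_field"
  unfolding weyl_poly_def by (intro subring_sum subring_power laurent_torus_subring tvar_laurent)

lemma laurent_M: "a \<in> laurent_in_t torus_field \<Longrightarrow> a \<in> M"
  unfolding fun_module_def invert_weyl_poly_def by (intro CollectI exI[of _ a] exI[of _ 0]) simp

lemma inverse_weyl_poly_M: "1 / W \<in> M"
  unfolding fun_module_def invert_weyl_poly_def
  by (intro CollectI exI[of _ 1] exI[of _ 1]) (simp add: subringD(2)[OF laurent_torus_subring])

lemma M_subring: "subring M"
proof -
  note D = subringD[OF laurent_torus_subring]
  have "f + g \<in> M \<and> f * g \<in> M" if fg: "f \<in> M" "g \<in> M" for f g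
  proof -
    obtain a n where f: "f = a / W ^ n" "a \<in> laurent_in_t torus_field"
      using fg(1) unfolding fun_module_def invert_weyl_poly_def by blast
    obtain b m where g: "g = b / W ^ m" "b \<in> laurent_in_t torus_field"
      using fg(2) unfolding fun_module_def invert_weyl_poly_def by blast
    have "f + g = (a * W ^ m + b * W ^ n) / W ^ (n + m)" "f * g = (a * b) / W ^ (n + m)"
      using weyl_poly_nz by (simp_all add: f(1) g(1) power_add field_simps)
    moreover have "a * W ^ m + b * W ^ n \<in> laurent_in_t torus_field" "a * b \<in> laurent_in_t torus_field"
      using f(2) g(2) weyl_poly_laurent by (intro D subring_power laurent_torus_subring; simp)+
    ultimately show ?thesis unfolding fun_module_def invert_weyl_poly_def by blast
  qed
  moreover have "- f \<in> M" if fM: "f \<in> M" for f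
  proof -
    obtain a n where f: "f = a / W ^ n" "a \<in> laurent_in_t torus_field"
      using fM unfolding fun_module_def invert_weyl_poly_def by blast
    have "- f = (- a) / W ^ n" "- a \<in> laurent_in_t torus_field" using f D by simp_all
    then show ?thesis unfolding fun_module_def invert_weyl_poly_def by blast
  qed
  ultimately show ?thesis unfolding subring_def using laurent_M D(1,2) by blast
qed

lemmas M_closed = subringD[OF M_subring]

lemma tvar_M: "tvar \<in> M" "inverse tvar \<in> M"
  using tvar_laurent laurent_M by blast+

lemma torus_M: "a \<in> torus_field \<Longrightarrow> a \<in> M"
  using laurent_M torus_field_scalar by blast

lemma scalar_M: "a \<in> scalar_ring \<Longrightarrow> a \<in> laurent_in_t torus_field"
proof -
  have "const_fun c \<in> torus_field" for c :: complex
    by (rule torus_ring_field) (auto simp: const_fun_def torus_ring_def intro!: imageI)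
  then have r: "range const_fun \<subseteq> torus_field" by blast
  show "a \<in> scalar_ring \<Longrightarrow> a \<in> laurent_in_t torus_field"
    unfolding scalar_ring_def laurent_in_t_def using r by blast
qed

lemma algebra_scalars_M:
  assumes "A \<in> {scalar_ring, invert_weyl_poly \<Delta> \<alpha> scalar_ring}" "a \<in> A" shows "a \<in> M"
proof -
  have "a \<in> invert_weyl_poly \<Delta> \<alpha> scalar_ring \<Longrightarrow> a \<in> M"
    unfolding fun_module_def invert_weyl_poly_def using scalar_M by blast
  then show ?thesis using assms scalar_M laurent_M by blast
qed

lemma monomial_fun_split: "monomial_fun (x :: 'n expo) = monomial_fun (x - Poly_Mapping.single None (Poly_Mapping.lookup x None)) * tvar powi (Poly_Mapping.lookup x None)"
proof -
  have t: "(tvar :: 'n ratfun) ^ n = monomial_fun (Poly_Mapping.single None (int n))" for n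
    by (induction n) (simp_all add: monomial_fun_0 tvar_monomial_fun monomial_fun_add[symmetric] single_add[symmetric])
  have "(tvar :: 'n ratfun) powi k = monomial_fun (Poly_Mapping.single None k)" for k
  proof (cases "0 \<le> k")
    case True then show ?thesis by (simp add: power_int_def t)
  next
    case False then show ?thesis by (simp add: power_int_def t power_inverse monomial_fun_uminus[symmetric] single_uminus[symmetric])
  qed
  then show ?thesis by (simp add: monomial_fun_add[symmetric])
qed

lemma monomial_fun_M: "monomial_fun x \<in> M"
  by (subst monomial_fun_split, rule laurent_M, rule laurent_term, rule torus_ring_field, rule monomial_fun_torus)
     (simp add: lookup_minus lookup_single)

lemma subst_torus_ring:
  assumes g: "expo_embedding g" and n: "\<And>x. Poly_Mapping.lookup (g x) None = Poly_Mapping.lookup x None"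
    and a: "a \<in> torus_ring"
  shows "monomial_subst g a \<in> torus_ring"
proof -
  obtain p where p: "a = of_laurent p" "\<forall>x\<in>Poly_Mapping.keys p. Poly_Mapping.lookup x None = 0"
    using a unfolding torus_ring_def by blast
  have "push_expo g p = (\<Sum>x\<in>Poly_Mapping.keys p. Poly_Mapping.single (g x) (Poly_Mapping.lookup p x))"
    by (simp add: push_expo_def)
  then have "monomial_subst g a = (\<Sum>x\<in>Poly_Mapping.keys p. of_laurent (Poly_Mapping.single (g x) (Poly_Mapping.lookup p x)))"
    using p(1) subst_of_laurent[OF g] of_laurent_sum by metis
  also have "\<dots> \<in> torus_ring"
  proof (rule subring_sum[OF torus_ring_subring])
    fix x assume "x \<in> Poly_Mapping.keys p"
    then have "Poly_Mapping.lookup (g x) None = 0" using n p(2) by simp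
    then show "of_laurent (Poly_Mapping.single (g x) (Poly_Mapping.lookup p x)) \<in> torus_ring"
      by (auto simp: torus_ring_def intro!: imageI)
  qed
  finally show ?thesis .
qed

text \<open>
  Fixing \<open>t\<close> is what is needed besides preservation of the torus ring: then \<open>W(t)\<close> is fixed and the
  powers of \<open>t\<close> are left alone.
\<close>
lemma subst_M:
  assumes g: "expo_embedding g" and n: "\<And>x. Poly_Mapping.lookup (g x) None = Poly_Mapping.lookup x None"
    and t: "monomial_subst g tvar = tvar" and f: "f \<in> M"
  shows "monomial_subst g f \<in> M"
proof -
  have tf: "monomial_subst g a \<in> torus_field" if a: "a \<in> torus_field" for a
  proof -
    obtain b c where "a = b / c" "b \<in> torus_ring" "c \<in> torus_ring" "c \<noteq> 0" using a unfolding torus_field_def by blast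
    then show ?thesis using subst_torus_ring[OF g n] subst_eq_0_iff[OF g]
      unfolding torus_field_def by (intro CollectI exI[of _ "monomial_subst g b"] exI[of _ "monomial_subst g c"])
        (simp add: subst_divide[OF g])
  qed
  obtain a k where f: "f = a / W ^ k" "a \<in> laurent_in_t torus_field"
    using f unfolding fun_module_def invert_weyl_poly_def by blast
  obtain S c where a: "a = (\<Sum>k\<in>S. c k * tvar powi k)" "finite S" "\<forall>k\<in>S. c k \<in> torus_field"
    using f(2) by (auto simp: laurent_in_t_def)
  have "monomial_subst g W = W"
    unfolding weyl_poly_def by (simp add: subst_sum[OF g] subst_power[OF g] t)
  then have "monomial_subst g f = (\<Sum>k\<in>S. monomial_subst g (c k) * tvar powi k) / W ^ k"
    unfolding f(1) a(1) by (simp add: subst_divide[OF g] subst_sum[OF g] subst_mult[OF g] subst_power[OF g] subst_powi[OF g] t)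
  moreover have "(\<Sum>k\<in>S. monomial_subst g (c k) * tvar powi k) \<in> laurent_in_t torus_field"
    unfolding laurent_in_t_def using a tf by (intro CollectI exI[of _ S] exI[of _ "\<lambda>k. monomial_subst g (c k)"]) auto
  ultimately show ?thesis unfolding fun_module_def invert_weyl_poly_def by blast
qed

context
  fixes w \<mu> assumes w: "w \<in> weyl \<Delta>" and \<mu>: "\<mu> \<in> coweight_lattice \<Delta>"
begin

lemmas act_simps = act_subst[OF w \<mu>]
lemmas act_mono = expo_embedding_act[OF w \<mu>]

lemma act_tvar: "act w \<mu> tvar = tvar"
proof -
  have "expo_vec \<alpha> (Poly_Mapping.single None 1) = 0" by (rule cf_eqI) (simp add: cf_expo_vec lookup_single cf_0)
  then have "act_expo w \<mu> (Poly_Mapping.single None 1) = Poly_Mapping.single None 1"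
    by (intro expo_eqI) (simp_all add: act_expo[OF w] lookup_single linear_0[OF weyl_linear[OF w]])
  then show ?thesis by (simp add: act_simps tvar_monomial_fun subst_monomial_fun act_mono)
qed

lemma act_add: "act w \<mu> (f + g) = act w \<mu> f + act w \<mu> g" and act_mult: "act w \<mu> (f * g) = act w \<mu> f * act w \<mu> g"
  and act_diff: "act w \<mu> (f - g) = act w \<mu> f - act w \<mu> g" and act_0: "act w \<mu> 0 = 0" and act_1: "act w \<mu> 1 = 1"
  and act_divide: "act w \<mu> (f / g) = act w \<mu> f / act w \<mu> g" and act_eq_0_iff: "act w \<mu> f = 0 \<longleftrightarrow> f = 0"
  and act_inverse: "act w \<mu> (inverse f) = inverse (act w \<mu> f)" and act_power: "act w \<mu> (f ^ n) = act w \<mu> f ^ n"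
  and act_sum: "act w \<mu> (\<Sum>x\<in>S. h x) = (\<Sum>x\<in>S. act w \<mu> (h x))"
  by (simp_all add: act_simps subst_add subst_mult subst_diff subst_0 subst_1 subst_divide subst_eq_0_iff subst_inverse subst_power subst_sum act_mono)

lemma act_W: "act w \<mu> W = W"
  unfolding weyl_poly_def by (simp add: act_sum act_power act_tvar)

lemma act_M: "f \<in> M \<Longrightarrow> act w \<mu> f \<in> M"
  using subst_M[OF act_mono act_expo(2)[OF w]] act_tvar by (simp add: act_simps)

end

lemma weyl_op_efun:
  assumes "w \<in> weyl \<Delta>" "v \<in> lattice" shows "weyl_op \<alpha> w (efun \<alpha> v) = efun \<alpha> (w v)"
proof -
  have "weyl_expo w (expo_of \<alpha> v) = expo_of \<alpha> (w v)"
    by (rule expo_eqI) (simp_all add: lookup_weyl_expo expo_vec_weyl_expo[OF assms(1)] lookup_expo_of expo_vec_expo_of assms weyl_lattice)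
  then show ?thesis by (simp add: weyl_op_subst efun_monomial_fun subst_monomial_fun expo_embedding_weyl assms)
qed

lemma lattice_add: "u \<in> lattice \<Longrightarrow> v \<in> lattice \<Longrightarrow> u + v \<in> lattice"
  and lattice_uminus: "u \<in> lattice \<Longrightarrow> - u \<in> lattice"
  by (auto simp: lattice_def cf_add cf_uminus)

lemma efun_add: "u \<in> lattice \<Longrightarrow> v \<in> lattice \<Longrightarrow> efun \<alpha> (u + v) = efun \<alpha> u * efun \<alpha> v"
  unfolding efun_monomial_fun monomial_fun_add[symmetric]
  by (rule arg_cong[of _ _ monomial_fun], rule expo_eqI) (simp_all add: lookup_expo_of lookup_add expo_vec_add expo_vec_expo_of lattice_add)

lemma efun_0: "efun \<alpha> 0 = 1"
proof -
  have "expo_of \<alpha> 0 = 0" by (rule expo_eqI) (auto simp: lookup_expo_of expo_vec_expo_of lattice_def cf_0 expo_vec_def)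
  then show ?thesis by (simp add: efun_monomial_fun monomial_fun_0)
qed

lemma efun_uminus: "v \<in> lattice \<Longrightarrow> efun \<alpha> (- v) = inverse (efun \<alpha> v)"
  using efun_add[of v "- v"] efun_0 lattice_uminus[of v] by (intro inverse_unique[symmetric]) simp

lemma efun_eq_1: "v \<in> lattice \<Longrightarrow> efun \<alpha> v = 1 \<longleftrightarrow> v = 0"
proof
  assume v: "v \<in> lattice" "efun \<alpha> v = 1"
  then have "expo_of \<alpha> v = 0" unfolding efun_monomial_fun using monomial_fun_inj[of "expo_of \<alpha> v" 0] monomial_fun_0 by metis
  then have "expo_vec \<alpha> (expo_of \<alpha> v) = 0" by (simp add: expo_vec_def)
  then show "v = 0" using v by (simp add: expo_vec_expo_of)
qed (simp add: efun_0)

lemma efun_nz: "efun \<alpha> v \<noteq> 0"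
  by (simp add: efun_monomial_fun monomial_fun_nz)

lemma efun_torus: "efun \<alpha> v \<in> torus_ring"
  unfolding efun_monomial_fun by (rule monomial_fun_torus) (simp add: lookup_expo_of)

lemma qvar_torus_field: "qvar powi k \<in> torus_field"
proof -
  have "qvar \<in> torus_ring" unfolding qvar_monomial_fun by (rule monomial_fun_torus) (simp add: lookup_single)
  then have "qvar \<in> torus_field" by (rule torus_ring_field)
  then show ?thesis unfolding power_int_def
    by (auto intro!: subring_power torus_field_subring torus_field_inverse)
qed

lemma efun_affine_torus_field: "efun_affine \<alpha> a \<in> torus_field"
  by (cases a) (simp add: efun_affine_def subringD[OF torus_field_subring] qvar_torus_field torus_ring_field efun_torus)

end

section \<open>Demazure--Lusztig operators and the symmetrizer\<close>

text \<open>
  With \<open>z = e\<^bsup>2\<xi>\<^esup>\<close> the function \<open>m(z)\<close> is \<open>((t\<^sup>-\<^sup>1 - t) coth \<xi> + t\<^sup>-\<^sup>1 + t) / 2\<close>; this is the addition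
  theorem of the hyperbolic cotangent.
\<close>
lemma coth_add:
  fixes x y t :: "'a::field"
  defines "hcoth \<equiv> \<lambda>z. (z * inverse t - t) / (z - 1)"
  assumes nz: "t \<noteq> 0" and n1: "x \<noteq> 1" "y \<noteq> 1" "x*y \<noteq> 1"
  shows "hcoth (x*y) * (t + inverse t - hcoth x - hcoth y) = 1 - hcoth x * hcoth y"
proof -
  have nz': "x - 1 \<noteq> 0" "y - 1 \<noteq> 0" "x*y - 1 \<noteq> 0" using n1 by auto
  show ?thesis using nz nz' n1
    by (simp add: hcoth_def, simp add: divide_simps, algebra)
qed

lemma coth_complement:
  fixes t k z :: "'a::field"
  assumes "z \<noteq> 1"
  shows "t + k - (z * k - t) / (z - 1) = (t * z - k) / (z - 1)"
proof -
  have "t + k = ((t + k) * (z - 1)) / (z - 1)" using assms by simp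
  also have "\<dots> - (z * k - t) / (z - 1) = (t * z - k) / (z - 1)"
    unfolding diff_divide_distrib[symmetric] by (simp add: algebra_simps)
  finally show ?thesis .
qed

lemma coth_minus:
  fixes t k z :: "'a::field"
  assumes "z \<noteq> 0" "z \<noteq> 1"
  shows "(inverse z * k - t) / (inverse z - 1) = t + k - (z * k - t) / (z - 1)"
proof -
  have e: "inverse z * k - t = (k - t * z) * inverse z" "inverse z - 1 = (1 - z) * inverse z"
    using assms by (simp_all add: left_diff_distrib)
  have "(inverse z * k - t) / (inverse z - 1) = (k - t * z) / (1 - z)"
    unfolding e using assms by simp
  also have "\<dots> = (t * z - k) / (z - 1)"
    by (metis minus_diff_eq minus_divide_divide)
  finally show ?thesis using coth_complement[OF assms(2)] by simp
qed

lemma demazure_lusztig_split: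
  fixes t k z :: "'a::field"
  assumes "z \<noteq> 1"
  shows "t * g + (t - k) / (z - 1) * (g - f) = (z * k - t) / (z - 1) * f + (t + k - (z * k - t) / (z - 1)) * g - k * f"
proof -
  have "z - 1 \<noteq> 0" using assms by auto
  then show ?thesis by (simp add: divide_simps, (simp add: algebra_simps)?)
qed

context root_functions
begin

abbreviation s :: "'n \<Rightarrow> 'n ratfun \<Rightarrow> 'n ratfun" where "s i \<equiv> weyl_op \<alpha> (reflect (\<alpha> i))"

lemma tnz: "(tvar :: 'n ratfun) \<noteq> 0"
  by (rule tvar_nz)

lemma simple_reflect_weyl: "reflect (\<alpha> i) \<in> weyl \<Delta>"
  by (simp add: reflect_weyl simple_root)

lemma s_hom: "s i (f + g) = s i f + s i g" "s i (f * g) = s i f * s i g" "s i (f - g) = s i f - s i g"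
  "s i (f / g) = s i f / s i g" "s i (inverse f) = inverse (s i f)" "s i tvar = tvar" "s i 1 = 1" "s i (s i f) = f"
  using act_add[OF simple_reflect_weyl zero_coweight] act_mult[OF simple_reflect_weyl zero_coweight]
    act_diff[OF simple_reflect_weyl zero_coweight] act_divide[OF simple_reflect_weyl zero_coweight]
    act_inverse[OF simple_reflect_weyl zero_coweight] act_tvar[OF simple_reflect_weyl zero_coweight]
    act_1[OF simple_reflect_weyl zero_coweight]
  by (simp_all add: shift_0 weyl_op_comp simple_reflect_weyl reflect_comp_reflect weyl_id_op)

lemma s_M: "f \<in> M \<Longrightarrow> s i f \<in> M"
  using act_M[OF simple_reflect_weyl zero_coweight] by (simp add: shift_0)

definition T :: "'n \<Rightarrow> 'n ratfun \<Rightarrow> 'n ratfun" where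
  "T i f = tvar * s i f + (tvar - inverse tvar) / (efun \<alpha> (\<alpha> i) - 1) * (s i f - f)"

text \<open>
  The coefficient of the identity in \<open>T\<^sub>i + t\<^sup>-\<^sup>1\<close> when \<open>\<beta> = \<alpha>\<^sub>i\<close>; that of \<open>s\<^sub>i\<close> is its complement to \<open>t + t\<^sup>-\<^sup>1\<close>.
\<close>
definition hcoth :: "'v \<Rightarrow> 'n ratfun" where
  "hcoth \<beta> = (efun \<alpha> \<beta> * inverse tvar - tvar) / (efun \<alpha> \<beta> - 1)"

abbreviation t_sum :: "'n ratfun" where "t_sum \<equiv> tvar + inverse tvar"

lemma root_efun: "\<beta> \<in> \<Delta> \<Longrightarrow> efun \<alpha> \<beta> \<noteq> 1"
  using efun_eq_1 root_lattice zero_not_root by metis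

lemma hcoth_uminus:
  assumes "\<beta> \<in> \<Delta>" shows "hcoth (- \<beta>) = t_sum - hcoth \<beta>"
  using coth_minus[OF efun_nz root_efun[OF assms], of "inverse tvar" tvar]
  by (simp only: hcoth_def efun_uminus[OF root_lattice[OF assms]])

lemma hcoth_add:
  assumes "\<beta> \<in> \<Delta>" "\<gamma> \<in> \<Delta>" "\<beta> + \<gamma> \<in> \<Delta>"
  shows "hcoth (\<beta> + \<gamma>) * (t_sum - hcoth \<beta> - hcoth \<gamma>) = 1 - hcoth \<beta> * hcoth \<gamma>"
  using coth_add[OF tnz, of "efun \<alpha> \<beta>" "efun \<alpha> \<gamma>"] root_efun[OF assms(1)] root_efun[OF assms(2)] root_efun[OF assms(3)]
  by (simp add: hcoth_def efun_add root_lattice assms)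

lemma s_hcoth: "\<beta> \<in> \<Delta> \<Longrightarrow> s i (hcoth \<beta>) = hcoth (reflect (\<alpha> i) \<beta>)"
  by (simp add: hcoth_def s_hom weyl_op_efun simple_reflect_weyl root_lattice)

lemma weyl_word_op: "foldr s is f = weyl_op \<alpha> (word_prod \<alpha> is) f"
proof (induction "is")
  case Nil show ?case by (subst word_prod_Nil, subst weyl_id_op) simp
next
  case (Cons i "is")
  have "foldr s (i # is) f = s i (foldr s is f)" by simp
  then show ?case by (simp only: Cons word_prod_Cons weyl_op_comp[OF simple_reflect_weyl word_weyl])
qed

lemma hecke_pair_s: "hecke_pair (s i) (s j) t_sum (hcoth (\<alpha> i)) (hcoth (\<alpha> j))"
  by unfold_locales (simp_all add: s_hom s_hcoth simple_root reflect_self simple_nz hcoth_uminus)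

lemma T_eq_E: "T i f = hcoth (\<alpha> i) * f + (t_sum - hcoth (\<alpha> i)) * s i f - inverse tvar * f"
  unfolding T_def hcoth_def by (rule demazure_lusztig_split[OF root_efun[OF simple_root]])

text \<open>
  The orthogonal case and those where \<open>\<alpha>\<^sub>i\<close> is at least as long as \<open>\<alpha>\<^sub>j\<close>. In the remaining ones the roles of \<open>i\<close> and \<open>j\<close>
  are exchanged, which only swaps the two sides.
\<close>
lemma braid_half:
  assumes ij: "i \<noteq> j" and c: "(cartan i j, cartan j i) \<in> {(0,0), (1,1), (1,2), (1,3)}"
  shows "foldr T (alt_word i j (coxeter i j)) f = foldr T (alt_word j i (coxeter i j)) f"
proof -
  interpret P: hecke_pair "s i" "s j" t_sum "hcoth (\<alpha> i)" "hcoth (\<alpha> j)" by (rule hecke_pair_s)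
  let ?k = "inverse tvar"
  have TP: "T i f = P.T ?k f" "T j f = P.S ?k f" for f
    by (simp_all add: T_eq_E P.T_def P.S_def P.E_def P.D_def)
  have k: "s i ?k = ?k" "s j ?k = ?k" "t_sum * ?k = ?k * ?k + 1" using tnz by (simp_all add: s_hom distrib_right)
  have w: "foldr s (alt_word i j (coxeter i j)) f = foldr s (alt_word j i (coxeter i j)) f" for f
    by (simp add: weyl_word_op braid_weyl[OF ij])
  note r = reflect_simple[OF ij] reflect_simple[OF ij[symmetric]] reflect_self[OF simple_nz]
    linear_add[OF reflect_linear] linear_scale[OF reflect_linear]
  let ?a = "\<alpha> i" and ?b = "\<alpha> j"
  have R: "reflect ?a \<beta> \<in> \<Delta>" "reflect ?b \<beta> \<in> \<Delta>" if "\<beta> \<in> \<Delta>" for \<beta>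
    using reflect_root simple_root that by auto
  have aw: "alt_word p q 2 = [p,q]" "alt_word p q 3 = [p,q,p]" "alt_word p q 4 = [p,q,p,q]"
    "alt_word p q 6 = [p,q,p,q,p,q]" for p q :: 'n
    by (simp_all add: numeral_eq_Suc)
  consider "cartan i j = 0" "cartan j i = 0" | "cartan i j = 1" "cartan j i = 1"
    | "cartan i j = 1" "cartan j i = 2" | "cartan i j = 1" "cartan j i = 3" using c by auto
  then show ?thesis
  proof cases
    case 1
    then have cx: "coxeter i j = 2" by (simp add: coxeter_def dihedral_order_def)
    have "P.T ?k (P.S ?k f) = P.S ?k (P.T ?k f)"
      by (rule P.braid2) (use k w 1 cx r in \<open>simp_all add: s_hcoth simple_root aw\<close>)
    then show ?thesis by (simp add: cx aw TP)
  next
    case 2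
    then have cx: "coxeter i j = 3" by (simp add: coxeter_def dihedral_order_def)
    have e: "reflect ?a ?b = ?a + ?b" "reflect ?a (?a + ?b) = ?b" "reflect ?b ?a = ?a + ?b" "reflect ?b (?a + ?b) = ?a"
      using 2 by (simp_all add: r algebra_simps)
    have rt: "?a + ?b \<in> \<Delta>" using R simple_root e by metis
    have "P.T ?k (P.S ?k (P.T ?k f)) = P.S ?k (P.T ?k (P.S ?k f))"
      by (rule P.braid3[of ?k "hcoth (?a + ?b)"])
        (use k(1,2,3) w hcoth_add[OF simple_root simple_root rt] in \<open>simp_all add: s_hcoth simple_root rt e cx aw\<close>)
    then show ?thesis by (simp add: cx aw TP)
  next
    case 3
    then have cx: "coxeter i j = 4" by (simp add: coxeter_def dihedral_order_def)
    let ?d = "?a + 2 *\<^sub>R ?b"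
    have e: "reflect ?a ?b = ?a + ?b" "reflect ?a (?a + ?b) = ?b" "reflect ?a ?d = ?d"
      "reflect ?b ?a = ?d" "reflect ?b ?d = ?a" "reflect ?b (?a + ?b) = ?a + ?b"
      using 3 by (rule_tac [!] cf_eqI) (simp_all add: r cf_add cf_diff cf_scale cf_uminus algebra_simps)
    have rt: "?a + ?b \<in> \<Delta>" "?d \<in> \<Delta>" using R simple_root e by metis+
    have d: "?d = (?a + ?b) + ?b" by (simp add: scaleR_2)
    have "hcoth ?d * (t_sum - hcoth (?a + ?b) - hcoth ?b) = 1 - hcoth (?a + ?b) * hcoth ?b"
      using hcoth_add[OF rt(1) simple_root] rt(2) unfolding d by blast
    then have "P.T ?k (P.S ?k (P.T ?k (P.S ?k f))) = P.S ?k (P.T ?k (P.S ?k (P.T ?k f)))"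
      by (intro P.braid4[of ?k "hcoth (?a + ?b)" "hcoth ?d"])
        (use k(1,2,3) w hcoth_add[OF simple_root simple_root rt(1)] in \<open>simp_all add: s_hcoth simple_root rt e cx aw\<close>)
    then show ?thesis by (simp add: cx aw TP)
  next
    case 4
    then have cx: "coxeter i j = 6" by (simp add: coxeter_def dihedral_order_def)
    let ?d = "?a + 2 *\<^sub>R ?b" and ?e = "?a + 3 *\<^sub>R ?b" and ?c = "2 *\<^sub>R ?a + 3 *\<^sub>R ?b"
    have e: "reflect ?a ?b = ?a + ?b" "reflect ?a (?a + ?b) = ?b" "reflect ?a ?e = ?c" "reflect ?a ?c = ?e" "reflect ?a ?d = ?d"
      "reflect ?b ?a = ?e" "reflect ?b ?e = ?a" "reflect ?b (?a + ?b) = ?d" "reflect ?b ?d = ?a + ?b" "reflect ?b ?c = ?c"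
      using 4 by (rule_tac [!] cf_eqI) (simp_all add: r cf_add cf_diff cf_scale cf_uminus algebra_simps)
    have rt: "?a + ?b \<in> \<Delta>" "?d \<in> \<Delta>" "?e \<in> \<Delta>" "?c \<in> \<Delta>" using R simple_root e by metis+
    have sm: "?d = (?a + ?b) + ?b" "?e = ?d + ?b" "?c = ?a + ?e" "?c = (?a + ?b) + ?d"
      by (rule_tac [!] cf_eqI) (simp_all add: cf_add cf_scale)
    have id: "hcoth ?d * (t_sum - hcoth (?a + ?b) - hcoth ?b) = 1 - hcoth (?a + ?b) * hcoth ?b"
       "hcoth ?e * (t_sum - hcoth ?d - hcoth ?b) = 1 - hcoth ?d * hcoth ?b"
       "hcoth ?c * (t_sum - hcoth ?a - hcoth ?e) = 1 - hcoth ?a * hcoth ?e" "hcoth ?c * (t_sum - hcoth (?a + ?b) - hcoth ?d) = 1 - hcoth (?a + ?b) * hcoth ?d"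
      using hcoth_add[of "?a + ?b" ?b] hcoth_add[of ?d ?b] hcoth_add[of ?a ?e] hcoth_add[of "?a + ?b" ?d] rt simple_root
      unfolding sm[symmetric] by blast+
    have "P.T ?k (P.S ?k (P.T ?k (P.S ?k (P.T ?k (P.S ?k f))))) = P.S ?k (P.T ?k (P.S ?k (P.T ?k (P.S ?k (P.T ?k f)))))"
      by (rule P.braid6[of ?k "hcoth (?a + ?b)" "hcoth ?e" "hcoth ?c" "hcoth ?d"])
        (use k(1,2,3) w hcoth_add[OF simple_root simple_root rt(1)] id in \<open>simp_all add: s_hcoth simple_root rt e cx aw\<close>)
    then show ?thesis by (simp add: cx aw TP)
  qed
qed

lemma braid_T:
  assumes ij: "i \<noteq> j"
  shows "foldr T (alt_word i j (coxeter i j)) f = foldr T (alt_word j i (coxeter i j)) f"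
proof (cases "(cartan i j, cartan j i) \<in> {(0,0), (1,1), (1,2), (1,3)}")
  case True then show ?thesis by (rule braid_half[OF ij])
next
  case False
  then have "(cartan j i, cartan i j) \<in> {(0,0), (1,1), (1,2), (1,3)}" using cartan_cases[OF ij] by auto
  from braid_half[OF ij[symmetric] this, symmetric] show ?thesis by (simp only: coxeter_commute[of j i])
qed

text \<open>
  The element \<open>T\<^sub>w\<close>, acting on the whole field, where no membership in the module has to be checked.
\<close>
definition Tw :: "('v \<Rightarrow> 'v) \<Rightarrow> 'n ratfun \<Rightarrow> 'n ratfun" where
  "Tw w = foldr T (SOME is. word_prod \<alpha> is = w \<and> length is = len w)"

lemma T_word_Tw:
  assumes "length is = len (word_prod \<alpha> is)" shows "foldr T is f = Tw (word_prod \<alpha> is) f"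
proof -
  let ?js = "SOME js. word_prod \<alpha> js = word_prod \<alpha> is \<and> length js = len (word_prod \<alpha> is)"
  have "word_prod \<alpha> ?js = word_prod \<alpha> is \<and> length ?js = len (word_prod \<alpha> is)"
    by (rule someI[of "\<lambda>js. word_prod \<alpha> js = word_prod \<alpha> is \<and> length js = len (word_prod \<alpha> is)" "is"]) (simp add: assms)
  then show ?thesis unfolding Tw_def by (intro matsumoto[OF braid_T assms]) simp_all
qed

lemma T_Tw:
  assumes w: "w \<in> weyl \<Delta>" and l: "len (reflect (\<alpha> i) \<circ> w) = Suc (len w)"
  shows "T i (Tw w f) = Tw (reflect (\<alpha> i) \<circ> w) f"
proof -
  obtain "is" where i: "word_prod \<alpha> is = w" "length is = len w" using len_word[OF w] by blast
  then show ?thesis using T_word_Tw[of "is" f] T_word_Tw[of "i # is" f] l by simp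
qed

lemma Tw_T:
  assumes w: "w \<in> weyl \<Delta>" and l: "len (w \<circ> reflect (\<alpha> i)) = Suc (len w)"
  shows "Tw w (T i f) = Tw (w \<circ> reflect (\<alpha> i)) f"
proof -
  obtain "is" where i: "word_prod \<alpha> is = w" "length is = len w" using len_word[OF w] by blast
  have e: "word_prod \<alpha> (is @ [i]) = w \<circ> reflect (\<alpha> i)" using i(1) by (simp add: word_prod_append)
  show ?thesis using T_word_Tw[of "is" "T i f"] T_word_Tw[of "is @ [i]" f] l i unfolding e by simp
qed

lemma T_quadratic: "T i (T i f) = (tvar - inverse tvar) * T i f + f"
proof -
  interpret P: hecke_pair "s i" "s i" t_sum "hcoth (\<alpha> i)" "hcoth (\<alpha> i)" by (rule hecke_pair_s)
  have e: "T i f = P.E f - inverse tvar * f" for f by (simp add: T_eq_E P.E_def)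
  have "P.E (inverse tvar * f) = inverse tvar * P.E f" for f by (rule P.E_linear) (simp add: s_hom)
  then show ?thesis using tnz unfolding e by (simp add: P.E_linear P.E_E algebra_simps)
qed

lemma T_add: "T i (f + g) = T i f + T i g"
  by (simp add: T_eq_E s_hom algebra_simps)
lemma T_scale: "s i a = a \<Longrightarrow> T i (a * f) = a * T i f"
  by (simp add: T_eq_E s_hom algebra_simps)
lemma T_0: "T i 0 = 0"
  using act_0[OF simple_reflect_weyl zero_coweight] by (simp add: T_eq_E shift_0)
lemma T_sum: "T i (\<Sum>x\<in>S. g x) = (\<Sum>x\<in>S. T i (g x))"
  by (induction S rule: infinite_finite_induct) (simp_all add: T_0 T_add)
lemma s_tvar_power: "s i (tvar ^ n) = tvar ^ n"
  by (induction n) (simp_all add: s_hom)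
lemma s_W: "s i W = W"
  using act_W[OF simple_reflect_weyl zero_coweight] by (simp add: shift_0)

lemma foldr_T_add: "foldr T is (f + g) = foldr T is f + foldr T is g"
  by (induction "is") (simp_all add: T_add)
lemma Tw_add: "Tw w (f + g) = Tw w f + Tw w g"
  unfolding Tw_def by (rule foldr_T_add)
lemma foldr_T_scale: "(\<And>i. s i a = a) \<Longrightarrow> foldr T is (a * f) = a * foldr T is f"
  by (induction "is") (simp_all add: T_scale)
lemma Tw_scale: "(\<And>i. s i a = a) \<Longrightarrow> Tw w (a * f) = a * Tw w f"
  unfolding Tw_def by (rule foldr_T_scale)

definition Sym :: "'n ratfun \<Rightarrow> 'n ratfun" where
  "Sym f = (\<Sum>w\<in>weyl \<Delta>. tvar ^ len w * Tw w f)"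

text \<open>
  For \<open>Y w = T\<^sub>i X w\<close> the hypothesis on \<open>Y\<close> combines the two cases of multiplication by \<open>T\<^sub>i\<close>: the length
  goes up, or it goes down and the quadratic relation adds a term. After reindexing the first sum,
  the coefficient of \<open>X w\<close> is \<open>t\<^bsup>l(w)+1\<^esup>\<close>, or \<open>t\<^bsup>l(w)-1\<^esup> + (t - t\<^sup>-\<^sup>1) t\<^bsup>l(w)\<^esup>\<close>, which is the same.
\<close>
lemma hecke_sum:
  fixes \<phi> :: "('v \<Rightarrow> 'v) \<Rightarrow> ('v \<Rightarrow> 'v)" and X :: "('v \<Rightarrow> 'v) \<Rightarrow> 'n ratfun"
  assumes b: "bij_betw \<phi> (weyl \<Delta>) (weyl \<Delta>)" and inv: "\<And>w. w \<in> weyl \<Delta> \<Longrightarrow> \<phi> (\<phi> w) = w"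
    and l: "\<And>w. w \<in> weyl \<Delta> \<Longrightarrow> len (\<phi> w) = Suc (len w) \<or> len w = Suc (len (\<phi> w))"
    and Y: "\<And>w. w \<in> weyl \<Delta> \<Longrightarrow> Y w = X (\<phi> w) + (if len w = Suc (len (\<phi> w)) then (tvar - inverse tvar) * X w else 0)"
  shows "(\<Sum>w\<in>weyl \<Delta>. tvar ^ len w * Y w) = tvar * (\<Sum>w\<in>weyl \<Delta>. tvar ^ len w * X w)"
proof -
  have "(\<Sum>w\<in>weyl \<Delta>. tvar ^ len w * Y w) = (\<Sum>w\<in>weyl \<Delta>. tvar ^ len w * X (\<phi> w))
     + (\<Sum>w\<in>weyl \<Delta>. tvar ^ len w * (if len w = Suc (len (\<phi> w)) then (tvar - inverse tvar) * X w else 0))"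
    unfolding sum.distrib[symmetric] by (rule sum.cong) (simp_all add: Y algebra_simps)
  also have "(\<Sum>w\<in>weyl \<Delta>. tvar ^ len w * X (\<phi> w)) = (\<Sum>w\<in>weyl \<Delta>. tvar ^ len (\<phi> w) * X w)"
    using sum.reindex_bij_betw[OF b, of "\<lambda>w. tvar ^ len (\<phi> w) * X w"] inv by simp
  finally have "(\<Sum>w\<in>weyl \<Delta>. tvar ^ len w * Y w) = (\<Sum>w\<in>weyl \<Delta>. tvar ^ len (\<phi> w) * X w
     + tvar ^ len w * (if len w = Suc (len (\<phi> w)) then (tvar - inverse tvar) * X w else 0))"
    by (simp only: sum.distrib)
  also have "\<dots> = (\<Sum>w\<in>weyl \<Delta>. tvar * (tvar ^ len w * X w))"
  proof (rule sum.cong)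
    fix w assume w: "w \<in> weyl \<Delta>"
    show "tvar ^ len (\<phi> w) * X w + tvar ^ len w * (if len w = Suc (len (\<phi> w)) then (tvar - inverse tvar) * X w else 0)
      = tvar * (tvar ^ len w * X w)"
      using l[OF w] tnz by (auto simp: algebra_simps)
  qed simp
  finally show ?thesis by (simp add: sum_distrib_left)
qed

lemma T_Sym: "T i (Sym f) = tvar * Sym f"
proof -
  let ?\<phi> = "\<lambda>w. reflect (\<alpha> i) \<circ> w"
  have b: "bij_betw ?\<phi> (weyl \<Delta>) (weyl \<Delta>)"
    by (rule bij_betw_byWitness[of _ ?\<phi>]) (auto simp: reflect_cancel weyl_comp simple_reflect_weyl)
  have "T i (Sym f) = (\<Sum>w\<in>weyl \<Delta>. tvar ^ len w * T i (Tw w f))"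
    unfolding Sym_def T_sum by (simp add: T_scale s_tvar_power)
  also have "\<dots> = tvar * Sym f"
    unfolding Sym_def
  proof (rule hecke_sum[OF b])
    fix w assume w: "w \<in> weyl \<Delta>"
    show "?\<phi> (?\<phi> w) = w" by (rule reflect_cancel)
    show d: "len (?\<phi> w) = Suc (len w) \<or> len w = Suc (len (?\<phi> w))" using descent_cases[OF w] by blast
    show "T i (Tw w f) = Tw (?\<phi> w) f + (if len w = Suc (len (?\<phi> w)) then (tvar - inverse tvar) * Tw w f else 0)"
    proof (cases "len w = Suc (len (?\<phi> w))")
      case False then show ?thesis using T_Tw[OF w] d by auto
    next
      case True
      have "T i (Tw (?\<phi> w) f) = Tw w f"
        using T_Tw[OF weyl_comp[OF simple_reflect_weyl[of i] w], of i f] True by (simp only: reflect_cancel)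
      then have "T i (Tw w f) = (tvar - inverse tvar) * Tw w f + Tw (?\<phi> w) f" using T_quadratic[of i "Tw (?\<phi> w) f"] by simp
      then show ?thesis using True by simp
    qed
  qed
  finally show ?thesis .
qed

lemma Sym_T: "Sym (T i f) = tvar * Sym f"
proof -
  let ?\<phi> = "\<lambda>w. w \<circ> reflect (\<alpha> i)"
  have b: "bij_betw ?\<phi> (weyl \<Delta>) (weyl \<Delta>)"
    by (rule bij_betw_byWitness[of _ ?\<phi>]) (auto simp: reflect_cancel_right weyl_comp simple_reflect_weyl)
  show ?thesis
    unfolding Sym_def
  proof (rule hecke_sum[OF b])
    fix w assume w: "w \<in> weyl \<Delta>"
    show "?\<phi> (?\<phi> w) = w" by (rule reflect_cancel_right)
    show d: "len (?\<phi> w) = Suc (len w) \<or> len w = Suc (len (?\<phi> w))" by (rule len_right_cases[OF w])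
    show "Tw w (T i f) = Tw (?\<phi> w) f + (if len w = Suc (len (?\<phi> w)) then (tvar - inverse tvar) * Tw w f else 0)"
    proof (cases "len w = Suc (len (?\<phi> w))")
      case False then show ?thesis using Tw_T[OF w] d by auto
    next
      case True
      have u: "Tw (?\<phi> w) (T i g) = Tw w g" for g
        using Tw_T[OF weyl_comp[OF w simple_reflect_weyl[of i]], of i g] True by (simp only: reflect_cancel_right)
      have "Tw w (T i f) = Tw (?\<phi> w) ((tvar - inverse tvar) * T i f + f)" unfolding u[symmetric] T_quadratic ..
      also have "\<dots> = (tvar - inverse tvar) * Tw w f + Tw (?\<phi> w) f"
        unfolding Tw_add by (subst Tw_scale) (simp_all add: s_hom u)
      finally show ?thesis using True by simp
    qed
  qed
qed

lemma T_eq_tvar_iff: "T i f = tvar * f \<longleftrightarrow> s i f = f"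
proof -
  have x: "efun \<alpha> (\<alpha> i) - 1 \<noteq> 0" using root_efun[OF simple_root] by simp
  have ne: "tvar * efun \<alpha> (\<alpha> i) - inverse tvar \<noteq> 0"
  proof
    assume "tvar * efun \<alpha> (\<alpha> i) - inverse tvar = 0"
    then have "tvar * efun \<alpha> (\<alpha> i) * tvar = 1" using tnz by (simp add: field_simps)
    then have "monomial_fun (Poly_Mapping.single None 1 + expo_of \<alpha> (\<alpha> i) + Poly_Mapping.single None 1) = monomial_fun (0 :: 'n expo)"
      by (simp only: tvar_monomial_fun efun_monomial_fun monomial_fun_add monomial_fun_0)
    then have "Poly_Mapping.single None 1 + expo_of \<alpha> (\<alpha> i) + Poly_Mapping.single None 1 = (0 :: 'n expo)" by (simp only: monomial_fun_inj)
    from arg_cong[OF this, of "\<lambda>x. Poly_Mapping.lookup x None"] show False by (simp add: lookup_add lookup_expo_of)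
  qed
  have "T i f - tvar * f = (t_sum - hcoth (\<alpha> i)) * (s i f - f)"
    by (simp add: T_eq_E algebra_simps)
  also have "t_sum - hcoth (\<alpha> i) = (tvar * efun \<alpha> (\<alpha> i) - inverse tvar) / (efun \<alpha> (\<alpha> i) - 1)"
    unfolding hcoth_def by (rule coth_complement) (use x in simp)
  finally have "T i f - tvar * f = (tvar * efun \<alpha> (\<alpha> i) - inverse tvar) / (efun \<alpha> (\<alpha> i) - 1) * (s i f - f)" .
  then show ?thesis using x ne by auto
qed

end

section \<open>The spherical subalgebra\<close>

context root_functions
begin

lemma coeff_divide_M: "a \<in> torus_field \<Longrightarrow> (tvar - inverse tvar) / (a - 1) \<in> M"
  unfolding divide_inverse
  by (intro M_closed tvar_M torus_M torus_field_inverse subringD[OF torus_field_subring])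

lemma T_op_simple:
  assumes "f \<in> M" shows "T_op \<Delta> \<alpha> (\<alpha> i, 0) f = T i f"
  using assms by (simp add: T_op_def affine_reflect_op_def efun_affine_def T_def shift_0)

lemma affine_reflect_act: "affine_reflect_op \<alpha> (\<beta>, k) f = act (reflect \<beta>) (of_int k *\<^sub>R coroot \<beta>) f"
  by (simp add: affine_reflect_op_def)

lemma T_op_M:
  assumes "\<beta> \<in> \<Delta>" "f \<in> M" shows "T_op \<Delta> \<alpha> (\<beta>, k) f \<in> M" "T_op \<Delta> \<alpha> (\<beta>, k) 0 = 0"
proof -
  have w: "reflect \<beta> \<in> weyl \<Delta>" and \<mu>: "of_int k *\<^sub>R coroot \<beta> \<in> coweight_lattice \<Delta>"
    by (simp_all only: reflect_weyl coweight_scale coroot_coweight assms)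
  show "T_op \<Delta> \<alpha> (\<beta>, k) f \<in> M"
    unfolding T_op_def affine_reflect_act restrict_apply'[OF assms(2)]
    by (intro M_closed tvar_M act_M[OF w \<mu>] coeff_divide_M efun_affine_torus_field assms)
  show "T_op \<Delta> \<alpha> (\<beta>, k) 0 = 0"
    using act_0[OF w \<mu>] by (simp add: T_op_def affine_reflect_act M_closed(1))
qed

lemma simple_affine_root_root: "a \<in> simple_affine_roots \<Delta> \<alpha> \<Longrightarrow> fst a \<in> \<Delta>"
  using uminus_root[OF highest_root_in] simple_root by (auto simp: simple_affine_roots_def)

text \<open>
  The generator attached to \<open>\<alpha>\<^sub>0\<close> preserves the module because \<open>\<alpha>\<^sub>0\<close> is an affine root, that is, because
  the highest root is a root. The value at \<open>0\<close> is recorded because \<open>e g e\<close> is to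
  vanish wherever \<open>e\<close> does.
\<close>
lemma daha_M:
  assumes A: "A \<in> {scalar_ring, invert_weyl_poly \<Delta> \<alpha> scalar_ring}" and g: "g \<in> daha \<Delta> \<alpha> A"
  shows "g 0 = 0 \<and> (\<forall>f\<in>M. g f \<in> M)"
  using g
proof induction
  case (daha_torus p)
  then have "p \<in> M" by (intro torus_M torus_ring_field)
  then show ?case by (simp add: mult_op_def M_closed(1,4))
next
  case (daha_scalar a)
  then have "a \<in> M" by (rule algebra_scalars_M[OF A])
  then show ?case by (simp add: mult_op_def M_closed(1,4))
next
  case (daha_T a)
  then show ?case using T_op_M[OF simple_affine_root_root] M_closed(1) by (metis prod.collapse)
next
  case (daha_Omega w \<mu>)
  then have "w \<in> weyl \<Delta>" "\<mu> \<in> coweight_lattice \<Delta>" by (auto simp: Omega_def)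
  then show ?case using M_closed(1) act_0 act_M by simp
next
  case (daha_add g h)
  then show ?case by (simp add: M_closed(1,3))
next
  case (daha_mult g h)
  then show ?case using M_closed(1) by (simp add: compose_def)
qed

lemma T_M: "f \<in> M \<Longrightarrow> T i f \<in> M"
  using T_op_M(1)[OF simple_root] T_op_simple by metis

lemma foldr_T_M: "f \<in> M \<Longrightarrow> foldr T is f \<in> M"
  by (induction "is") (simp_all add: T_M)

lemma T_word_foldr: "f \<in> M \<Longrightarrow> T_word \<Delta> \<alpha> is f = foldr T is f"
proof (induction "is")
  case Nil then show ?case by (simp add: T_word_def mult_op_def)
next
  case (Cons i "is")
  then show ?case using T_op_simple foldr_T_M by (simp add: T_word_def compose_def)
qed

lemma T_weyl_Tw: "f \<in> M \<Longrightarrow> T_weyl \<Delta> \<alpha> w f = Tw w f"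
  by (simp add: T_weyl_def Tw_def T_word_foldr)

lemma Tw_M: "f \<in> M \<Longrightarrow> Tw w f \<in> M"
  unfolding Tw_def by (rule foldr_T_M)

lemma sph_idem_Sym: "f \<in> M \<Longrightarrow> sph_idem \<Delta> \<alpha> f = 1 / W * Sym f"
  by (simp add: sph_idem_def Sym_def T_weyl_Tw)

lemma Sym_M: "f \<in> M \<Longrightarrow> Sym f \<in> M"
  unfolding Sym_def by (intro subring_sum M_subring M_closed subring_power tvar_M Tw_M)

lemma sph_idem_M: "f \<in> M \<Longrightarrow> sph_idem \<Delta> \<alpha> f \<in> M"
  unfolding sph_idem_Sym by (intro M_closed inverse_weyl_poly_M Sym_M)

lemma sph_idem_invariant: "f \<in> M \<Longrightarrow> s i (sph_idem \<Delta> \<alpha> f) = sph_idem \<Delta> \<alpha> f"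
  using T_Sym[of i f] by (simp add: sph_idem_Sym s_hom s_W T_eq_tvar_iff)

lemma Sym_add: "Sym (f + g) = Sym f + Sym g"
  by (simp add: Sym_def Tw_add distrib_left sum.distrib)

lemma Sym_scale: "(\<And>i. s i a = a) \<Longrightarrow> Sym (a * f) = a * Sym f"
  by (simp add: Sym_def Tw_scale sum_distrib_left ac_simps)

lemma Sym_0: "Sym 0 = 0"
proof -
  have "s i 0 = 0" for i using act_0[OF simple_reflect_weyl zero_coweight] by (simp add: shift_0)
  from Sym_scale[of 0 0, OF this] show ?thesis by simp
qed

lemma Sym_diff: "Sym (f - g) = Sym f - Sym g"
  using Sym_add[of "f - g" g] by simp

lemma sph_idem_kills: "f \<in> M \<Longrightarrow> sph_idem \<Delta> \<alpha> (T i f - tvar * f) = 0"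
proof -
  assume f: "f \<in> M"
  have "T i f - tvar * f \<in> M" using f by (intro M_closed T_M tvar_M)
  then show ?thesis by (simp add: sph_idem_Sym Sym_diff Sym_T Sym_scale s_hom)
qed

lemma invariant_Tw:
  assumes w: "w \<in> weyl \<Delta>" and f: "\<And>i. s i f = f" shows "Tw w f = tvar ^ len w * f"
proof -
  have a: "foldr T is f = tvar ^ length is * f" for "is"
    by (induction "is") (use f T_eq_tvar_iff in \<open>simp_all add: T_scale s_tvar_power\<close>)
  have "length (SOME is. word_prod \<alpha> is = w \<and> length is = len w) = len w"
    using someI_ex[OF len_word[OF w]] by blast
  then show ?thesis by (simp add: Tw_def a)
qed

lemma sph_idem_fixes:
  assumes "\<And>i. s i f = f" "f \<in> M" shows "sph_idem \<Delta> \<alpha> f = f"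
proof -
  have "Sym f = (\<Sum>w\<in>weyl \<Delta>. tvar ^ (2 * len w)) * f"
    unfolding Sym_def sum_distrib_right
    by (rule sum.cong) (simp_all add: invariant_Tw assms mult_2 power_add)
  then show ?thesis using weyl_poly_nz by (simp add: sph_idem_Sym assms weyl_poly_def)
qed

definition hecke_factor :: "'n \<Rightarrow> 'n ratfun" where "hecke_factor i = t_sum - hcoth (\<alpha> i)"

lemma T_minus_tvar: "T i f - tvar * f = hecke_factor i * (s i f - f)"
  by (simp add: T_eq_E hecke_factor_def algebra_simps)

lemma s_hecke_factor: "s i (hecke_factor i) = hcoth (\<alpha> i)"
  by (simp add: hecke_factor_def s_hom s_hcoth simple_root reflect_self simple_nz hcoth_uminus)

lemma hecke_factor_formula: "hecke_factor i = (tvar * efun \<alpha> (\<alpha> i) - inverse tvar) / (efun \<alpha> (\<alpha> i) - 1)"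
  unfolding hecke_factor_def hcoth_def by (rule coth_complement[OF root_efun[OF simple_root]])

lemma s_eq_0_iff: "s i f = 0 \<longleftrightarrow> f = 0"
  using act_eq_0_iff[OF simple_reflect_weyl zero_coweight] by (simp add: shift_0)

text \<open>
  Otherwise \<open>T\<^sub>i\<close> would be the scalar \<open>t\<close> and \<open>s\<^sub>i\<close> the identity, contrary to its effect on \<open>e\<^bsup>\<alpha>\<^sub>i\<^esup>\<close>.
\<close>
lemma hecke_factor_nz: "hecke_factor i \<noteq> 0"
proof
  assume "hecke_factor i = 0"
  then have "T i f = tvar * f" for f using T_minus_tvar[of i f] by simp
  then have "s i f = f" for f using T_eq_tvar_iff by blast
  from this[of "efun \<alpha> (\<alpha> i)"] have "efun \<alpha> (- \<alpha> i) = efun \<alpha> (\<alpha> i)"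
    by (simp add: weyl_op_efun simple_reflect_weyl root_lattice simple_root reflect_self simple_nz)
  then have "efun \<alpha> (\<alpha> i + \<alpha> i) = 1"
    using efun_nz[of "\<alpha> i"] by (simp add: efun_add efun_uminus root_lattice simple_root) (metis right_inverse)
  then show False using efun_eq_1[OF lattice_add[OF root_lattice[OF simple_root] root_lattice[OF simple_root]], of i i]
    simple_nz[of i] by (simp add: scaleR_2[symmetric])
qed

lemma hecke_factor_M: "hecke_factor i \<in> M"
  unfolding hecke_factor_formula divide_inverse
  by (intro M_closed tvar_M torus_M torus_field_inverse subringD[OF torus_field_subring] torus_ring_field efun_torus)

lemma hecke_factor_ratio: "hecke_factor i / s i (hecke_factor i) = (tvar\<^sup>2 * efun \<alpha> (\<alpha> i) - 1) / (efun \<alpha> (\<alpha> i) - tvar\<^sup>2)"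
proof -
  let ?x = "efun \<alpha> (\<alpha> i)"
  have "hecke_factor i / s i (hecke_factor i) = (tvar * ?x - inverse tvar) / (?x * inverse tvar - tvar)"
    unfolding s_hecke_factor unfolding hecke_factor_formula hcoth_def using root_efun[OF simple_root, of i] by simp
  also have "\<dots> = (tvar * (tvar * ?x - inverse tvar)) / (tvar * (?x * inverse tvar - tvar))"
    by (rule mult_divide_mult_cancel_left[OF tnz, symmetric])
  also have "tvar * (tvar * ?x - inverse tvar) = tvar\<^sup>2 * ?x - 1"
    using tnz by (simp add: right_diff_distrib power2_eq_square)
  also have "tvar * (?x * inverse tvar - tvar) = ?x - tvar\<^sup>2"
    using tnz by (simp add: right_diff_distrib power2_eq_square)
  finally show ?thesis .
qed

abbreviation P where "P \<equiv> weyl \<Delta> \<times> coweight_lattice \<Delta>"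

definition pair_act :: "('v \<Rightarrow> 'v) \<times> 'v \<Rightarrow> 'n ratfun \<Rightarrow> 'n ratfun" where
  "pair_act p = act (fst p) (snd p)"

context
  fixes c :: "('v \<Rightarrow> 'v) \<times> 'v \<Rightarrow> 'n ratfun" and S
  assumes S: "S = {p \<in> P. c p \<noteq> 0}" and fin: "finite S"
begin

definition expansion :: "'n ratfun \<Rightarrow> 'n ratfun" where
  "expansion f = (\<Sum>p\<in>S. c p * pair_act p f)"

lemma S_P: "S \<subseteq> P" unfolding S by blast

lemma pair_operators_independent:
  assumes "R \<subseteq> P" "finite R" "\<And>f. f \<in> M \<Longrightarrow> (\<Sum>p\<in>R. d p * pair_act p f) = 0" "p \<in> R"
  shows "d p = 0"
proof -
  have "(\<lambda>w \<mu>. d (w, \<mu>)) (fst p) (snd p) = 0"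
    by (rule operators_independent[OF assms(1,2), where a = "\<lambda>w \<mu>. d (w, \<mu>)"])
       (use assms(3)[OF monomial_fun_M] assms(4) in \<open>simp_all add: pair_act_def case_prod_beta\<close>)
  then show ?thesis by simp
qed

text \<open>
  Comparison of coefficients for two expansions, one of which has its operators permuted by an
  involution \<open>\<phi>\<close> of the index set. The support need not be stable under \<open>\<phi>\<close>, so both sums are first
  extended to its union with its image.
\<close>
lemma reindexed_expansion:
  assumes \<phi>: "\<And>p. p \<in> P \<Longrightarrow> \<phi> p \<in> P" "\<And>p. p \<in> P \<Longrightarrow> \<phi> (\<phi> p) = p"
    and a: "\<And>p. p \<in> P \<Longrightarrow> c p = 0 \<Longrightarrow> a p = 0" and b: "\<And>p. p \<in> P \<Longrightarrow> c p = 0 \<Longrightarrow> b p = 0"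
  shows "(\<forall>f\<in>M. (\<Sum>p\<in>S. a p * pair_act (\<phi> p) f) = (\<Sum>p\<in>S. b p * pair_act p f)) \<longleftrightarrow> (\<forall>p\<in>P. a (\<phi> p) = b p)"
proof -
  define R where "R = S \<union> \<phi> ` S"
  have "\<phi> ` S \<subseteq> P" using S_P \<phi>(1) by blast
  then have R: "R \<subseteq> P" "finite R" "S \<subseteq> R" using S_P fin unfolding R_def by auto
  have z: "c p = 0" if "p \<in> P" "p \<notin> S" for p using that S by auto
  have bij: "bij_betw \<phi> R R"
  proof (rule bij_betw_byWitness[of _ \<phi>])
    show "\<forall>p\<in>R. \<phi> (\<phi> p) = p" using R(1) \<phi>(2) by blast
    then show "\<forall>p\<in>R. \<phi> (\<phi> p) = p" .
    show "\<phi> ` R \<subseteq> R" using S_P \<phi>(2) unfolding R_def by (auto simp del: mem_Sigma_iff) (metis subsetD)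
    then show "\<phi> ` R \<subseteq> R" .
  qed
  have out: "a (\<phi> p) = 0 \<and> b p = 0" if "p \<in> P" "p \<notin> R" for p
  proof -
    have "\<phi> p \<notin> S" using that \<phi>(2)[OF that(1)] unfolding R_def by (metis UnI2 imageI)
    then show ?thesis using that z[of p] z[of "\<phi> p"] a[of "\<phi> p"] b[of p] \<phi>(1)[of p] R(3) by blast
  qed
  have "(\<Sum>p\<in>S. a p * pair_act (\<phi> p) f) = (\<Sum>p\<in>R. a (\<phi> p) * pair_act p f)" for f
  proof -
    have "(\<Sum>p\<in>S. a p * pair_act (\<phi> p) f) = (\<Sum>p\<in>R. a p * pair_act (\<phi> p) f)"
      by (rule sum.mono_neutral_left) (use R a z in auto)
    also have "\<dots> = (\<Sum>p\<in>R. a (\<phi> p) * pair_act (\<phi> (\<phi> p)) f)"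
      by (rule sum.reindex_bij_betw[OF bij, of "\<lambda>p. a p * pair_act (\<phi> p) f", symmetric])
    also have "\<dots> = (\<Sum>p\<in>R. a (\<phi> p) * pair_act p f)"
      by (rule sum.cong) (use R(1) \<phi>(2) in auto)
    finally show ?thesis .
  qed
  moreover have "(\<Sum>p\<in>S. b p * pair_act p f) = (\<Sum>p\<in>R. b p * pair_act p f)" for f
    by (rule sum.mono_neutral_left) (use R b z in auto)
  ultimately have e: "(\<Sum>p\<in>S. a p * pair_act (\<phi> p) f) = (\<Sum>p\<in>S. b p * pair_act p f) \<longleftrightarrow>
      (\<Sum>p\<in>R. (a (\<phi> p) - b p) * pair_act p f) = 0" for f
    by (simp add: left_diff_distrib sum_subtractf)
  show ?thesis
  proof
    assume "\<forall>f\<in>M. (\<Sum>p\<in>S. a p * pair_act (\<phi> p) f) = (\<Sum>p\<in>S. b p * pair_act p f)"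
    then have "(\<Sum>p\<in>R. (a (\<phi> p) - b p) * pair_act p f) = 0" if "f \<in> M" for f using e that by blast
    from pair_operators_independent[OF R(1,2) this] have "a (\<phi> p) = b p" if "p \<in> R" for p using that by auto
    then show "\<forall>p\<in>P. a (\<phi> p) = b p" using out by metis
  next
    assume "\<forall>p\<in>P. a (\<phi> p) = b p"
    then have z: "a (\<phi> p) - b p = 0" if "p \<in> R" for p using R(1) that by (metis right_minus_eq subsetD)
    have "(\<Sum>p\<in>R. (a (\<phi> p) - b p) * pair_act p f) = 0" for f by (rule sum.neutral) (simp add: z)
    then show "\<forall>f\<in>M. (\<Sum>p\<in>S. a p * pair_act (\<phi> p) f) = (\<Sum>p\<in>S. b p * pair_act p f)"
      using e by blast
  qed
qed

lemma invariant_iff: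
  "(\<forall>f\<in>M. s i (expansion f) = expansion f) \<longleftrightarrow>
   (\<forall>w\<in>weyl \<Delta>. \<forall>\<mu>\<in>coweight_lattice \<Delta>. c (reflect (\<alpha> i) \<circ> w, reflect (\<alpha> i) \<mu>) = s i (c (w, \<mu>)))"
proof -
  let ?\<phi> = "\<lambda>(w, \<mu>). (reflect (\<alpha> i) \<circ> w, reflect (\<alpha> i) \<mu>)"
  have \<phi>: "?\<phi> p \<in> P" "?\<phi> (?\<phi> p) = p" if "p \<in> P" for p
    using that weyl_comp[OF simple_reflect_weyl] weyl_coweight[OF simple_reflect_weyl]
    by (auto simp: reflect_cancel reflect_reflect)
  have e: "s i (expansion f) = (\<Sum>p\<in>S. s i (c p) * pair_act (?\<phi> p) f)" for f
  proof -
    have "s i (expansion f) = (\<Sum>p\<in>S. s i (c p * pair_act p f))"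
      using act_sum[OF simple_reflect_weyl zero_coweight] by (simp add: expansion_def shift_0)
    also have "\<dots> = (\<Sum>p\<in>S. s i (c p) * pair_act (?\<phi> p) f)"
      using S_P weyl_op_act[OF simple_reflect_weyl] by (intro sum.cong) (auto simp: s_hom pair_act_def)
    finally show ?thesis .
  qed
  have "(\<forall>f\<in>M. s i (expansion f) = expansion f) \<longleftrightarrow> (\<forall>p\<in>P. s i (c (?\<phi> p)) = c p)"
    unfolding e unfolding expansion_def
    by (rule reindexed_expansion[OF \<phi>, where a = "\<lambda>p. s i (c p)" and b = c]) (simp_all add: s_eq_0_iff)
  also have "\<dots> \<longleftrightarrow> (\<forall>p\<in>P. c (?\<phi> p) = s i (c p))"
  proof (rule ball_cong[OF refl])
    show "s i (c (?\<phi> p)) = c p \<longleftrightarrow> c (?\<phi> p) = s i (c p)" for p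
      using s_hom(8)[of i "c (?\<phi> p)"] s_hom(8)[of i "c p"] by (metis (no_types))
  qed
  finally show ?thesis by auto
qed

lemma annihilates_iff:
  "(\<forall>f\<in>M. expansion (hecke_factor i * (s i f - f)) = 0) \<longleftrightarrow>
   (\<forall>w\<in>weyl \<Delta>. \<forall>\<mu>\<in>coweight_lattice \<Delta>. c (w \<circ> reflect (\<alpha> i), \<mu>) = c (w, \<mu>) * act w \<mu> (hecke_factor i / s i (hecke_factor i)))"
proof -
  let ?\<phi> = "\<lambda>(w, \<mu>). (w \<circ> reflect (\<alpha> i), \<mu>)"
  have \<phi>: "?\<phi> p \<in> P" "?\<phi> (?\<phi> p) = p" if "p \<in> P" for p
    using that weyl_comp[OF _ simple_reflect_weyl] by (auto simp: reflect_cancel_right)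
  have e: "expansion (hecke_factor i * (s i f - f)) = (\<Sum>p\<in>S. c p * pair_act p (hecke_factor i) * pair_act (?\<phi> p) f) - (\<Sum>p\<in>S. c p * pair_act p (hecke_factor i) * pair_act p f)" for f
    unfolding expansion_def sum_subtractf[symmetric]
  proof (rule sum.cong)
    fix p assume "p \<in> S"
    then obtain w \<mu> where p: "p = (w, \<mu>)" "w \<in> weyl \<Delta>" "\<mu> \<in> coweight_lattice \<Delta>" using S_P by blast
    show "c p * pair_act p (hecke_factor i * (s i f - f)) = c p * pair_act p (hecke_factor i) * pair_act (?\<phi> p) f - c p * pair_act p (hecke_factor i) * pair_act p f"
      using act_weyl_op[OF simple_reflect_weyl p(2)]
      by (simp add: p pair_act_def act_mult[OF p(2,3)] act_diff[OF p(2,3)] algebra_simps)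
  qed simp
  have "(\<forall>f\<in>M. expansion (hecke_factor i * (s i f - f)) = 0) \<longleftrightarrow> (\<forall>p\<in>P. c (?\<phi> p) * pair_act (?\<phi> p) (hecke_factor i) = c p * pair_act p (hecke_factor i))"
    unfolding e right_minus_eq
    by (rule reindexed_expansion[OF \<phi>, where a = "\<lambda>p. c p * pair_act p (hecke_factor i)" and b = "\<lambda>p. c p * pair_act p (hecke_factor i)"]) simp_all
  also have "\<dots> \<longleftrightarrow> (\<forall>p\<in>P. c (?\<phi> p) = c p * pair_act p (hecke_factor i / s i (hecke_factor i)))"
  proof (rule ball_cong[OF refl])
    fix p assume "p \<in> P"
    then obtain w \<mu> where p: "p = (w, \<mu>)" "w \<in> weyl \<Delta>" "\<mu> \<in> coweight_lattice \<Delta>" by blast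
    have 1: "pair_act (?\<phi> p) (hecke_factor i) = pair_act p (s i (hecke_factor i))"
      using act_weyl_op[OF simple_reflect_weyl p(2)] by (simp add: p pair_act_def)
    have nz: "pair_act p (s i (hecke_factor i)) \<noteq> 0"
      using hecke_factor_nz by (simp add: p pair_act_def act_eq_0_iff[OF p(2,3)] s_eq_0_iff)
    have 2: "pair_act p (hecke_factor i / s i (hecke_factor i)) = pair_act p (hecke_factor i) / pair_act p (s i (hecke_factor i))"
      by (simp add: p pair_act_def act_divide[OF p(2,3)])
    show "c (?\<phi> p) * pair_act (?\<phi> p) (hecke_factor i) = c p * pair_act p (hecke_factor i) \<longleftrightarrow> c (?\<phi> p) = c p * pair_act p (hecke_factor i / s i (hecke_factor i))"
      by (simp only: 1 2 times_divide_eq_right nonzero_eq_divide_eq[OF nz])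
  qed
  finally show ?thesis by (auto simp: pair_act_def)
qed

lemma expansion_add: "expansion (f + g) = expansion f + expansion g"
  unfolding expansion_def sum.distrib[symmetric] using S_P
  by (intro sum.cong) (auto simp: pair_act_def act_add distrib_left)

lemma expansion_scale:
  assumes "\<And>w \<mu>. w \<in> weyl \<Delta> \<Longrightarrow> \<mu> \<in> coweight_lattice \<Delta> \<Longrightarrow> act w \<mu> a = a"
  shows "expansion (a * f) = a * expansion f"
  unfolding expansion_def sum_distrib_left using S_P assms
  by (intro sum.cong) (auto simp: pair_act_def act_mult)

lemma expansion_M:
  assumes "\<And>p. p \<in> P \<Longrightarrow> c p \<in> M" "f \<in> M" shows "expansion f \<in> M"
  unfolding expansion_def using S_P assms(1) act_M[OF _ _ assms(2)]
  by (intro subring_sum M_subring M_closed) (auto simp: pair_act_def)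

lemma expansion_sum: "expansion (\<Sum>x\<in>X. g x) = (\<Sum>x\<in>X. expansion (g x))"
proof -
  have "expansion 0 + expansion 0 = expansion 0 + 0" using expansion_add[of 0 0] by simp
  then have "expansion 0 = 0" by (rule add_left_imp_eq)
  then show ?thesis by (induction X rule: infinite_finite_induct) (simp_all add: expansion_add)
qed

text \<open>
  From right to left, \<open>H\<close> itself serves as the element between the two idempotents, which covers
  both rings of scalars at once.
\<close>
lemma spherical_iff_invariant:
  assumes A: "A \<in> {scalar_ring, invert_weyl_poly \<Delta> \<alpha> scalar_ring}"
    and cM: "\<And>p. p \<in> P \<Longrightarrow> c p \<in> M"
    and H: "H = (\<lambda>f\<in>M. expansion f)" "H \<in> daha \<Delta> \<alpha> A"
  shows "H \<in> spherical \<Delta> \<alpha> A \<longleftrightarrow>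
    (\<forall>i. \<forall>f\<in>M. s i (expansion f) = expansion f \<and> expansion (hecke_factor i * (s i f - f)) = 0)"
proof
  let ?e = "sph_idem \<Delta> \<alpha>"
  assume "H \<in> spherical \<Delta> \<alpha> A"
  then obtain g where g: "g \<in> daha \<Delta> \<alpha> A" "H = compose M ?e (compose M g ?e)"
    unfolding spherical_def by blast
  have gM: "g 0 = 0" "\<And>f. f \<in> M \<Longrightarrow> g f \<in> M" using daha_M[OF A g(1)] by auto
  have Hf: "expansion f = ?e (g (?e f))" if "f \<in> M" for f
  proof -
    have "H f = ?e (g (?e f))" using that unfolding g(2) by (simp add: compose_def)
    then show ?thesis using H(1) that by simp
  qed
  show "\<forall>i. \<forall>f\<in>M. s i (expansion f) = expansion f \<and> expansion (hecke_factor i * (s i f - f)) = 0"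
  proof (intro allI ballI conjI)
    fix i f assume f: "f \<in> M"
    show "s i (expansion f) = expansion f"
      unfolding Hf[OF f] using f by (intro sph_idem_invariant gM sph_idem_M)
    have "hecke_factor i * (s i f - f) \<in> M" using f by (intro M_closed hecke_factor_M s_M)
    then have "expansion (hecke_factor i * (s i f - f)) = ?e (g (?e (T i f - tvar * f)))"
      unfolding T_minus_tvar by (rule Hf)
    also have "\<dots> = 0" using f by (simp add: sph_idem_kills gM(1) sph_idem_Sym M_closed(1) Sym_0)
    finally show "expansion (hecke_factor i * (s i f - f)) = 0" .
  qed
next
  let ?e = "sph_idem \<Delta> \<alpha>"
  assume inv: "\<forall>i. \<forall>f\<in>M. s i (expansion f) = expansion f \<and> expansion (hecke_factor i * (s i f - f)) = 0"
  have T: "expansion (T i f) = tvar * expansion f" if "f \<in> M" for i f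
  proof -
    have "expansion (T i f) = expansion (hecke_factor i * (s i f - f) + tvar * f)" unfolding T_minus_tvar[symmetric] by simp
    then show ?thesis using inv that by (simp add: expansion_add expansion_scale act_tvar)
  qed
  have fT: "expansion (foldr T is f) = tvar ^ length is * expansion f" if "f \<in> M" for "is" f
    by (induction "is") (simp_all add: T foldr_T_M that)
  have Tw: "expansion (Tw w f) = tvar ^ len w * expansion f" if w: "w \<in> weyl \<Delta>" and f: "f \<in> M" for w f
  proof -
    have "length (SOME is. word_prod \<alpha> is = w \<and> length is = len w) = len w"
      using someI_ex[OF len_word[OF w]] by blast
    then show ?thesis by (simp add: Tw_def fT[OF f])
  qed
  have right: "expansion (?e f) = expansion f" if f: "f \<in> M" for f
  proof -
    have "expansion (?e f) = 1 / W * (\<Sum>w\<in>weyl \<Delta>. tvar ^ len w * expansion (Tw w f))"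
      unfolding sph_idem_Sym[OF f] Sym_def
      by (simp only: expansion_scale act_divide act_1 act_W expansion_sum act_power act_tvar)
    also have "\<dots> = 1 / W * (W * expansion f)"
      unfolding weyl_poly_def sum_distrib_right
      by (simp add: Tw f mult_2 power_add mult.assoc)
    finally show ?thesis using weyl_poly_nz by simp
  qed
  have "H f = compose M ?e (compose M H ?e) f" for f
  proof (cases "f \<in> M")
    case True
    have "?e (H (?e f)) = ?e (expansion f)" using True sph_idem_M[OF True] H(1) right by simp
    also have "\<dots> = expansion f" using inv True expansion_M[OF cM] by (intro sph_idem_fixes) blast+
    finally show ?thesis using True H(1) by (simp add: compose_def)
  next
    case False then show ?thesis using H(1) by (simp add: compose_def)
  qed
  then have "H = compose M ?e (compose M H ?e)" by (rule ext)
  then show "H \<in> spherical \<Delta> \<alpha> A" unfolding spherical_def using H(2) by blast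
qed

end
end

theorem theorem8p1:
  fixes \<Delta> :: "'v::euclidean_space set"
    and \<alpha> :: "'n::{finite,linorder} \<Rightarrow> 'v"
    and A :: "'n ratfun set"
    and h :: "'n ratfun \<Rightarrow> 'n ratfun"
    and c :: "('v \<Rightarrow> 'v) \<Rightarrow> 'v \<Rightarrow> 'n ratfun"
  assumes "irreducible_root_system \<Delta>"
    and "simple_system \<Delta> \<alpha>"
    and "A \<in> {scalar_ring, invert_weyl_poly \<Delta> \<alpha> scalar_ring}"
    and "h \<in> daha \<Delta> \<alpha> A"
    and "\<forall>w\<in>weyl \<Delta>. \<forall>\<mu>\<in>coweight_lattice \<Delta>. c w \<mu> \<in> fun_module \<Delta> \<alpha>"
    and "finite (coeff_support \<Delta> c)"
    and "h = (\<lambda>f\<in>fun_module \<Delta> \<alpha>.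
               \<Sum>(w, \<mu>)\<in>coeff_support \<Delta> c. c w \<mu> * shift_op \<alpha> \<mu> (weyl_op \<alpha> w f))"
  shows "h \<in> spherical \<Delta> \<alpha> A \<longleftrightarrow>
    (\<forall>i. \<forall>w\<in>weyl \<Delta>. \<forall>\<mu>\<in>coweight_lattice \<Delta>.
       c (reflect (\<alpha> i) \<circ> w) (reflect (\<alpha> i) \<mu>) = weyl_op \<alpha> (reflect (\<alpha> i)) (c w \<mu>) \<and>
       c (w \<circ> reflect (\<alpha> i)) \<mu> =
         c w \<mu> * shift_op \<alpha> \<mu> (weyl_op \<alpha> w
           ((tvar\<^sup>2 * efun \<alpha> (\<alpha> i) - 1) / (efun \<alpha> (\<alpha> i) - tvar\<^sup>2))))"
proof -
  interpret root_functions \<Delta> \<alpha> by unfold_locales (fact assms)+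
  let ?c = "case_prod c" and ?S = "coeff_support \<Delta> c"
  have S: "?S = {p \<in> P. ?c p \<noteq> 0}" by (auto simp: coeff_support_def)
  have H: "h = (\<lambda>f\<in>M. expansion ?c ?S f)"
    unfolding assms(7) expansion_def[OF S assms(6)] by (simp add: pair_act_def case_prod_beta)
  have cM: "?c p \<in> M" if "p \<in> P" for p using that assms(5) by auto
  have "h \<in> spherical \<Delta> \<alpha> A \<longleftrightarrow> (\<forall>i. (\<forall>f\<in>M. s i (expansion ?c ?S f) = expansion ?c ?S f) \<and>
      (\<forall>f\<in>M. expansion ?c ?S (hecke_factor i * (s i f - f)) = 0))"
    by (subst spherical_iff_invariant[OF S assms(6) assms(3) cM H assms(4)]) blast+
  also have "\<dots> \<longleftrightarrow> (\<forall>i. \<forall>w\<in>weyl \<Delta>. \<forall>\<mu>\<in>coweight_lattice \<Delta>.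
       c (reflect (\<alpha> i) \<circ> w) (reflect (\<alpha> i) \<mu>) = weyl_op \<alpha> (reflect (\<alpha> i)) (c w \<mu>) \<and>
       c (w \<circ> reflect (\<alpha> i)) \<mu> = c w \<mu> * act w \<mu> (hecke_factor i / s i (hecke_factor i)))"
    unfolding invariant_iff[OF S assms(6)] annihilates_iff[OF S assms(6)] by auto
  finally show ?thesis unfolding hecke_factor_ratio .
qed

end
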